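(* Let $\ell>0$, $\mathcal I=[0,\ell]$, and let $\mathsf P:\mathcal B(\mathbb R)\to\mathcal L(L^2(\mathcal I))$ be the momentum POVM of a particle confined to $\mathcal I$. Then $$\mathsf P'[1]=P_0\qquad\text{and}\qquad\mathsf P'[2n]=(P_0^n)^*P_0^n\quad(n=1,2,\ldots).$$
   Context: Inner products are linear in the second argument. $\mathcal B(\mathbb R)$ is the Borel $\sigma$-algebra and $\mathcal L(\cdot)$ denotes bounded operators. Momentum POVM: Let $\mathcal F:L^2(\mathbb R)\to L^2(\mathbb R)$ be the unitary Fourier–Plancherel operator, $(\mathcal F\psi)(x)=\frac1{\sqrt{2\pi}}\int_{\mathbb R}e^{-ixt}\psi(t)\,dt$ for $\psi\in L^1(\mathbb R)\cap L^2(\mathbb R)$. Let $(\mathsf Q_{\mathbb R}(Y)\psi)(x)=\chi_Y(x)\psi(x)$ and $\mathsf P_{\mathbb R}(Y)=\mathcal F^*\mathsf Q_{\mathbb R}(Y)\mathcal F$ for $Y\in\mathcal B(\mathbb R)$. Let $U:L^2(\mathcal I)\to L^2(\mathbb R)$ be the isometry extending functions by $0$ outside $\mathcal I$. Then $\mathsf P(Y):=U^*\mathsf P_{\mathbb R}(Y)U$, $Y\in\mathcal B(\mathbb R)$. It is a normalized POVM (strongly $\sigma$-additive, positive operator valued, $\mathsf P(\mathbb R)=I$). $\mathsf P_{\psi,\varphi}$ denotes the complex measure $Y\mapsto\langle\psi|\mathsf P(Y)\varphi\rangle$; it has density $x\mapsto\overline{(\mathcal FU\psi)(x)}(\mathcal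 FU\varphi)(x)$. Weak moment operators: for $k\ge1$ let $\mathcal D_F(x^k,\mathsf P)=\{\varphi\in L^2(\mathcal I):\int|x|^k\,d\mathsf P_{\varphi,\varphi}(x)<\infty\}$. This is a dense linear subspace and $x^k$ is $\mathsf P_{\psi,\varphi}$-integrable for all $\psi,\varphi$ in it. $\mathsf P'[k]$ is the linear operator with domain $\{\varphi\in\mathcal D_F(x^k,\mathsf P):\mathcal D_F(x^k,\mathsf P)\ni\psi\mapsto\int x^k\,d\mathsf P_{\psi,\varphi}(x)\text{ is (norm) continuous}\}$, determined by $\langle\psi|\mathsf P'[k]\varphi\rangle=\int x^k\,d\mathsf P_{\psi,\varphi}(x)$ for all $\psi\in\mathcal D_F(x^k,\mathsf P)$. $P_0$ is the operator $-i\,d/dx$ in $L^2(\mathcal I)$ whose domain is the set of absolutely continuous $\varphi\in L^2(\mathcal I)$ with $\varphi'\in L^2(\mathcal I)$ and $\varphi(0)=\varphi(\ell)=0$; $P_0^n$ is its $n$-fold composition with natural domain. Products of operators have their natural domains; equality of operators includes equality of domains. *)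

theory Defs
  imports "HOL-Analysis.Analysis"
begin

section \<open>The Hilbert space of square integrable functions\<close>

definition square_integrable :: "'a measure \<Rightarrow> ('a \<Rightarrow> complex) set" where
  "square_integrable M =
     {f \<in> borel_measurable M. integrable M (\<lambda>x. (cmod (f x))\<^sup>2)}"

definition ae_rel :: "'a measure \<Rightarrow> (('a \<Rightarrow> complex) \<times> ('a \<Rightarrow> complex)) set" where
  "ae_rel M = {(f, g). f \<in> square_integrable M \<and> g \<in> square_integrable M \<and>
                       (AE x in M. f x = g x)}"

definition L2 :: "'a measure \<Rightarrow> ('a \<Rightarrow> complex) set set" where
  "L2 M = square_integrable M // ae_rel M"

definition L2_class :: "'a measure \<Rightarrow> ('a \<Rightarrow> complex) \<Rightarrow> ('a \<Rightarrow> complex) set" where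
  "L2_class M f = ae_rel M `` {f}"

definition L2_rep :: "('a \<Rightarrow> complex) set \<Rightarrow> 'a \<Rightarrow> complex" where
  "L2_rep \<Phi> = (SOME f. f \<in> \<Phi>)"

definition L2_inner ::
    "'a measure \<Rightarrow> ('a \<Rightarrow> complex) set \<Rightarrow> ('a \<Rightarrow> complex) set \<Rightarrow> complex" where
  "L2_inner M \<Phi> \<Psi> = (\<integral>x. cnj (L2_rep \<Phi> x) * L2_rep \<Psi> x \<partial>M)"

definition L2_dist ::
    "'a measure \<Rightarrow> ('a \<Rightarrow> complex) set \<Rightarrow> ('a \<Rightarrow> complex) set \<Rightarrow> real" where
  "L2_dist M \<Phi> \<Psi> = sqrt (\<integral>x. (cmod (L2_rep \<Phi> x - L2_rep \<Psi> x))\<^sup>2 \<partial>M)"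

abbreviation L2_topology :: "'a measure \<Rightarrow> ('a \<Rightarrow> complex) set topology" where
  "L2_topology M \<equiv> Metric_space.mtopology (L2 M) (L2_dist M)"

text \<open>The inner product and the distance do not depend on the chosen representatives.\<close>

lemma equiv_ae_rel: "equiv (square_integrable M) (ae_rel M)"
proof (rule equivI)
  show "ae_rel M \<subseteq> square_integrable M \<times> square_integrable M"
    by (auto simp: ae_rel_def)
  show "refl_on (square_integrable M) (ae_rel M)"
    by (auto simp: refl_on_def ae_rel_def)
  show "sym (ae_rel M)"
    by (auto simp: sym_def ae_rel_def elim: eventually_mono)
  show "trans (ae_rel M)"
    by (auto simp: trans_def ae_rel_def elim: eventually_elim2)
qed

lemma L2_class_in_L2: "f \<in> square_integrable M \<Longrightarrow> L2_class M f \<in> L2 M"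
  by (simp add: L2_def L2_class_def quotientI)

lemma L2_rep_class:
  assumes "f \<in> square_integrable M"
  shows "L2_rep (L2_class M f) \<in> square_integrable M"
    and "AE x in M. L2_rep (L2_class M f) x = f x"
proof -
  have "f \<in> L2_class M f"
    using assms by (simp add: L2_class_def ae_rel_def)
  then have "L2_rep (L2_class M f) \<in> L2_class M f"
    unfolding L2_rep_def by (rule someI[where P = "\<lambda>h. h \<in> L2_class M f"])
  then show "L2_rep (L2_class M f) \<in> square_integrable M"
    and "AE x in M. L2_rep (L2_class M f) x = f x"
    by (auto simp: L2_class_def ae_rel_def elim: eventually_mono)
qed

lemma L2_inner_class:
  assumes f: "f \<in> square_integrable M" and g: "g \<in> square_integrable M"
  shows "L2_inner M (L2_class M f) (L2_class M g) = (\<integral>x. cnj (f x) * g x \<partial>M)"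
  unfolding L2_inner_def
proof (rule integral_cong_AE)
  show "AE x in M. cnj (L2_rep (L2_class M f) x) * L2_rep (L2_class M g) x = cnj (f x) * g x"
    using L2_rep_class(2)[OF f] L2_rep_class(2)[OF g] by eventually_elim simp
qed (use L2_rep_class(1)[OF f] L2_rep_class(1)[OF g] f g
      in \<open>auto simp: square_integrable_def intro!: borel_measurable_times
            measurable_compose[OF _ borel_measurable_continuous_onI[OF continuous_on_cnj[OF continuous_on_id]]]\<close>)

lemma L2_dist_class:
  assumes f: "f \<in> square_integrable M" and g: "g \<in> square_integrable M"
  shows "L2_dist M (L2_class M f) (L2_class M g) = sqrt (\<integral>x. (cmod (f x - g x))\<^sup>2 \<partial>M)"
proof -
  have "(\<integral>x. (cmod (L2_rep (L2_class M f) x - L2_rep (L2_class M g) x))\<^sup>2 \<partial>M)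
      = (\<integral>x. (cmod (f x - g x))\<^sup>2 \<partial>M)"
  proof (rule integral_cong_AE)
    show "AE x in M. (cmod (L2_rep (L2_class M f) x - L2_rep (L2_class M g) x))\<^sup>2
        = (cmod (f x - g x))\<^sup>2"
      using L2_rep_class(2)[OF f] L2_rep_class(2)[OF g] by eventually_elim simp
  qed (use L2_rep_class(1)[OF f] L2_rep_class(1)[OF g] f g
        in \<open>auto simp: square_integrable_def\<close>)
  then show ?thesis
    by (simp add: L2_dist_def)
qed


section \<open>Operators\<close>

text \<open>
  A (possibly unbounded) operator is identified with its graph, so equality of graphs
  includes equality of domains. The operator product \<open>S T\<close> (first \<open>T\<close>, then \<open>S\<close>), with its
  natural domain, is the relational composition \<open>T O S\<close>, and \<open>T ^^ n\<close> is the \<open>n\<close>-fold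
  composition of \<open>T\<close>.
\<close>

type_synonym ('a, 'b) operator = "(('a \<Rightarrow> complex) set \<times> ('b \<Rightarrow> complex) set) set"

definition op_apply ::
    "('a, 'b) operator \<Rightarrow> ('a \<Rightarrow> complex) set \<Rightarrow> ('b \<Rightarrow> complex) set" where
  "op_apply T \<Phi> = (THE \<Psi>. (\<Phi>, \<Psi>) \<in> T)"

definition adjoint_op ::
    "'a measure \<Rightarrow> 'b measure \<Rightarrow> ('a, 'b) operator \<Rightarrow> ('b, 'a) operator" where
  "adjoint_op M N T =
     {(\<Psi>, \<Omega>). \<Psi> \<in> L2 N \<and> \<Omega> \<in> L2 M \<and>
               (\<forall>(\<Phi>, \<Theta>) \<in> T. L2_inner N \<Psi> \<Theta> = L2_inner M \<Omega> \<Phi>)}"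


section \<open>Integrals with respect to complex measures\<close>

text \<open>
  Real and complex measures on the Borel sets are set functions. The positive part of the
  Jordan decomposition of a real measure \<open>m\<close> is \<open>E \<mapsto> sup {m A | A \<subseteq> E}\<close>; the negative part
  is the positive part of \<open>- m\<close>.
\<close>

definition positive_part_measure :: "(real set \<Rightarrow> real) \<Rightarrow> real measure" where
  "positive_part_measure m =
     measure_of UNIV (sets borel) (\<lambda>E. SUP A \<in> {A \<in> sets borel. A \<subseteq> E}. ennreal (m A))"

definition complex_measure_integral ::
    "(real set \<Rightarrow> complex) \<Rightarrow> (real \<Rightarrow> complex) \<Rightarrow> complex" where
  "complex_measure_integral \<mu> f =
     (\<integral>x. f x \<partial>positive_part_measure (\<lambda>Y. Re (\<mu> Y)))
     - (\<integral>x. f x \<partial>positive_part_measure (\<lambda>Y. - Re (\<mu> Y)))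
     + \<i> * ((\<integral>x. f x \<partial>positive_part_measure (\<lambda>Y. Im (\<mu> Y)))
            - (\<integral>x. f x \<partial>positive_part_measure (\<lambda>Y. - Im (\<mu> Y))))"


section \<open>Weak moment operators of a POVM\<close>

definition povm_measure ::
    "'a measure \<Rightarrow> (real set \<Rightarrow> ('a, 'a) operator) \<Rightarrow>
     ('a \<Rightarrow> complex) set \<Rightarrow> ('a \<Rightarrow> complex) set \<Rightarrow> real set \<Rightarrow> complex" where
  "povm_measure M E \<Psi> \<Phi> Y = L2_inner M \<Psi> (op_apply (E Y) \<Phi>)"

definition moment_domain ::
    "'a measure \<Rightarrow> (real set \<Rightarrow> ('a, 'a) operator) \<Rightarrow> nat \<Rightarrow> ('a \<Rightarrow> complex) set set" where
  "moment_domain M E k =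
     {\<Phi> \<in> L2 M.
        (\<integral>\<^sup>+x. ennreal (\<bar>x\<bar> ^ k)
           \<partial>measure_of UNIV (sets borel) (\<lambda>Y. ennreal (Re (povm_measure M E \<Phi> \<Phi> Y)))) < \<infinity>}"

definition weak_moment ::
    "'a measure \<Rightarrow> (real set \<Rightarrow> ('a, 'a) operator) \<Rightarrow> nat \<Rightarrow> ('a, 'a) operator" where
  "weak_moment M E k =
     {(\<Phi>, \<Omega>). \<Phi> \<in> moment_domain M E k \<and>
        continuous_map (subtopology (L2_topology M) (moment_domain M E k)) euclidean
          (\<lambda>\<Psi>. complex_measure_integral (povm_measure M E \<Psi> \<Phi>) (\<lambda>x. complex_of_real x ^ k)) \<and>
        \<Omega> \<in> L2 M \<and>
        (\<forall>\<Psi> \<in> moment_domain M E k.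
           L2_inner M \<Psi> \<Omega> =
             complex_measure_integral (povm_measure M E \<Psi> \<Phi>) (\<lambda>x. complex_of_real x ^ k))}"


section \<open>The momentum POVM of a particle confined to an interval\<close>

abbreviation interval_lborel :: "real \<Rightarrow> real measure" where
  "interval_lborel l \<equiv> restrict_space lborel {0..l}"

definition fourier_integral :: "(real \<Rightarrow> complex) \<Rightarrow> real \<Rightarrow> complex" where
  "fourier_integral f x =
     complex_of_real (1 / sqrt (2 * pi)) *
     (\<integral>t. exp (- (\<i> * complex_of_real x * complex_of_real t)) * f t \<partial>lborel)"

text \<open>
  The continuous extension of the integral transform from the integrable square integrable
  functions to all of \<open>L2 lborel\<close>, given as the closure of the graph.
\<close>

definition fourier_plancherel :: "(real, real) operator" where
  "fourier_plancherel =
     {(\<Phi>, \<Psi>). \<Phi> \<in> L2 lborel \<and> \<Psi> \<in> L2 lborel \<and>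
        (\<forall>e>0. \<exists>f \<in> square_integrable lborel. integrable lborel f \<and>
           L2_dist lborel (L2_class lborel f) \<Phi> < e \<and>
           L2_dist lborel (L2_class lborel (fourier_integral f)) \<Psi> < e)}"

definition position_pvm :: "real set \<Rightarrow> (real, real) operator" where
  "position_pvm Y =
     {(L2_class lborel f, L2_class lborel (\<lambda>x. indicator Y x * f x)) | f.
        f \<in> square_integrable lborel}"

definition momentum_pvm :: "real set \<Rightarrow> (real, real) operator" where
  "momentum_pvm Y =
     fourier_plancherel O position_pvm Y O adjoint_op lborel lborel fourier_plancherel"

definition zero_extension :: "real \<Rightarrow> (real, real) operator" where
  "zero_extension l =
     {(L2_class (interval_lborel l) f, L2_class lborel (\<lambda>x. indicator {0..l} x * f x)) | f.
        f \<in> square_integrable (interval_lborel l)}"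

definition momentum_povm :: "real \<Rightarrow> real set \<Rightarrow> (real, real) operator" where
  "momentum_povm l Y =
     zero_extension l O momentum_pvm Y O
       adjoint_op (interval_lborel l) lborel (zero_extension l)"


section \<open>The minimal momentum operator\<close>

text \<open>\<open>D\<close> below is a finite family of non-overlapping subintervals, given by their endpoints.\<close>

definition absolutely_continuous_fun ::
    "real \<Rightarrow> real \<Rightarrow> (real \<Rightarrow> complex) \<Rightarrow> bool" where
  "absolutely_continuous_fun a b f \<longleftrightarrow>
     (\<forall>e>0. \<exists>d>0. \<forall>D :: (real \<times> real) set.
        finite D \<longrightarrow>
        (\<forall>(u, v) \<in> D. a \<le> u \<and> u < v \<and> v \<le> b) \<longrightarrow>
        disjoint_family_on (\<lambda>(u, v). {u<..<v}) D \<longrightarrow>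
        (\<Sum>(u, v) \<in> D. v - u) < d \<longrightarrow>
        (\<Sum>(u, v) \<in> D. cmod (f v - f u)) < e)"

definition minimal_momentum :: "real \<Rightarrow> (real, real) operator" where
  "minimal_momentum l =
     {(L2_class (interval_lborel l) f, L2_class (interval_lborel l) (\<lambda>x. - \<i> * f' x)) | f f'.
        f \<in> square_integrable (interval_lborel l) \<and>
        f' \<in> square_integrable (interval_lborel l) \<and>
        absolutely_continuous_fun 0 l f \<and> f 0 = 0 \<and> f l = 0 \<and>
        (AE x in interval_lborel l. (f has_vector_derivative f' x) (at x within {0..l}))}"

end

theory Submission
  imports Defs "HOL-Probability.Probability"
begin

text \<open>
  Write \<open>\<F> \<phi>\<close> for the Fourier transform of the extension of \<open>\<phi>\<close> by zero. In this picture all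
  operators act by multiplication. The complex measure of the momentum POVM for \<open>\<psi>\<close> and \<open>\<phi>\<close> has
  the density \<open>cnj (\<F> \<psi>) \<F> \<phi>\<close> (\<open>povm_measure_momentum\<close>), so the \<open>k\<close>-th moment is the
  form \<open>\<integral> x\<^sup>k cnj (\<F> \<psi>) \<F> \<phi>\<close>, defined for those \<open>\<phi>\<close> for which \<open>|x|\<^sup>k |\<F> \<phi>|\<^sup>2\<close> is
  integrable (\<open>moment_domain_iff\<close>). The weak moment operator sends \<open>\<phi>\<close> to the vector that
  represents this form; the required continuity is automatic as soon as such a vector exists
  (\<open>weak_moment_iff\<close>).

  The minimal momentum operator \<open>P\<^sub>0\<close> becomes multiplication by \<open>x\<close> on the largest possible domain: \<open>\<phi>\<close>
  belongs to its domain if and only if \<open>x \<F> \<phi>\<close> is square integrable. One direction is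
  integration by parts without boundary terms (\<open>minimal_momentum_fourier\<close>). For the other one
  (\<open>minimal_momentum_total\<close>), moving \<open>x\<close> to the other factor shows that \<open>\<phi>\<close> lies in
  the domain of the adjoint of \<open>P\<^sub>0\<close>, which means that it is absolutely continuous with square integrable
  derivative; nonzero boundary values are excluded because a jump makes \<open>\<F> \<phi>\<close> decay no faster than
  \<open>1 / x\<close> on average.

  By iteration the domain of the \<open>2 n\<close>-th moment form is the domain of \<open>P\<^sub>0\<^sup>n\<close> and the form is
  \<open>\<langle>P\<^sub>0\<^sup>n \<psi> | P\<^sub>0\<^sup>n \<phi>\<rangle>\<close>. It is represented at \<open>\<phi>\<close> by a vector exactly if \<open>P\<^sub>0\<^sup>n \<phi>\<close> lies in the
  domain of the adjoint of \<open>P\<^sub>0\<^sup>n\<close>, which is the second claim. The first moment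
  form has a domain larger than that of \<open>P\<^sub>0\<close>, but testing it with the elements of the
  domain of \<open>P\<^sub>0\<close> again places \<open>\<phi>\<close> in the domain of the adjoint, and integrability of
  \<open>|x| |\<F> \<phi>|\<^sup>2\<close> is just enough to exclude boundary values, as \<open>\<integral> dx / x\<close> diverges
  (\<open>minimal_momentum_if_adjoint\<close>).

  The analysis behind this consists of Bessel's inequality for the Fourier integral, which with the completeness
  of \<open>L\<^sup>2\<close> makes the adjoint of the Fourier transform everywhere defined; of Parseval's identity for
  functions that vanish outside a bounded interval; and of the calculus of absolutely continuous functions on an
  interval (fundamental theorem, Lebesgue differentiation, integration by parts).
\<close>

section \<open>Square integrable functions\<close>

definition L2_norm :: "'a measure \<Rightarrow> ('a \<Rightarrow> complex) \<Rightarrow> real" where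
  "L2_norm M f = sqrt (\<integral>x. (cmod (f x))\<^sup>2 \<partial>M)"

lemma square_integrableI:
  "f \<in> borel_measurable M \<Longrightarrow> integrable M (\<lambda>x. (cmod (f x))\<^sup>2) \<Longrightarrow> f \<in> square_integrable M"
  by (simp add: square_integrable_def)

lemma square_integrable_measurable [measurable_dest]:
  "f \<in> square_integrable M \<Longrightarrow> f \<in> borel_measurable M"
  by (simp add: square_integrable_def)

lemma square_integrable_integrable:
  "f \<in> square_integrable M \<Longrightarrow> integrable M (\<lambda>x. (cmod (f x))\<^sup>2)"
  by (simp add: square_integrable_def)

lemma cnj_measurable [measurable]: "cnj \<in> borel_measurable borel"
  by (intro borel_measurable_continuous_onI continuous_intros)

lemma square_integrable_bound:
  assumes "f \<in> square_integrable M" "g \<in> borel_measurable M" "AE x in M. cmod (g x) \<le> C * cmod (f x)"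
  shows "g \<in> square_integrable M"
proof (rule square_integrableI)
  show "integrable M (\<lambda>x. (cmod (g x))\<^sup>2)"
  proof (rule Bochner_Integration.integrable_bound)
    show "integrable M (\<lambda>x. C\<^sup>2 * (cmod (f x))\<^sup>2)"
      using square_integrable_integrable[OF assms(1)] by simp
    show "AE x in M. norm ((cmod (g x))\<^sup>2) \<le> norm (C\<^sup>2 * (cmod (f x))\<^sup>2)"
      using assms(3)
      by eventually_elim (auto simp: power_mult_distrib[symmetric] intro!: power_mono)
  qed (use assms in measurable)
qed (use assms in auto)

lemma square_integrable_add:
  assumes f: "f \<in> square_integrable M" and g: "g \<in> square_integrable M"
  shows "(\<lambda>x. f x + g x) \<in> square_integrable M"
proof (rule square_integrableI)
  show "integrable M (\<lambda>x. (cmod (f x + g x))\<^sup>2)"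
  proof (rule Bochner_Integration.integrable_bound)
    show "integrable M (\<lambda>x. 2 * (cmod (f x))\<^sup>2 + 2 * (cmod (g x))\<^sup>2)"
      using square_integrable_integrable[OF f] square_integrable_integrable[OF g] by simp
    have "(cmod (a + b))\<^sup>2 \<le> 2 * (cmod a)\<^sup>2 + 2 * (cmod b)\<^sup>2" for a b :: complex
    proof -
      have "(cmod (a + b))\<^sup>2 \<le> (cmod a + cmod b)\<^sup>2"
        by (intro power_mono norm_triangle_ineq) auto
      also have "\<dots> \<le> 2 * (cmod a)\<^sup>2 + 2 * (cmod b)\<^sup>2"
        using sum_squares_bound[of "cmod a" "cmod b"] by (simp add: power2_sum)
      finally show ?thesis .
    qed
    then show "AE x in M. norm ((cmod (f x + g x))\<^sup>2) \<le> norm (2 * (cmod (f x))\<^sup>2 + 2 * (cmod (g x))\<^sup>2)"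
      by simp
  qed (use assms in measurable)
qed (use assms in measurable)

lemma square_integrable_cmult:
  "f \<in> square_integrable M \<Longrightarrow> (\<lambda>x. c * f x) \<in> square_integrable M"
  by (rule square_integrable_bound[where C = "cmod c"]) (auto simp: norm_mult)

lemma square_integrable_diff:
  assumes "f \<in> square_integrable M" "g \<in> square_integrable M"
  shows "(\<lambda>x. f x - g x) \<in> square_integrable M"
  using square_integrable_add[OF assms(1) square_integrable_cmult[OF assms(2), of "-1"]] by simp

lemma square_integrable_indicator:
  assumes f: "f \<in> square_integrable M" and A: "{x \<in> space M. x \<in> A} \<in> sets M"
  shows "(\<lambda>x. indicator A x * f x) \<in> square_integrable M"
proof (rule square_integrable_bound[OF f, where C = 1])
  have [measurable]: "(indicator A :: 'a \<Rightarrow> complex) \<in> borel_measurable M"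
    using A by (simp add: borel_measurable_indicator_iff Int_def conj_commute)
  show "(\<lambda>x. indicator A x * f x) \<in> borel_measurable M"
    using f by measurable
qed (auto simp: indicator_def)

lemma integrable_cnj_mult:
  assumes f: "f \<in> square_integrable M" and g: "g \<in> square_integrable M"
  shows "integrable M (\<lambda>x. cnj (f x) * g x)"
proof (rule Bochner_Integration.integrable_bound)
  show "integrable M (\<lambda>x. (cmod (f x))\<^sup>2 + (cmod (g x))\<^sup>2)"
    using square_integrable_integrable[OF f] square_integrable_integrable[OF g] by simp
  have "cmod (cnj a * b) \<le> (cmod a)\<^sup>2 + (cmod b)\<^sup>2" for a b
    using sum_squares_bound[of "cmod a" "cmod b"] mult_nonneg_nonneg[OF norm_ge_zero[of a] norm_ge_zero[of b]]
    unfolding norm_mult complex_mod_cnj by linarith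
  then show "AE x in M. norm (cnj (f x) * g x) \<le> norm ((cmod (f x))\<^sup>2 + (cmod (g x))\<^sup>2)"
    by simp
qed (use assms in measurable)

lemma L2_norm_nonneg [simp]: "0 \<le> L2_norm M f"
  by (simp add: L2_norm_def)

lemma L2_norm_power2: "(L2_norm M f)\<^sup>2 = (\<integral>x. (cmod (f x))\<^sup>2 \<partial>M)"
  by (simp add: L2_norm_def)

lemma L2_norm_minus_commute: "L2_norm M (\<lambda>x. f x - g x) = L2_norm M (\<lambda>x. g x - f x)"
  by (simp add: L2_norm_def norm_minus_commute)

lemma nn_integral_L2_norm:
  assumes "f \<in> square_integrable M"
  shows "(\<integral>\<^sup>+x. ennreal ((cmod (f x))\<^sup>2) \<partial>M) = ennreal ((L2_norm M f)\<^sup>2)"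
  unfolding L2_norm_power2
  by (rule nn_integral_eq_integral[OF square_integrable_integrable[OF assms]]) auto

lemma L2_norm_leI:
  assumes "(\<integral>\<^sup>+x. ennreal ((cmod (f x))\<^sup>2) \<partial>M) \<le> ennreal (c\<^sup>2)" "f \<in> borel_measurable M" "0 \<le> c"
  shows "f \<in> square_integrable M" "L2_norm M f \<le> c"
proof -
  have "integrable M (\<lambda>x. (cmod (f x))\<^sup>2)"
    using assms(1,2) by (intro integrableI_bounded) (auto simp: order_le_less_trans)
  then show f: "f \<in> square_integrable M"
    using assms by (intro square_integrableI)
  show "L2_norm M f \<le> c"
    using assms nn_integral_L2_norm[OF f] by (simp add: power2_le_iff_abs_le)
qed

lemma L2_norm_eq_0_iff:
  assumes "f \<in> square_integrable M"
  shows "L2_norm M f = 0 \<longleftrightarrow> (AE x in M. f x = 0)"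
  unfolding L2_norm_def
  using integral_nonneg_eq_0_iff_AE[OF square_integrable_integrable[OF assms]] by simp

lemma L2_Cauchy_Schwarz:
  assumes f: "f \<in> square_integrable M" and g: "g \<in> square_integrable M"
  shows "cmod (\<integral>x. cnj (f x) * g x \<partial>M) \<le> L2_norm M f * L2_norm M g"
proof -
  note [measurable] = square_integrable_measurable[OF f] square_integrable_measurable[OF g]
  have i: "integrable M (\<lambda>x. cmod (f x) * cmod (g x))"
    using integrable_norm[OF integrable_cnj_mult[OF f g]] by (simp add: norm_mult)
  have "cmod (\<integral>x. cnj (f x) * g x \<partial>M) \<le> (\<integral>x. cmod (f x) * cmod (g x) \<partial>M)"
    using integral_norm_bound[of M "\<lambda>x. cnj (f x) * g x"] by (simp add: norm_mult)
  moreover have "(\<integral>x. cmod (f x) * cmod (g x) \<partial>M)\<^sup>2 \<le> (L2_norm M f * L2_norm M g)\<^sup>2"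
  proof -
    have "(\<integral>\<^sup>+x. ennreal (cmod (f x)) * ennreal (cmod (g x)) \<partial>M)\<^sup>2
        \<le> (\<integral>\<^sup>+x. ennreal (cmod (f x)) ^ 2 \<partial>M) * (\<integral>\<^sup>+x. ennreal (cmod (g x)) ^ 2 \<partial>M)"
      by (intro Cauchy_Schwarz_nn_integral) measurable
    also have "(\<integral>\<^sup>+x. ennreal (cmod (f x)) * ennreal (cmod (g x)) \<partial>M)
        = ennreal (\<integral>x. cmod (f x) * cmod (g x) \<partial>M)"
      by (subst nn_integral_eq_integral[OF i, symmetric]) (auto simp: ennreal_mult)
    finally show ?thesis
      using nn_integral_L2_norm[OF f] nn_integral_L2_norm[OF g]
      by (simp add: ennreal_power ennreal_mult[symmetric] power_mult_distrib)
  qed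
  ultimately show ?thesis
    by (meson L2_norm_nonneg mult_nonneg_nonneg order_trans power2_le_imp_le)
qed

lemma L2_norm_triangle:
  assumes f: "f \<in> square_integrable M" and g: "g \<in> square_integrable M"
  shows "L2_norm M (\<lambda>x. f x + g x) \<le> L2_norm M f + L2_norm M g"
proof (rule power2_le_imp_le)
  note i = square_integrable_integrable[OF f] square_integrable_integrable[OF g] integrable_cnj_mult[OF f g]
  have "(L2_norm M (\<lambda>x. f x + g x))\<^sup>2
      = (\<integral>x. (cmod (f x))\<^sup>2 + (cmod (g x))\<^sup>2 + 2 * Re (cnj (f x) * g x) \<partial>M)"
    unfolding L2_norm_power2
    by (intro Bochner_Integration.integral_cong) (simp_all add: cmod_power2 power2_sum algebra_simps)
  also have "\<dots> = (L2_norm M f)\<^sup>2 + (L2_norm M g)\<^sup>2 + 2 * Re (\<integral>x. cnj (f x) * g x \<partial>M)"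
    using i by (simp add: L2_norm_power2 del: times_complex.sel)
  also have "\<dots> \<le> (L2_norm M f)\<^sup>2 + (L2_norm M g)\<^sup>2 + 2 * (L2_norm M f * L2_norm M g)"
    using order_trans[OF complex_Re_le_cmod L2_Cauchy_Schwarz[OF f g]] by simp
  also have "\<dots> = (L2_norm M f + L2_norm M g)\<^sup>2"
    by (simp add: power2_sum)
  finally show "(L2_norm M (\<lambda>x. f x + g x))\<^sup>2 \<le> (L2_norm M f + L2_norm M g)\<^sup>2" .
qed simp

lemma L2_norm_triangle_diff:
  assumes "f \<in> square_integrable M" "g \<in> square_integrable M" "h \<in> square_integrable M"
  shows "L2_norm M (\<lambda>x. f x - h x) \<le> L2_norm M (\<lambda>x. f x - g x) + L2_norm M (\<lambda>x. g x - h x)"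
  using L2_norm_triangle[OF square_integrable_diff[OF assms(1,2)] square_integrable_diff[OF assms(2,3)]]
  by simp

lemma L2_inner_tendsto_left:
  assumes f: "\<And>n. f n \<in> square_integrable M" and g: "g \<in> square_integrable M"
    and h: "h \<in> square_integrable M"
    and lim: "(\<lambda>n. L2_norm M (\<lambda>x. f n x - g x)) \<longlonglongrightarrow> 0"
  shows "(\<lambda>n. \<integral>x. cnj (f n x) * h x \<partial>M) \<longlonglongrightarrow> (\<integral>x. cnj (g x) * h x \<partial>M)"
proof (rule Lim_null[THEN iffD2], rule tendsto_norm_zero_cancel, rule tendsto_sandwich[of "\<lambda>_. 0"])
  show "(\<lambda>n. L2_norm M (\<lambda>x. f n x - g x) * L2_norm M h) \<longlonglongrightarrow> 0"
    using tendsto_mult_right[OF lim, of "L2_norm M h"] by simp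
  have "norm ((\<integral>x. cnj (f n x) * h x \<partial>M) - (\<integral>x. cnj (g x) * h x \<partial>M))
      \<le> L2_norm M (\<lambda>x. f n x - g x) * L2_norm M h" for n
    using L2_Cauchy_Schwarz[OF square_integrable_diff[OF f g] h, of n]
    by (simp add: left_diff_distrib integrable_cnj_mult f g h)
  then show "\<forall>\<^sub>F n in sequentially. norm ((\<integral>x. cnj (f n x) * h x \<partial>M) - (\<integral>x. cnj (g x) * h x \<partial>M))
      \<le> L2_norm M (\<lambda>x. f n x - g x) * L2_norm M h"
    by simp
qed auto

text \<open>
  Riesz--Fischer. Along a subsequence with
  \<open>\<integral> |f\<^bsub>r (k + 1)\<^esub> - f\<^bsub>r k\<^esub>|\<^sup>2 \<le> 8\<^sup>-\<^sup>k\<close> the weighted sum \<open>\<Sum>k. 4\<^sup>k |f\<^bsub>r (k + 1)\<^esub> - f\<^bsub>r k\<^esub>|\<^sup>2\<close> is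
  integrable, hence almost everywhere finite, so the increments are almost everywhere
  \<open>O(2\<^sup>-\<^sup>k)\<close> and the subsequence converges pointwise. Fatou's lemma upgrades this to
  convergence in the mean of the whole sequence.
\<close>

lemma square_integrable_complete:
  assumes f: "\<And>n. f n \<in> square_integrable M"
    and Cauchy: "\<And>e. e > 0 \<Longrightarrow> \<exists>N. \<forall>m\<ge>N. \<forall>n\<ge>N. L2_norm M (\<lambda>x. f m x - f n x) < e"
  obtains g where "g \<in> square_integrable M" "(\<lambda>n. L2_norm M (\<lambda>x. f n x - g x)) \<longlonglongrightarrow> 0"
proof -
  note [measurable] = square_integrable_measurable[OF f]
  \<comment> \<open>the added index \<open>k\<close> in the definition of \<open>r\<close> makes it strictly increasing\<close>
  have "\<exists>r :: nat \<Rightarrow> nat. strict_mono r \<and>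
      (\<forall>k. \<forall>m\<ge>r k. \<forall>n\<ge>r k. L2_norm M (\<lambda>x. f m x - f n x) < sqrt ((1/8)^k))"
  proof -
    obtain N where N: "\<And>k m n. m \<ge> N k \<Longrightarrow> n \<ge> N k \<Longrightarrow>
        L2_norm M (\<lambda>x. f m x - f n x) < sqrt ((1/8)^k)"
      using Cauchy[of "sqrt ((1/8)^k)" for k] by (metis real_sqrt_gt_zero zero_less_divide_1_iff zero_less_numeral zero_less_power)
    define r where "r k = (\<Sum>i\<le>k. N i) + k" for k
    have "strict_mono r"
      by (auto simp: strict_mono_Suc_iff r_def)
    moreover have "N k \<le> r k" for k
      using member_le_sum[of k "{..k}" N] by (simp add: r_def trans_le_add1)
    ultimately show ?thesis
      using N by (meson order_trans)
  qed
  then obtain r :: "nat \<Rightarrow> nat" where r: "strict_mono r"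
    and small: "\<And>k m n. m \<ge> r k \<Longrightarrow> n \<ge> r k \<Longrightarrow> L2_norm M (\<lambda>x. f m x - f n x) < sqrt ((1/8)^k)"
    by blast
  define D where "D k x = f (r (Suc k)) x - f (r k) x" for k x
  have [measurable]: "D k \<in> borel_measurable M" for k
    unfolding D_def by measurable
  have D_int: "(\<integral>\<^sup>+x. ennreal (4^k * (cmod (D k x))\<^sup>2) \<partial>M) \<le> ennreal ((1/2)^k)" for k
  proof -
    have "(\<integral>\<^sup>+x. ennreal (4^k * (cmod (D k x))\<^sup>2) \<partial>M) = ennreal (4^k) * (\<integral>\<^sup>+x. ennreal ((cmod (D k x))\<^sup>2) \<partial>M)"
      by (subst nn_integral_cmult[symmetric]) (auto simp: ennreal_mult)
    also have "(\<integral>\<^sup>+x. ennreal ((cmod (D k x))\<^sup>2) \<partial>M) = ennreal ((L2_norm M (D k))\<^sup>2)"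
      unfolding D_def by (intro nn_integral_L2_norm square_integrable_diff f)
    also have "ennreal (4^k) * \<dots> = ennreal (4^k * (L2_norm M (D k))\<^sup>2)"
      by (simp add: ennreal_mult)
    also have "\<dots> \<le> ennreal (4^k * (1/8)^k)"
    proof -
      have "L2_norm M (D k) \<le> sqrt ((1/8)^k)"
        unfolding D_def using small[of k "r (Suc k)" "r k"] strict_mono_less_eq[OF r, of k "Suc k"] by simp
      then have "(L2_norm M (D k))\<^sup>2 \<le> (sqrt ((1/8)^k))\<^sup>2"
        by (intro power_mono) auto
      then show ?thesis
        by (intro ennreal_leI mult_left_mono) auto
    qed
    also have "4^k * (1/8)^k = ((1/2)^k :: real)"
      by (simp add: power_mult_distrib[symmetric])
    finally show ?thesis .
  qed
  have "(\<integral>\<^sup>+x. (\<Sum>k. ennreal (4^k * (cmod (D k x))\<^sup>2)) \<partial>M) < \<infinity>"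
  proof -
    have "(\<integral>\<^sup>+x. (\<Sum>k. ennreal (4^k * (cmod (D k x))\<^sup>2)) \<partial>M)
        = (\<Sum>k. \<integral>\<^sup>+x. ennreal (4^k * (cmod (D k x))\<^sup>2) \<partial>M)"
      by (rule nn_integral_suminf) measurable
    also have "\<dots> \<le> (\<Sum>k. ennreal ((1/2)^k))"
      by (intro suminf_le D_int) auto
    also have "\<dots> < \<infinity>"
      using summable_geometric[of "1/2 :: real"]
      by (subst suminf_ennreal2) auto
    finally show ?thesis .
  qed
  then have fin: "AE x in M. (\<Sum>k. ennreal (4^k * (cmod (D k x))\<^sup>2)) \<noteq> \<infinity>"
    by (intro nn_integral_PInf_AE) auto
  have conv: "AE x in M. convergent (\<lambda>k. f (r k) x)"
    using fin
  proof eventually_elim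
    case (elim x)
    have term_le: "g k \<le> suminf g" for g :: "nat \<Rightarrow> ennreal" and k
      using sum_le_suminf[of g "{k}"] by simp
    have "\<exists>C\<ge>0. S = ennreal C" if "S \<noteq> \<infinity>" for S :: ennreal
      using that by (cases S) auto
    from this[OF elim] obtain C where C: "C \<ge> 0" "(\<Sum>k. ennreal (4^k * (cmod (D k x))\<^sup>2)) = ennreal C"
      by blast
    have "cmod (D k x) \<le> sqrt C * (1/2)^k" for k
    proof -
      have "ennreal (4^k * (cmod (D k x))\<^sup>2) \<le> ennreal C"
        by (rule term_le[of "\<lambda>k. ennreal (4^k * (cmod (D k x))\<^sup>2)" k, unfolded C(2)])
      then have "4^k * (cmod (D k x))\<^sup>2 \<le> C"
        using C(1) by simp
      moreover have "((2::real)^k)\<^sup>2 = 4^k"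
        by (simp add: power2_eq_square flip: power_mult_distrib)
      ultimately have "(cmod (D k x) * 2^k)\<^sup>2 \<le> C"
        by (simp add: power_mult_distrib mult.commute)
      then have "cmod (D k x) * 2^k \<le> sqrt C"
        by (rule real_le_rsqrt)
      then show ?thesis
        by (simp add: field_simps power_one_over)
    qed
    moreover have "summable (\<lambda>k. sqrt C * (1/2)^k)"
      by (intro summable_mult summable_geometric) simp
    ultimately have "summable (\<lambda>k. D k x)"
      by (metis summable_comparison_test')
    then have "convergent (\<lambda>n. \<Sum>k<n. D k x)"
      by (simp add: summable_iff_convergent)
    moreover have "(\<Sum>k<n. D k x) = f (r n) x - f (r 0) x" for n
      unfolding D_def by (rule sum_lessThan_telescope)
    ultimately have "convergent (\<lambda>n. f (r n) x - f (r 0) x)"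
      by simp
    from convergent_add[OF this convergent_const[of "f (r 0) x"]] show ?case
      by simp
  qed
  define g where "g x = lim (\<lambda>k. f (r k) x)" for x
  have g_meas [measurable]: "g \<in> borel_measurable M"
    unfolding g_def by measurable
  have tail: "(\<integral>\<^sup>+x. ennreal ((cmod (f m x - g x))\<^sup>2) \<partial>M) \<le> ennreal (e\<^sup>2)"
    if e: "e > 0" and m: "m \<ge> N" and N: "\<And>m n. m \<ge> N \<Longrightarrow> n \<ge> N \<Longrightarrow> L2_norm M (\<lambda>x. f m x - f n x) < e"
    for m e N
  proof -
    have "AE x in M. ennreal ((cmod (f m x - g x))\<^sup>2) = liminf (\<lambda>k. ennreal ((cmod (f m x - f (r k) x))\<^sup>2))"
      using conv
    proof eventually_elim
      case (elim x)
      then have "(\<lambda>k. f (r k) x) \<longlonglongrightarrow> g x"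
        unfolding g_def by (simp add: convergent_LIMSEQ_iff)
      then have "(\<lambda>k. ennreal ((cmod (f m x - f (r k) x))\<^sup>2)) \<longlonglongrightarrow> ennreal ((cmod (f m x - g x))\<^sup>2)"
        by (intro tendsto_ennrealI tendsto_intros)
      then show ?case
        by (rule lim_imp_Liminf[OF trivial_limit_sequentially, symmetric])
    qed
    then have "(\<integral>\<^sup>+x. ennreal ((cmod (f m x - g x))\<^sup>2) \<partial>M)
        = (\<integral>\<^sup>+x. liminf (\<lambda>k. ennreal ((cmod (f m x - f (r k) x))\<^sup>2)) \<partial>M)"
      by (rule nn_integral_cong_AE)
    also have "\<dots> \<le> liminf (\<lambda>k. \<integral>\<^sup>+x. ennreal ((cmod (f m x - f (r k) x))\<^sup>2) \<partial>M)"
      by (rule nn_integral_liminf) measurable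
    also have "\<dots> \<le> ennreal (e\<^sup>2)"
    proof (rule order_trans[OF Liminf_mono Liminf_const[THEN eq_refl]])
      show "\<forall>\<^sub>F k in sequentially. (\<integral>\<^sup>+x. ennreal ((cmod (f m x - f (r k) x))\<^sup>2) \<partial>M) \<le> ennreal (e\<^sup>2)"
        using eventually_ge_at_top[of N]
      proof eventually_elim
        case (elim k)
        have "N \<le> r k"
          using elim seq_suble[OF r, of k] by simp
        then have "L2_norm M (\<lambda>x. f m x - f (r k) x) \<le> e"
          using N[OF m] by (simp add: less_imp_le)
        then show ?case
          unfolding nn_integral_L2_norm[OF square_integrable_diff[OF f f]]
          by (intro ennreal_leI power_mono) auto
      qed
    qed auto
    finally show ?thesis .
  qed
  obtain N1 where N1: "\<And>m n. m \<ge> N1 \<Longrightarrow> n \<ge> N1 \<Longrightarrow> L2_norm M (\<lambda>x. f m x - f n x) < 1"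
    using Cauchy[of 1] by auto
  have "(\<lambda>x. f N1 x - g x) \<in> square_integrable M"
    by (rule L2_norm_leI(1)[OF tail[OF _ order_refl N1]]) auto
  from square_integrable_diff[OF f[of N1] this] have g: "g \<in> square_integrable M"
    by simp
  show thesis
  proof (rule that[OF g])
    show "(\<lambda>n. L2_norm M (\<lambda>x. f n x - g x)) \<longlonglongrightarrow> 0"
    proof (rule LIMSEQ_I)
      fix e :: real assume "e > 0"
      then have e: "e / 2 > 0" by simp
      obtain N where N: "\<And>m n. m \<ge> N \<Longrightarrow> n \<ge> N \<Longrightarrow> L2_norm M (\<lambda>x. f m x - f n x) < e / 2"
        using Cauchy[OF e] by auto
      show "\<exists>no. \<forall>n\<ge>no. norm (L2_norm M (\<lambda>x. f n x - g x) - 0) < e"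
      proof (intro exI[of _ N] allI impI)
        fix n assume "N \<le> n"
        have "L2_norm M (\<lambda>x. f n x - g x) \<le> e / 2"
          by (rule L2_norm_leI(2)[OF tail[OF e \<open>N \<le> n\<close> N]]) (use e in auto)
        then show "norm (L2_norm M (\<lambda>x. f n x - g x) - 0) < e"
          using \<open>e > 0\<close> by simp
      qed
    qed
  qed
qed

section \<open>The metric space of classes\<close>

lemma L2_rep_in:
  assumes "\<Phi> \<in> L2 M"
  shows "L2_rep \<Phi> \<in> square_integrable M" "L2_class M (L2_rep \<Phi>) = \<Phi>"
proof -
  obtain f where f: "f \<in> square_integrable M" "\<Phi> = L2_class M f"
    using assms by (auto simp: L2_def L2_class_def elim: quotientE)
  show "L2_rep \<Phi> \<in> square_integrable M"
    unfolding f(2) by (rule L2_rep_class(1)[OF f(1)])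
  have "(L2_rep \<Phi>, f) \<in> ae_rel M"
    using L2_rep_class[OF f(1)] f by (simp add: ae_rel_def)
  then show "L2_class M (L2_rep \<Phi>) = \<Phi>"
    unfolding f(2) L2_class_def by (rule equiv_class_eq[OF equiv_ae_rel])
qed

lemma L2_class_eq_iff:
  assumes "f \<in> square_integrable M" "g \<in> square_integrable M"
  shows "L2_class M f = L2_class M g \<longleftrightarrow> (AE x in M. f x = g x)"
  unfolding L2_class_def using eq_equiv_class_iff[OF equiv_ae_rel assms] assms
  by (simp add: ae_rel_def)

lemma L2_dist_eq: "L2_dist M \<Phi> \<Psi> = L2_norm M (\<lambda>x. L2_rep \<Phi> x - L2_rep \<Psi> x)"
  by (simp add: L2_dist_def L2_norm_def)

lemma L2_dist_class':
  "f \<in> square_integrable M \<Longrightarrow> g \<in> square_integrable M \<Longrightarrow>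
    L2_dist M (L2_class M f) (L2_class M g) = L2_norm M (\<lambda>x. f x - g x)"
  by (simp add: L2_dist_class L2_norm_def)

lemma L2_dist_eq_0_iff:
  assumes "\<Phi> \<in> L2 M" "\<Psi> \<in> L2 M"
  shows "L2_dist M \<Phi> \<Psi> = 0 \<longleftrightarrow> \<Phi> = \<Psi>"
  unfolding L2_dist_eq
  using L2_norm_eq_0_iff[OF square_integrable_diff[OF L2_rep_in(1)[OF assms(1)] L2_rep_in(1)[OF assms(2)]]]
    L2_class_eq_iff[OF L2_rep_in(1)[OF assms(1)] L2_rep_in(1)[OF assms(2)]]
    L2_rep_in(2)[OF assms(1)] L2_rep_in(2)[OF assms(2)]
  by simp

lemma L2_dist_triangle:
  assumes "\<Phi> \<in> L2 M" "\<Psi> \<in> L2 M" "\<Omega> \<in> L2 M"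
  shows "L2_dist M \<Phi> \<Omega> \<le> L2_dist M \<Phi> \<Psi> + L2_dist M \<Psi> \<Omega>"
  unfolding L2_dist_eq by (intro L2_norm_triangle_diff L2_rep_in(1) assms)

lemma Metric_space_L2: "Metric_space (L2 M) (L2_dist M)"
proof
  show "L2_dist M \<Phi> \<Psi> = L2_dist M \<Psi> \<Phi>" for \<Phi> \<Psi>
    unfolding L2_dist_eq by (rule L2_norm_minus_commute)
  show "0 \<le> L2_dist M \<Phi> \<Psi>" for \<Phi> \<Psi>
    unfolding L2_dist_eq by simp
qed (simp_all add: L2_dist_eq_0_iff L2_dist_triangle)

lemma L2_inner_commute: "L2_inner M \<Phi> \<Psi> = cnj (L2_inner M \<Psi> \<Phi>)"
proof -
  have "cnj (\<integral>x. cnj (L2_rep \<Psi> x) * L2_rep \<Phi> x \<partial>M) = (\<integral>x. cnj (cnj (L2_rep \<Psi> x) * L2_rep \<Phi> x) \<partial>M)"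
    by (rule Bochner_Integration.integral_cnj[symmetric])
  then show ?thesis
    by (simp add: L2_inner_def mult.commute)
qed

lemma continuous_map_L2_inner_left:
  assumes "\<Omega> \<in> L2 M"
  shows "continuous_map (L2_topology M) euclidean (\<lambda>\<Psi>. L2_inner M \<Psi> \<Omega>)"
proof -
  interpret Metric_space "L2 M" "L2_dist M" by (rule Metric_space_L2)
  have "Lipschitz_continuous_map (metric (L2 M, L2_dist M)) Met_TC.Self (\<lambda>\<Psi>. L2_inner M \<Psi> \<Omega>)"
    unfolding Lipschitz_continuous_map_def
  proof (intro conjI exI ballI)
    fix \<Phi> \<Psi> assume "\<Phi> \<in> mspace (metric (L2 M, L2_dist M))" "\<Psi> \<in> mspace (metric (L2 M, L2_dist M))"
    then have *: "L2_rep \<Phi> \<in> square_integrable M" "L2_rep \<Psi> \<in> square_integrable M"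
      "L2_rep \<Omega> \<in> square_integrable M"
      using assms by (simp_all add: L2_rep_in)
    have "dist (L2_inner M \<Phi> \<Omega>) (L2_inner M \<Psi> \<Omega>)
        = cmod (\<integral>x. cnj (L2_rep \<Phi> x - L2_rep \<Psi> x) * L2_rep \<Omega> x \<partial>M)"
      unfolding L2_inner_def dist_norm
      by (simp add: left_diff_distrib integrable_cnj_mult *)
    also have "\<dots> \<le> L2_dist M \<Phi> \<Psi> * L2_norm M (L2_rep \<Omega>)"
      unfolding L2_dist_eq by (intro L2_Cauchy_Schwarz square_integrable_diff *)
    finally show "mdist Met_TC.Self (L2_inner M \<Phi> \<Omega>) (L2_inner M \<Psi> \<Omega>)
        \<le> L2_norm M (L2_rep \<Omega>) * mdist (metric (L2 M, L2_dist M)) \<Phi> \<Psi>"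
      by (simp add: mult.commute)
  qed auto
  from Lipschitz_continuous_imp_continuous_map[OF this] show ?thesis
    by (simp add: mtopology_of_def)
qed

lemma L2_eqI_inner:
  assumes "\<Phi> \<in> L2 M" "\<Phi>' \<in> L2 M" and eq: "\<And>\<Psi>. \<Psi> \<in> L2 M \<Longrightarrow> L2_inner M \<Phi> \<Psi> = L2_inner M \<Phi>' \<Psi>"
  shows "\<Phi> = \<Phi>'"
proof -
  let ?f = "L2_rep \<Phi>" and ?g = "L2_rep \<Phi>'"
  note f = L2_rep_in[OF assms(1)] and g = L2_rep_in[OF assms(2)]
  let ?h = "\<lambda>x. ?f x - ?g x"
  note h = square_integrable_diff[OF f(1) g(1)]
  have "(\<integral>x. cnj (?f x) * ?h x \<partial>M) = (\<integral>x. cnj (?g x) * ?h x \<partial>M)"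
    using eq[OF L2_class_in_L2[OF h]] L2_inner_class[OF f(1) h] L2_inner_class[OF g(1) h] f(2) g(2)
    by simp
  then have "(\<integral>x. cnj (?h x) * ?h x \<partial>M) = 0"
    using integrable_cnj_mult[OF f(1) h] integrable_cnj_mult[OF g(1) h]
    by (simp add: left_diff_distrib)
  then have "complex_of_real (\<integral>x. (cmod (?h x))\<^sup>2 \<partial>M) = 0"
    unfolding integral_complex_of_real[symmetric] complex_norm_square by (simp only: mult.commute)
  then have "L2_norm M ?h = 0"
    by (simp add: L2_norm_def)
  then show ?thesis
    using L2_dist_eq_0_iff[OF assms(1,2)] by (simp add: L2_dist_eq)
qed

section \<open>The Fourier integral of integrable functions\<close>

abbreviation fourier_kernel :: "real \<Rightarrow> real \<Rightarrow> complex" where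
  "fourier_kernel x t \<equiv> exp (- (\<i> * complex_of_real x * complex_of_real t))"

abbreviation gaussian :: "real \<Rightarrow> complex" where
  "gaussian v \<equiv> complex_of_real (std_normal_density v)"

lemma norm_fourier_kernel [simp]: "cmod (fourier_kernel x t) = 1"
  by simp

lemma integrable_fourier_kernel_mult [simp]:
  assumes "integrable lborel f"
  shows "integrable lborel (\<lambda>t. fourier_kernel x t * f t)"
  by (rule Bochner_Integration.integrable_bound[OF assms]) (use assms in \<open>auto simp: norm_mult\<close>)

lemma fourier_integral_measurable [measurable]:
  assumes [measurable]: "f \<in> borel_measurable borel"
  shows "fourier_integral f \<in> borel_measurable borel"
  unfolding fourier_integral_def[abs_def] by measurable

lemma fourier_integral_bound:
  assumes "integrable lborel f"
  shows "cmod (fourier_integral f x) \<le> 1 / sqrt (2 * pi) * (\<integral>t. cmod (f t) \<partial>lborel)"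
  using integral_norm_bound[of lborel "\<lambda>t. fourier_kernel x t * f t"]
  unfolding fourier_integral_def by (simp add: norm_mult norm_divide divide_right_mono)

lemma fourier_integral_diff:
  assumes "integrable lborel f" "integrable lborel g"
  shows "fourier_integral (\<lambda>t. f t - g t) x = fourier_integral f x - fourier_integral g x"
  unfolding fourier_integral_def using assms by (simp add: right_diff_distrib)

lemma integrable_mult_bounded:
  fixes f g :: "'a \<Rightarrow> complex"
  assumes f: "integrable M f" and [measurable]: "g \<in> borel_measurable M" and g: "\<And>x. cmod (g x) \<le> B"
  shows "integrable M (\<lambda>x. f x * g x)"
proof (rule Bochner_Integration.integrable_bound)
  show "integrable M (\<lambda>x. B * cmod (f x))"
    using f by simp
  have "0 \<le> B"
    using g norm_ge_zero order_trans by blast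
  then show "AE x in M. norm (f x * g x) \<le> norm (B * cmod (f x))"
    using mult_left_mono[OF g norm_ge_zero[of "f _"]] by (simp add: norm_mult mult.commute[of B])
  show "(\<lambda>x. f x * g x) \<in> borel_measurable M"
    using f by measurable
qed

text \<open>The Fourier integral is symmetric for the bilinear pairing \<open>(u, v) \<mapsto> \<integral> u v\<close>, by Fubini.\<close>

lemma fourier_integral_multiplication:
  assumes u: "integrable lborel u" and v: "integrable lborel v"
  shows "(\<integral>x. u x * fourier_integral v x \<partial>lborel) = (\<integral>t. fourier_integral u t * v t \<partial>lborel)"
proof -
  note [measurable] = borel_measurable_integrable[OF u] borel_measurable_integrable[OF v]
  let ?F = "\<lambda>x t. u x * (fourier_kernel x t * v t)"
  have "integrable (lborel \<Otimes>\<^sub>M lborel) (case_prod ?F)"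
  proof (rule lborel_pair.Fubini_integrable)
    have "(\<lambda>x. \<integral>y. norm (case (x, y) of (x, t) \<Rightarrow> ?F x t) \<partial>lborel) = (\<lambda>x. cmod (u x) * (\<integral>y. cmod (v y) \<partial>lborel))"
      by (simp add: norm_mult)
    then show "integrable lborel (\<lambda>x. \<integral>y. norm (case (x, y) of (x, t) \<Rightarrow> ?F x t) \<partial>lborel)"
      using u by simp
    show "AE x in lborel. integrable lborel (\<lambda>y. case (x, y) of (x, t) \<Rightarrow> ?F x t)"
      using v by simp
  qed measurable
  from lborel_pair.Fubini_integral[OF this]
  have "(\<integral>t. \<integral>x. ?F x t \<partial>lborel \<partial>lborel) = (\<integral>x. \<integral>t. ?F x t \<partial>lborel \<partial>lborel)" .
  moreover define c where "c = complex_of_real (1 / sqrt (2 * pi))"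
  have "(\<integral>x. u x * fourier_integral v x \<partial>lborel) = c * (\<integral>x. \<integral>t. ?F x t \<partial>lborel \<partial>lborel)"
    unfolding fourier_integral_def c_def[symmetric] by (simp add: mult.left_commute[of "u _" c])
  moreover have "(\<integral>t. fourier_integral u t * v t \<partial>lborel) = c * (\<integral>t. \<integral>x. ?F x t \<partial>lborel \<partial>lborel)"
  proof -
    have "?F x t = fourier_kernel t x * u x * v t" for x t
      by (simp add: mult_ac)
    then have "(\<integral>x. ?F x t \<partial>lborel) = (\<integral>x. fourier_kernel t x * u x \<partial>lborel) * v t" for t
      by (simp only: integral_mult_left_zero)
    then show ?thesis
      unfolding fourier_integral_def c_def[symmetric] by (simp only: mult.assoc integral_mult_right_zero)
  qed
  ultimately show ?thesis by simp
qed

subsection \<open>Gaussian regularization\<close>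

lemma integral_iexp_gaussian:
  "(\<integral>x. iexp (t * x) * complex_of_real (exp (- x\<^sup>2 / 2)) \<partial>lborel)
    = complex_of_real (sqrt (2 * pi) * exp (- t\<^sup>2 / 2))"
proof -
  have "char std_normal_distribution t = (\<integral>x. std_normal_density x *\<^sub>R iexp (t * x) \<partial>lborel)"
    unfolding char_def by (subst integral_density) auto
  also have "\<dots> = (\<integral>x. complex_of_real (1 / sqrt (2 * pi)) * (iexp (t * x) * complex_of_real (exp (- x\<^sup>2 / 2))) \<partial>lborel)"
    by (simp add: std_normal_density_def scaleR_conv_of_real mult_ac)
  also have "\<dots> = complex_of_real (1 / sqrt (2 * pi)) * (\<integral>x. iexp (t * x) * complex_of_real (exp (- x\<^sup>2 / 2)) \<partial>lborel)"
    by (rule Bochner_Integration.integral_mult_right_zero)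
  finally show ?thesis
    unfolding char_std_normal_distribution by (simp add: field_simps)
qed

lemma integrable_gaussian:
  fixes d :: real
  assumes "d > 0"
  shows "integrable lborel (\<lambda>x. exp (- (d * x)\<^sup>2 / 2))"
proof -
  have "integrable lborel (\<lambda>x. sqrt (2 * pi) * std_normal_density (0 + d * x))"
    using assms by (intro integrable_mult_right lborel_integrable_real_affine) auto
  then show ?thesis
    by (simp add: std_normal_density_def)
qed

lemma fourier_integral_modulated_gaussian:
  assumes "d > 0"
  shows "fourier_integral (\<lambda>x. iexp (s * x) * complex_of_real (exp (- (d * x)\<^sup>2 / 2))) t
    = complex_of_real (exp (- ((t - s) / d)\<^sup>2 / 2) / d)"
proof -
  let ?h = "\<lambda>x. fourier_kernel t x * (iexp (s * x) * complex_of_real (exp (- (d * x)\<^sup>2 / 2)))"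
  have "integral\<^sup>L lborel ?h = \<bar>1 / d\<bar> *\<^sub>R (\<integral>x. ?h (0 + 1 / d * x) \<partial>lborel)"
    using assms by (intro lborel_integral_real_affine) auto
  also have "(\<lambda>x. ?h (0 + 1 / d * x)) = (\<lambda>x. iexp ((s - t) / d * x) * complex_of_real (exp (- x\<^sup>2 / 2)))"
  proof
    fix x
    have "- (\<i> * complex_of_real t * complex_of_real (0 + 1 / d * x)) + \<i> * complex_of_real (s * (0 + 1 / d * x))
        = \<i> * complex_of_real ((s - t) / d * x)"
      using assms by (simp add: field_simps)
    then show "?h (0 + 1 / d * x) = iexp ((s - t) / d * x) * complex_of_real (exp (- x\<^sup>2 / 2))"
      using assms by (simp only: mult.assoc[symmetric] exp_add[symmetric]) simp
  qed
  also have "(\<integral>x. iexp ((s - t) / d * x) * complex_of_real (exp (- x\<^sup>2 / 2)) \<partial>lborel)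
      = complex_of_real (sqrt (2 * pi) * exp (- ((s - t) / d)\<^sup>2 / 2))"
    by (rule integral_iexp_gaussian)
  finally show ?thesis
    unfolding fourier_integral_def using assms
    by (simp add: scaleR_conv_of_real power_divide power2_commute[of s t])
qed

text \<open>
  Damping the frequency integral by a Gaussian of width \<open>1 / d\<close> amounts to averaging the
  second function over normally distributed translations of size \<open>d\<close>: apply the
  multiplication formula twice, the weight being a Gaussian whose transform is again a Gaussian.
\<close>

lemma gaussian_parseval:
  assumes f: "integrable lborel f" and g: "integrable lborel g" and d: "d > 0"
  shows "(\<integral>x. complex_of_real (exp (- (d * x)\<^sup>2 / 2)) * (cnj (fourier_integral g x) * fourier_integral f x) \<partial>lborel)
    = (\<integral>s. cnj (\<integral>v. gaussian v * g (s + d * v) \<partial>lborel) * f s \<partial>lborel)"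
proof -
  note [measurable] = borel_measurable_integrable[OF f] borel_measurable_integrable[OF g]
  let ?w = "\<lambda>x. complex_of_real (exp (- (d * x)\<^sup>2 / 2))"
  let ?u = "\<lambda>x. ?w x * cnj (fourier_integral g x)"
  have w: "integrable lborel ?w"
    using integrable_gaussian[OF d] by simp
  have u: "integrable lborel ?u"
    using fourier_integral_bound[OF g] by (intro integrable_mult_bounded[OF w]) auto
  have "(\<integral>x. ?w x * (cnj (fourier_integral g x) * fourier_integral f x) \<partial>lborel)
      = (\<integral>x. ?u x * fourier_integral f x \<partial>lborel)"
    by (simp only: mult.assoc)
  also have "\<dots> = (\<integral>s. fourier_integral ?u s * f s \<partial>lborel)"
    by (rule fourier_integral_multiplication[OF u f])
  also have "fourier_integral ?u = (\<lambda>s. cnj (\<integral>v. gaussian v * g (s + d * v) \<partial>lborel))"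
  proof
    fix s
    let ?m = "\<lambda>x. iexp (s * x) * ?w x"
    have m: "integrable lborel ?m"
      by (rule Bochner_Integration.integrable_bound[OF w]) (auto simp: norm_mult)
    have "fourier_integral ?u s = cnj (complex_of_real (1 / sqrt (2 * pi)) * (\<integral>x. ?m x * fourier_integral g x \<partial>lborel))"
      unfolding fourier_integral_def[of ?u] complex_cnj_mult Bochner_Integration.integral_cnj[symmetric]
      by (simp add: exp_cnj mult.assoc)
    also have "(\<integral>x. ?m x * fourier_integral g x \<partial>lborel) = (\<integral>t. fourier_integral ?m t * g t \<partial>lborel)"
      by (rule fourier_integral_multiplication[OF m g])
    also have "\<dots> = (\<integral>t. complex_of_real (exp (- ((t - s) / d)\<^sup>2 / 2) / d) * g t \<partial>lborel)"
      unfolding fourier_integral_modulated_gaussian[OF d] ..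
    also have "\<dots> = \<bar>d\<bar> *\<^sub>R (\<integral>v. complex_of_real (exp (- ((s + d * v - s) / d)\<^sup>2 / 2) / d) * g (s + d * v) \<partial>lborel)"
      using d by (intro lborel_integral_real_affine) auto
    also have "\<dots> = (\<integral>v. complex_of_real (exp (- v\<^sup>2 / 2)) * g (s + d * v) \<partial>lborel)"
      unfolding scaleR_conv_of_real Bochner_Integration.integral_mult_right_zero[symmetric]
      using d by (intro Bochner_Integration.integral_cong) auto
    also have "complex_of_real (1 / sqrt (2 * pi)) * \<dots>
        = (\<integral>v. gaussian v * g (s + d * v) \<partial>lborel)"
      unfolding Bochner_Integration.integral_mult_right_zero[symmetric]
      by (simp add: std_normal_density_def mult.assoc)
    finally show "fourier_integral ?u s = cnj (\<integral>v. gaussian v * g (s + d * v) \<partial>lborel)" .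
  qed
  finally show ?thesis .
qed

section \<open>Plancherel's theorem\<close>

lemma nn_integral_std_normal_density: "(\<integral>\<^sup>+v. ennreal (std_normal_density v) \<partial>lborel) = 1"
  by (subst nn_integral_eq_integral) auto

text \<open>
  Bessel's inequality. By Gaussian regularization the damped norm of the transform is an average
  over \<open>v\<close> of \<open>\<integral> f (s) cnj (f (s + d v)) ds\<close>, and each of these correlations is at most the
  squared norm of \<open>f\<close>; let the damping tend to zero.
\<close>

lemma damped_fourier_integral_bound:
  assumes f: "integrable lborel f" and f2: "f \<in> square_integrable lborel" and d: "d > 0"
  shows "(\<integral>\<^sup>+x. ennreal (exp (- (d * x)\<^sup>2 / 2) * (cmod (fourier_integral f x))\<^sup>2) \<partial>lborel)
    \<le> ennreal ((L2_norm lborel f)\<^sup>2)"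
proof -
  note [measurable] = borel_measurable_integrable[OF f]
  let ?W = "\<lambda>x. exp (- (d * x)\<^sup>2 / 2) * (cmod (fourier_integral f x))\<^sup>2"
  let ?N = "\<lambda>v. gaussian v"
  have [measurable]: "fourier_integral f \<in> borel_measurable borel"
    by measurable
  have W: "integrable lborel ?W"
  proof (rule Bochner_Integration.integrable_bound)
    let ?B = "1 / sqrt (2 * pi) * (\<integral>t. cmod (f t) \<partial>lborel)"
    show "integrable lborel (\<lambda>x. ?B\<^sup>2 * exp (- (d * x)\<^sup>2 / 2))"
      using integrable_gaussian[OF d] by simp
    have "(cmod (fourier_integral f x))\<^sup>2 \<le> ?B\<^sup>2" for x
      by (intro power_mono fourier_integral_bound f) auto
    then have "\<bar>?W x\<bar> \<le> \<bar>?B\<^sup>2 * exp (- (d * x)\<^sup>2 / 2)\<bar>" for x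
      by (subst (1 2) abs_of_nonneg) (auto simp: mult.commute[of "exp _"] intro!: mult_right_mono)
    then show "AE x in lborel. norm (?W x) \<le> norm (?B\<^sup>2 * exp (- (d * x)\<^sup>2 / 2))"
      by simp
  qed measurable
  have W_eq: "complex_of_real (\<integral>x. ?W x \<partial>lborel)
      = (\<integral>s. cnj (\<integral>v. ?N v * f (s + d * v) \<partial>lborel) * f s \<partial>lborel)"
    unfolding gaussian_parseval[OF f f d, symmetric] integral_complex_of_real[symmetric]
    by (simp only: of_real_mult complex_norm_square mult.commute[of "cnj (fourier_integral f _)"])
  have "0 \<le> (\<integral>x. ?W x \<partial>lborel)"
    by (rule Bochner_Integration.integral_nonneg) simp
  moreover have "(\<integral>\<^sup>+x. ennreal (?W x) \<partial>lborel) = ennreal (\<integral>x. ?W x \<partial>lborel)"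
    by (rule nn_integral_eq_integral[OF W]) simp
  ultimately have "(\<integral>\<^sup>+x. ennreal (?W x) \<partial>lborel) = ennreal (cmod (complex_of_real (\<integral>x. ?W x \<partial>lborel)))"
    by (simp only: norm_of_real abs_of_nonneg)
  also have "\<dots> \<le> (\<integral>\<^sup>+s. ennreal (cmod (cnj (\<integral>v. ?N v * f (s + d * v) \<partial>lborel) * f s)) \<partial>lborel)"
    unfolding W_eq
  proof (cases "integrable lborel (\<lambda>s. cnj (\<integral>v. ?N v * f (s + d * v) \<partial>lborel) * f s)")
    case True
    then show "ennreal (cmod (\<integral>s. cnj (\<integral>v. ?N v * f (s + d * v) \<partial>lborel) * f s \<partial>lborel))
        \<le> (\<integral>\<^sup>+s. ennreal (cmod (cnj (\<integral>v. ?N v * f (s + d * v) \<partial>lborel) * f s)) \<partial>lborel)"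
      by (rule integral_norm_bound_ennreal)
  qed (simp add: not_integrable_integral_eq)
  also have "\<dots> \<le> (\<integral>\<^sup>+s. \<integral>\<^sup>+v. ennreal (std_normal_density v) * ennreal (((cmod (f s))\<^sup>2 + (cmod (f (s + d * v)))\<^sup>2) / 2) \<partial>lborel \<partial>lborel)"
  proof (rule nn_integral_mono)
    fix s :: real
    have "ennreal (cmod (\<integral>v. ?N v * f (s + d * v) \<partial>lborel)) \<le> (\<integral>\<^sup>+v. ennreal (cmod (?N v * f (s + d * v))) \<partial>lborel)"
    proof (cases "integrable lborel (\<lambda>v. ?N v * f (s + d * v))")
      case True
      then show ?thesis by (rule integral_norm_bound_ennreal)
    qed (simp add: not_integrable_integral_eq)
    then have "ennreal (cmod (f s)) * ennreal (cmod (\<integral>v. ?N v * f (s + d * v) \<partial>lborel))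
        \<le> ennreal (cmod (f s)) * (\<integral>\<^sup>+v. ennreal (cmod (?N v * f (s + d * v))) \<partial>lborel)"
      by (intro mult_left_mono) auto
    also have "\<dots> = (\<integral>\<^sup>+v. ennreal (cmod (f s)) * ennreal (cmod (?N v * f (s + d * v))) \<partial>lborel)"
      by (rule nn_integral_cmult[symmetric]) measurable
    also have "\<dots> \<le> (\<integral>\<^sup>+v. ennreal (std_normal_density v) * ennreal (((cmod (f s))\<^sup>2 + (cmod (f (s + d * v)))\<^sup>2) / 2) \<partial>lborel)"
    proof (rule nn_integral_mono)
      fix v :: real
      have "cmod (f s) * cmod (?N v * f (s + d * v)) = std_normal_density v * (cmod (f s) * cmod (f (s + d * v)))"
        by (simp add: norm_mult)
      also have "\<dots> \<le> std_normal_density v * (((cmod (f s))\<^sup>2 + (cmod (f (s + d * v)))\<^sup>2) / 2)"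
        using sum_squares_bound[of "cmod (f s)" "cmod (f (s + d * v))"] by (intro mult_left_mono) auto
      finally show "ennreal (cmod (f s)) * ennreal (cmod (?N v * f (s + d * v)))
          \<le> ennreal (std_normal_density v) * ennreal (((cmod (f s))\<^sup>2 + (cmod (f (s + d * v)))\<^sup>2) / 2)"
        by (simp add: ennreal_mult[symmetric] ennreal_leI)
    qed
    finally show "ennreal (cmod (cnj (\<integral>v. ?N v * f (s + d * v) \<partial>lborel) * f s))
        \<le> (\<integral>\<^sup>+v. ennreal (std_normal_density v) * ennreal (((cmod (f s))\<^sup>2 + (cmod (f (s + d * v)))\<^sup>2) / 2) \<partial>lborel)"
      by (simp add: norm_mult ennreal_mult mult.commute)
  qed
  also have "\<dots> = (\<integral>\<^sup>+v. \<integral>\<^sup>+s. ennreal (std_normal_density v) * ennreal (((cmod (f s))\<^sup>2 + (cmod (f (s + d * v)))\<^sup>2) / 2) \<partial>lborel \<partial>lborel)"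
    by (rule lborel_pair.Fubini'[symmetric]) measurable
  also have "\<dots> = (\<integral>\<^sup>+v. ennreal (std_normal_density v) * ennreal ((L2_norm lborel f)\<^sup>2) \<partial>lborel)"
  proof (rule nn_integral_cong)
    fix v :: real
    have shift: "(\<integral>\<^sup>+s. ennreal ((cmod (f (s + d * v)))\<^sup>2) \<partial>lborel) = ennreal ((L2_norm lborel f)\<^sup>2)"
      using nn_integral_real_affine[of "\<lambda>s. ennreal ((cmod (f s))\<^sup>2)" 1 "d * v"] nn_integral_L2_norm[OF f2]
      by (simp add: add.commute)
    have "(\<integral>\<^sup>+s. ennreal (((cmod (f s))\<^sup>2 + (cmod (f (s + d * v)))\<^sup>2) / 2) \<partial>lborel)
        = (\<integral>\<^sup>+s. ennreal (1/2) * (ennreal ((cmod (f s))\<^sup>2) + ennreal ((cmod (f (s + d * v)))\<^sup>2)) \<partial>lborel)"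
      by (intro nn_integral_cong, subst ennreal_plus[symmetric], simp, simp, subst ennreal_mult[symmetric]) auto
    also have "\<dots> = ennreal (1/2) * (ennreal ((L2_norm lborel f)\<^sup>2) + ennreal ((L2_norm lborel f)\<^sup>2))"
      by (subst nn_integral_cmult, measurable, subst nn_integral_add) (auto simp: shift nn_integral_L2_norm[OF f2])
    also have "\<dots> = ennreal ((L2_norm lborel f)\<^sup>2)"
    proof -
      have "ennreal (1/2) * ennreal (y + y) = ennreal y" if "0 \<le> y" for y
        by (subst ennreal_mult[symmetric]) (use that in auto)
      then show ?thesis
        by (simp only: ennreal_plus[symmetric] zero_le_power2)
    qed  finally show "(\<integral>\<^sup>+s. ennreal (std_normal_density v) * ennreal (((cmod (f s))\<^sup>2 + (cmod (f (s + d * v)))\<^sup>2) / 2) \<partial>lborel)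
        = ennreal (std_normal_density v) * ennreal ((L2_norm lborel f)\<^sup>2)"
      by (subst nn_integral_cmult) auto
  qed
  also have "\<dots> = ennreal ((L2_norm lborel f)\<^sup>2)"
    by (subst nn_integral_multc) (auto simp: nn_integral_std_normal_density)
  finally show ?thesis .
qed

lemma gaussian_tendsto_1: "(\<lambda>n. exp (- (inverse (real (Suc n)) * x)\<^sup>2 / 2)) \<longlonglongrightarrow> 1"
proof -
  have "(\<lambda>n. exp (- (inverse (real (Suc n)) * x)\<^sup>2 / 2)) \<longlonglongrightarrow> exp (- (0 * x)\<^sup>2 / 2)"
    by (intro tendsto_intros LIMSEQ_inverse_real_of_nat) simp
  then show ?thesis by simp
qed

lemma fourier_integral_Bessel:
  assumes f: "integrable lborel f" and f2: "f \<in> square_integrable lborel"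
  shows "fourier_integral f \<in> square_integrable lborel"
    and "L2_norm lborel (fourier_integral f) \<le> L2_norm lborel f"
proof -
  note [measurable] = borel_measurable_integrable[OF f]
  let ?d = "\<lambda>n. inverse (real (Suc n))"
  let ?W = "\<lambda>n x. ennreal (exp (- (?d n * x)\<^sup>2 / 2) * (cmod (fourier_integral f x))\<^sup>2)"
  have [measurable]: "fourier_integral f \<in> borel_measurable borel"
    by measurable
  have lim: "(\<lambda>n. ?W n x) \<longlonglongrightarrow> ennreal (1 * (cmod (fourier_integral f x))\<^sup>2)" for x
    by (intro tendsto_ennrealI tendsto_mult gaussian_tendsto_1 tendsto_const)
  have W_liminf: "ennreal ((cmod (fourier_integral f x))\<^sup>2) = liminf (\<lambda>n. ?W n x)" for x
    using lim_imp_Liminf[OF trivial_limit_sequentially lim[of x]] by (simp only: mult_1)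
  have "(\<integral>\<^sup>+x. ennreal ((cmod (fourier_integral f x))\<^sup>2) \<partial>lborel) = (\<integral>\<^sup>+x. liminf (\<lambda>n. ?W n x) \<partial>lborel)"
    by (simp only: W_liminf)
  also have "\<dots> \<le> liminf (\<lambda>n. \<integral>\<^sup>+x. ?W n x \<partial>lborel)"
    by (rule nn_integral_liminf) measurable
  also have "\<dots> \<le> liminf (\<lambda>n :: nat. ennreal ((L2_norm lborel f)\<^sup>2))"
    by (intro Liminf_mono always_eventually allI damped_fourier_integral_bound f f2) simp
  also have "\<dots> = ennreal ((L2_norm lborel f)\<^sup>2)"
    by (rule Liminf_const) simp
  finally have *: "(\<integral>\<^sup>+x. ennreal ((cmod (fourier_integral f x))\<^sup>2) \<partial>lborel) \<le> ennreal ((L2_norm lborel f)\<^sup>2)" .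
  show "fourier_integral f \<in> square_integrable lborel" "L2_norm lborel (fourier_integral f) \<le> L2_norm lborel f"
    by (rule L2_norm_leI[OF *]; measurable; simp)+
qed

lemma cnj_indicator [simp]: "cnj (indicator A x) = indicator A x"
  by (simp add: indicator_def)

lemma indicator_square_integrable: "indicator {a..b::real} \<in> square_integrable lborel"
proof -
  have "(\<lambda>x. (cmod (indicator {a..b} x))\<^sup>2) = indicator {a..b}"
    by (auto simp: indicator_def)
  then show ?thesis
    by (intro square_integrableI) (auto simp: emeasure_lborel_Icc_eq)
qed

lemma integrable_truncation:
  assumes f: "f \<in> square_integrable lborel"
  shows "integrable lborel (\<lambda>x. indicator {a..b::real} x * f x)"
  using integrable_cnj_mult[OF indicator_square_integrable f] by simp

lemma truncation_square_integrable:
  "f \<in> square_integrable lborel \<Longrightarrow> (\<lambda>x. indicator {a..b::real} x * f x) \<in> square_integrable lborel"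
  by (rule square_integrable_indicator) auto

lemma truncation_tendsto:
  assumes f: "f \<in> square_integrable lborel"
  shows "(\<lambda>n. L2_norm lborel (\<lambda>x. indicator {- real n..real n} x * f x - f x)) \<longlonglongrightarrow> 0"
proof -
  note [measurable] = square_integrable_measurable[OF f]
  have "(\<lambda>n. \<integral>x. (cmod (indicator {- real n..real n} x * f x - f x))\<^sup>2 \<partial>lborel) \<longlonglongrightarrow> integral\<^sup>L lborel (\<lambda>x::real. 0::real)"
  proof (rule Bochner_Integration.integral_dominated_convergence[where w = "\<lambda>x. (cmod (f x))\<^sup>2"])
    show "AE x in lborel. (\<lambda>n. (cmod (indicator {- real n..real n} x * f x - f x))\<^sup>2) \<longlonglongrightarrow> 0"
    proof (rule AE_I2, rule tendsto_eventually)
      fix x :: real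
      obtain N :: nat where "\<bar>x\<bar> \<le> real N"
        using real_arch_simple by blast
      then show "\<forall>\<^sub>F n in sequentially. (cmod (indicator {- real n..real n} x * f x - f x))\<^sup>2 = 0"
        by (intro eventually_sequentiallyI[of N]) (auto simp: indicator_def abs_le_iff)
    qed
    show "integrable lborel (\<lambda>x. (cmod (f x))\<^sup>2)"
      by (rule square_integrable_integrable[OF f])
  qed (auto simp: indicator_def)
  then show ?thesis
    unfolding L2_norm_def using tendsto_real_sqrt by fastforce
qed

lemma square_integrable_cnj:
  "f \<in> square_integrable M \<Longrightarrow> (\<lambda>x. cnj (f x)) \<in> square_integrable M"
  by (rule square_integrable_bound[where C = 1]) auto

text \<open>
  The adjoint of the Fourier transform is everywhere defined: on truncations of \<open>c\<close> it is again an
  integral transform, these are Cauchy by Bessel's inequality, and the space is complete.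
\<close>

lemma fourier_integral_adjoint_exists:
  assumes c: "c \<in> square_integrable lborel"
  obtains d where "d \<in> square_integrable lborel"
    "\<And>g. integrable lborel g \<Longrightarrow> g \<in> square_integrable lborel \<Longrightarrow>
      (\<integral>x. cnj (c x) * fourier_integral g x \<partial>lborel) = (\<integral>x. cnj (d x) * g x \<partial>lborel)"
proof -
  \<comment> \<open>with \<open>E n\<close> the transform of the conjugate of \<open>C n\<close>, the adjoint maps \<open>C n\<close> to the conjugate of \<open>E n\<close>\<close>
  define C where "C n x = indicator {- real n..real n} x * c x" for n x
  note C_lim = truncation_tendsto[OF c, folded C_def]
  have C: "C n \<in> square_integrable lborel" for n
    unfolding C_def[abs_def] by (rule truncation_square_integrable[OF c])
  have C1: "integrable lborel (C n)" for n
    unfolding C_def[abs_def] by (rule integrable_truncation[OF c])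
  have cnjC: "(\<lambda>x. cnj (C n x)) \<in> square_integrable lborel" "integrable lborel (\<lambda>x. cnj (C n x))" for n
    using square_integrable_cnj[OF C] C1[of n] by auto
  define E where "E n x = fourier_integral (\<lambda>x. cnj (C n x)) x" for n x
  have E: "E n \<in> square_integrable lborel" for n
    unfolding E_def[abs_def] by (rule fourier_integral_Bessel[OF cnjC(2,1)])
  have cnjE: "(\<lambda>x. cnj (E n x)) \<in> square_integrable lborel" for n
    by (rule square_integrable_cnj[OF E])
  have dist: "L2_norm lborel (\<lambda>x. cnj (E m x) - cnj (E n x)) \<le> L2_norm lborel (\<lambda>x. C m x - c x) + L2_norm lborel (\<lambda>x. C n x - c x)" for m n
  proof -
    have "L2_norm lborel (\<lambda>x. cnj (E m x) - cnj (E n x)) = L2_norm lborel (fourier_integral (\<lambda>x. cnj (C m x) - cnj (C n x)))"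
      unfolding L2_norm_def E_def fourier_integral_diff[OF cnjC(2) cnjC(2), symmetric]
        complex_cnj_diff[symmetric] complex_mod_cnj ..
    also have "\<dots> \<le> L2_norm lborel (\<lambda>x. cnj (C m x) - cnj (C n x))"
      using cnjC by (intro fourier_integral_Bessel square_integrable_diff) auto
    also have "\<dots> = L2_norm lborel (\<lambda>x. C m x - C n x)"
      unfolding L2_norm_def complex_cnj_diff[symmetric] complex_mod_cnj ..
    also have "\<dots> \<le> L2_norm lborel (\<lambda>x. C m x - c x) + L2_norm lborel (\<lambda>x. c x - C n x)"
      by (rule L2_norm_triangle_diff[OF C c C])
    finally show ?thesis
      by (simp add: L2_norm_minus_commute[of _ c])
  qed
  obtain d where d: "d \<in> square_integrable lborel" "(\<lambda>n. L2_norm lborel (\<lambda>x. cnj (E n x) - d x)) \<longlonglongrightarrow> 0"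
  proof (rule square_integrable_complete[OF cnjE])
    fix e :: real assume "e > 0"
    then have "\<forall>\<^sub>F n in sequentially. L2_norm lborel (\<lambda>x. C n x - c x) < e / 2"
      using order_tendstoD(2)[OF C_lim, of "e / 2"] by simp
    then obtain N where N: "\<And>n. n \<ge> N \<Longrightarrow> L2_norm lborel (\<lambda>x. C n x - c x) < e / 2"
      by (auto simp: eventually_sequentially)
    then show "\<exists>N. \<forall>m\<ge>N. \<forall>n\<ge>N. L2_norm lborel (\<lambda>x. cnj (E m x) - cnj (E n x)) < e"
    proof (intro exI[of _ N] allI impI)
      fix m n assume "N \<le> m" "N \<le> n"
      then show "L2_norm lborel (\<lambda>x. cnj (E m x) - cnj (E n x)) < e"
        using dist[of m n] N[of m] N[of n] by linarith
    qed
  qed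
  show thesis
  proof (rule that[OF d(1)])
    fix g :: "real \<Rightarrow> complex" assume g: "integrable lborel g" "g \<in> square_integrable lborel"
    have "(\<lambda>n. \<integral>x. cnj (C n x) * fourier_integral g x \<partial>lborel) \<longlonglongrightarrow> (\<integral>x. cnj (c x) * fourier_integral g x \<partial>lborel)"
      by (rule L2_inner_tendsto_left[OF C c fourier_integral_Bessel(1)[OF g] C_lim])
    moreover have "(\<lambda>n. \<integral>x. cnj (cnj (E n x)) * g x \<partial>lborel) \<longlonglongrightarrow> (\<integral>x. cnj (d x) * g x \<partial>lborel)"
      by (rule L2_inner_tendsto_left[OF cnjE d(1) g(2) d(2)])
    moreover have "(\<integral>x. cnj (C n x) * fourier_integral g x \<partial>lborel) = (\<integral>x. cnj (cnj (E n x)) * g x \<partial>lborel)" for n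
      unfolding E_def complex_cnj_cnj by (rule fourier_integral_multiplication[OF cnjC(2) g(1)])
    ultimately show "(\<integral>x. cnj (c x) * fourier_integral g x \<partial>lborel) = (\<integral>x. cnj (d x) * g x \<partial>lborel)"
      using LIMSEQ_unique by fastforce
  qed
qed

lemma gaussian_average_tendsto:
  fixes g :: "real \<Rightarrow> complex"
  assumes [measurable]: "g \<in> borel_measurable borel" and bound: "\<And>x. cmod (g x) \<le> B" and cont: "isCont g s"
  shows "(\<lambda>n. \<integral>v. gaussian v * g (s + inverse (real (Suc n)) * v) \<partial>lborel) \<longlonglongrightarrow> g s"
proof -
  have "(\<lambda>n. \<integral>v. gaussian v * g (s + inverse (real (Suc n)) * v) \<partial>lborel)
      \<longlonglongrightarrow> (\<integral>v. gaussian v * g s \<partial>lborel)"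
  proof (rule Bochner_Integration.integral_dominated_convergence[where w = "\<lambda>v. std_normal_density v * B"])
    have "(\<lambda>n. g (s + inverse (real (Suc n)) * v)) \<longlonglongrightarrow> g s" for v
    proof (rule isCont_tendsto_compose[OF cont])
      have "(\<lambda>n. s + inverse (real (Suc n)) * v) \<longlonglongrightarrow> s + 0 * v"
        by (intro tendsto_intros LIMSEQ_inverse_real_of_nat)
      then show "(\<lambda>n. s + inverse (real (Suc n)) * v) \<longlonglongrightarrow> s" by simp
    qed
    then show "AE v in lborel. (\<lambda>n. gaussian v * g (s + inverse (real (Suc n)) * v))
        \<longlonglongrightarrow> gaussian v * g s"
      by (intro AE_I2 tendsto_mult tendsto_const)
    show "AE v in lborel. norm (gaussian v * g (s + inverse (real (Suc n)) * v))
        \<le> std_normal_density v * B" for n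
      by (intro AE_I2) (simp add: norm_mult mult_left_mono bound)
  qed auto
  also have "(\<integral>v. gaussian v * g s \<partial>lborel) = g s"
    by simp
  finally show ?thesis .
qed

lemma fourier_parseval_almost_continuous:
  assumes f: "integrable lborel f" "f \<in> square_integrable lborel"
    and g: "integrable lborel g" "g \<in> square_integrable lborel"
    and bound: "\<And>x. cmod (g x) \<le> B" and cont: "AE s in lborel. isCont g s"
  shows "(\<integral>x. cnj (fourier_integral g x) * fourier_integral f x \<partial>lborel) = (\<integral>x. cnj (g x) * f x \<partial>lborel)"
proof -
  note [measurable] = borel_measurable_integrable[OF f(1)] borel_measurable_integrable[OF g(1)]
  let ?d = "\<lambda>n. inverse (real (Suc n))"
  let ?w = "\<lambda>n x. complex_of_real (exp (- (?d n * x)\<^sup>2 / 2))"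
  let ?P = "\<lambda>x. cnj (fourier_integral g x) * fourier_integral f x"
  let ?A = "\<lambda>n s. \<integral>v. gaussian v * g (s + ?d n * v) \<partial>lborel"
  have [measurable]: "fourier_integral f \<in> borel_measurable borel" "fourier_integral g \<in> borel_measurable borel"
    by measurable
  have "0 \<le> B"
    using bound norm_ge_zero order_trans by blast
  have "(\<lambda>n. \<integral>x. ?w n x * ?P x \<partial>lborel) \<longlonglongrightarrow> (\<integral>x. ?P x \<partial>lborel)"
  proof (rule Bochner_Integration.integral_dominated_convergence[where w = "\<lambda>x. cmod (?P x)"])
    show "integrable lborel (\<lambda>x. cmod (?P x))"
      by (intro integrable_norm integrable_cnj_mult fourier_integral_Bessel f g)
    have "(\<lambda>n. ?w n x * ?P x) \<longlonglongrightarrow> complex_of_real 1 * ?P x" for x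
      by (intro tendsto_mult tendsto_of_real gaussian_tendsto_1 tendsto_const)
    then show "AE x in lborel. (\<lambda>n. ?w n x * ?P x) \<longlonglongrightarrow> ?P x"
      by simp
    have "cmod (?w n x) \<le> 1" for n x
      by (simp only: norm_of_real abs_exp_cancel) simp
    then have "cmod (?w n x * ?P x) \<le> cmod (?P x)" for n x
      unfolding norm_mult[of "?w n x"] by (intro mult_left_le_one_le) auto
    then show "AE x in lborel. norm (?w n x * ?P x) \<le> cmod (?P x)" for n
      by blast
  qed measurable
  moreover have "(\<lambda>n. \<integral>s. cnj (?A n s) * f s \<partial>lborel) \<longlonglongrightarrow> (\<integral>s. cnj (g s) * f s \<partial>lborel)"
  proof (rule Bochner_Integration.integral_dominated_convergence[where w = "\<lambda>s. B * cmod (f s)"])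
    show "AE s in lborel. (\<lambda>n. cnj (?A n s) * f s) \<longlonglongrightarrow> cnj (g s) * f s"
      using cont
    proof eventually_elim
      case (elim s)
      show ?case
        by (intro tendsto_mult tendsto_cnj gaussian_average_tendsto[OF _ bound elim] tendsto_const) measurable
    qed
    have "cmod (?A n s) \<le> (\<integral>v. std_normal_density v * B \<partial>lborel)" for n s
    proof (rule order_trans[OF integral_norm_bound Bochner_Integration.integral_mono])
      show N: "integrable lborel (\<lambda>v. std_normal_density v * B)"
        by simp
      show le: "norm (gaussian v * g (s + ?d n * v)) \<le> std_normal_density v * B" for v
        by (simp add: norm_mult mult_left_mono bound)
      show "integrable lborel (\<lambda>v. norm (gaussian v * g (s + ?d n * v)))"
        by (rule Bochner_Integration.integrable_bound[OF N]) (use le in \<open>auto intro: order_trans[OF _ abs_ge_self]\<close>)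
    qed
    then have "cmod (?A n s) \<le> B" for n s
      by simp
    then show "AE s in lborel. norm (cnj (?A n s) * f s) \<le> B * cmod (f s)" for n
      by (intro AE_I2) (auto simp: norm_mult intro: mult_right_mono)
    show "integrable lborel (\<lambda>s. B * cmod (f s))"
      using f(1) by simp
  qed measurable
  moreover have "(\<integral>x. ?w n x * ?P x \<partial>lborel) = (\<integral>s. cnj (?A n s) * f s \<partial>lborel)" for n
    by (rule gaussian_parseval[OF f(1) g(1)]) simp
  ultimately show ?thesis
    by (simp only:) (rule LIMSEQ_unique)
qed

text \<open>
  Test against continuous approximations of the phase \<open>cnj (sgn h)\<close>, truncated to the unit disc
  so that dominated convergence applies; in the limit the pairing is \<open>\<integral> |h|\<close>.
\<close>

lemma AE_eq_0_if_orthogonal_continuous: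
  fixes h :: "real \<Rightarrow> complex"
  assumes h: "integrable lborel h"
    and orth: "\<And>k. continuous_on UNIV k \<Longrightarrow> (\<And>x. cmod (k x) \<le> 1) \<Longrightarrow> (\<integral>x. k x * h x \<partial>lborel) = 0"
  shows "AE x in lborel. h x = 0"
proof -
  note [measurable] = borel_measurable_integrable[OF h]
  let ?\<sigma> = "\<lambda>x. cnj (sgn (h x))"
  have [measurable]: "(sgn :: complex \<Rightarrow> complex) \<in> borel_measurable borel"
    unfolding sgn_div_norm[abs_def] by measurable
  have "?\<sigma> \<in> borel_measurable borel"
    by measurable
  then have "?\<sigma> \<in> borel_measurable lebesgue"
    by (intro measurable_completion) simp
  then have "?\<sigma> measurable_on UNIV"
    by (rule lebesgue_measurable_imp_measurable_on) simp
  then obtain N g where N: "negligible N" and g: "\<And>n. continuous_on UNIV (g n)"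
    and lim: "\<And>x. x \<notin> N \<Longrightarrow> (\<lambda>n. g n x) \<longlonglongrightarrow> ?\<sigma> x"
    unfolding measurable_on_def by auto
  \<comment> \<open>the limit \<open>?\<sigma>\<close> has modulus at most 1, so the truncation does not change it\<close>
  define k where "k n x = g n x / complex_of_real (max 1 (cmod (g n x)))" for n x
  have k_cont: "continuous_on UNIV (k n)" for n
    unfolding k_def[abs_def] by (intro continuous_intros g) (auto simp: max_def)
  have k_bound: "cmod (k n x) \<le> 1" for n x
    by (auto simp: k_def norm_divide max_def divide_simps)
  have [measurable]: "k n \<in> borel_measurable borel" for n
    by (rule borel_measurable_continuous_onI[OF k_cont])
  have "(\<lambda>n. \<integral>x. k n x * h x \<partial>lborel) \<longlonglongrightarrow> (\<integral>x. ?\<sigma> x * h x \<partial>lborel)"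
  proof (rule Bochner_Integration.integral_dominated_convergence[where w = "\<lambda>x. cmod (h x)"])
    show "AE x in lborel. (\<lambda>n. k n x * h x) \<longlonglongrightarrow> ?\<sigma> x * h x"
    proof -
      have "AE x in lebesgue. x \<notin> N"
        using N by (simp add: negligible_iff_null_sets AE_not_in)
      then have "AE x in lborel. x \<notin> N"
        by (simp add: AE_completion_iff)
      then show ?thesis
      proof eventually_elim
        case (elim x)
        have "(\<lambda>n. k n x) \<longlonglongrightarrow> ?\<sigma> x / complex_of_real (max 1 (cmod (?\<sigma> x)))"
          unfolding k_def by (intro tendsto_intros lim elim) (auto simp: max_def)
        also have "max 1 (cmod (?\<sigma> x)) = 1"
          by (simp add: norm_sgn)
        finally show ?case
          by (intro tendsto_mult tendsto_const) simp
      qed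
    qed
    show "AE x in lborel. norm (k n x * h x) \<le> cmod (h x)" for n
      by (intro AE_I2) (simp add: norm_mult k_bound mult_left_le_one_le)
  qed (use h in auto)
  then have "(\<integral>x. ?\<sigma> x * h x \<partial>lborel) = 0"
    unfolding orth[OF k_cont k_bound] by (simp only: LIMSEQ_const_iff)
  moreover have "?\<sigma> x * h x = complex_of_real (cmod (h x))" for x
    by (cases "h x = 0") (auto simp: sgn_div_norm scaleR_conv_of_real complex_norm_square[symmetric]
        power2_eq_square field_simps mult.commute[of "cnj _"])
  ultimately have "(\<integral>x. cmod (h x) \<partial>lborel) = 0"
    by simp
  then show ?thesis
    using integral_nonneg_eq_0_iff_AE[of lborel "\<lambda>x. cmod (h x)"] h by simp
qed

lemma AE_isCont_truncation:
  fixes k :: "real \<Rightarrow> complex"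
  assumes "continuous_on UNIV k"
  shows "AE s in lborel. isCont (\<lambda>x. indicator {a..b} x * k x) s"
proof -
  have "AE s in lborel. s \<noteq> a" "AE s in lborel. s \<noteq> b"
    by (rule AE_lborel_singleton)+
  then show ?thesis
  proof eventually_elim
    case (elim s)
    have k: "isCont k s"
      using assms by (simp add: continuous_on_eq_continuous_at)
    consider "s \<in> {a<..<b}" | "s \<in> - {a..b}"
      using elim by fastforce
    then show ?case
    proof cases
      case 1
      have "\<forall>\<^sub>F x in nhds s. indicator {a..b} x * k x = k x"
        using eventually_nhds_in_open[OF open_greaterThanLessThan 1] by eventually_elim simp
      from isCont_cong[OF this] k show ?thesis by simp
    next
      case 2
      have "\<forall>\<^sub>F x in nhds s. indicator {a..b} x * k x = 0"
        using eventually_nhds_in_open[OF _ 2] by (rule eventually_mono) auto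
      from isCont_cong[OF this] show ?thesis by simp
    qed
  qed
qed

text \<open>
  Apply the adjoint of the Fourier transform to the transform of \<open>f\<close>. The result agrees with \<open>f\<close>
  on \<open>[a, b]\<close>, because both have the same pairing with every function that is continuous on
  \<open>[a, b]\<close>, for which the correlations in Gaussian regularization converge pointwise.
\<close>

theorem fourier_parseval:
  assumes f: "f \<in> square_integrable lborel" "\<And>x. x \<notin> {a..b} \<Longrightarrow> f x = 0"
    and g: "g \<in> square_integrable lborel" "\<And>x. x \<notin> {a..b} \<Longrightarrow> g x = 0"
  shows "(\<integral>x. cnj (fourier_integral f x) * fourier_integral g x \<partial>lborel) = (\<integral>x. cnj (f x) * g x \<partial>lborel)"
proof -
  have trunc: "(\<lambda>x. indicator {a..b} x * u x) = u" if "\<And>x. x \<notin> {a..b} \<Longrightarrow> u x = 0" for u :: "real \<Rightarrow> complex"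
    using that by (auto simp: indicator_def fun_eq_iff)
  have f1: "integrable lborel f" and g1: "integrable lborel g"
    using integrable_truncation[OF f(1), of a b] integrable_truncation[OF g(1), of a b] trunc[of f] trunc[of g] f(2) g(2)
    by fastforce+
  note Ff = fourier_integral_Bessel(1)[OF f1 f(1)]
  obtain d where d: "d \<in> square_integrable lborel"
    and adj: "\<And>g. integrable lborel g \<Longrightarrow> g \<in> square_integrable lborel \<Longrightarrow>
      (\<integral>x. cnj (fourier_integral f x) * fourier_integral g x \<partial>lborel) = (\<integral>x. cnj (d x) * g x \<partial>lborel)"
    using fourier_integral_adjoint_exists[OF Ff] by blast
  let ?h = "\<lambda>x. cnj (indicator {a..b} x * (d x - f x))"
  note df = square_integrable_diff[OF d f(1)]
  have "AE x in lborel. ?h x = 0"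
  proof (rule AE_eq_0_if_orthogonal_continuous)
    show "integrable lborel ?h"
      using integrable_truncation[OF df, of a b] by (simp del: complex_cnj_mult complex_cnj_diff)
    fix k :: "real \<Rightarrow> complex" assume k: "continuous_on UNIV k" "\<And>x. cmod (k x) \<le> 1"
    let ?k = "\<lambda>x. indicator {a..b} x * k x"
    have [measurable]: "k \<in> borel_measurable borel"
      by (rule borel_measurable_continuous_onI[OF k(1)])
    have k2: "?k \<in> square_integrable lborel"
      by (rule square_integrable_bound[where C = 1, OF indicator_square_integrable[of a b]])
         (use k(2) in \<open>auto simp: indicator_def\<close>)
    have k1: "integrable lborel ?k"
      using integrable_truncation[OF k2, of a b] by (subst (asm) trunc) auto
    have kB: "cmod (?k x) \<le> 1" for x
      using k(2)[of x] by (simp add: indicator_def)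
    have swap: "(\<integral>x. cnj (u x) * v x \<partial>lborel) = cnj (\<integral>x. cnj (v x) * u x \<partial>lborel)" for u v :: "real \<Rightarrow> complex"
      unfolding Bochner_Integration.integral_cnj[symmetric] by (simp add: mult.commute)
    have "(\<integral>x. cnj (d x) * ?k x \<partial>lborel) = (\<integral>x. cnj (fourier_integral f x) * fourier_integral ?k x \<partial>lborel)"
      by (rule adj[OF k1 k2, symmetric])
    also have "\<dots> = cnj (\<integral>x. cnj (?k x) * f x \<partial>lborel)"
      unfolding swap[of "fourier_integral f"]
      by (subst fourier_parseval_almost_continuous[OF f1 f(1) k1 k2 kB AE_isCont_truncation[OF k(1)]]) (rule refl)
    also have "\<dots> = (\<integral>x. cnj (f x) * ?k x \<partial>lborel)"
      by (rule swap[symmetric])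
    finally have "(\<integral>x. cnj (d x) * ?k x \<partial>lborel) - (\<integral>x. cnj (f x) * ?k x \<partial>lborel) = 0"
      by simp
    then have "(\<integral>x. cnj (d x) * ?k x - cnj (f x) * ?k x \<partial>lborel) = 0"
      by (subst Bochner_Integration.integral_diff) (intro integrable_cnj_mult d f k2)+
    then show "(\<integral>x. k x * ?h x \<partial>lborel) = 0"
      by (simp add: algebra_simps)
  qed
  then have "AE x in lborel. cnj (d x) * g x = cnj (f x) * g x"
  proof eventually_elim
    case (elim x)
    then show ?case
      using g(2)[of x] by (cases "x \<in> {a..b}") auto
  qed
  then have "(\<integral>x. cnj (d x) * g x \<partial>lborel) = (\<integral>x. cnj (f x) * g x \<partial>lborel)"
    by (intro integral_cong_AE borel_measurable_integrable integrable_cnj_mult d f g)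
  then show ?thesis
    using adj[OF g1 g(1)] by simp
qed

section \<open>Absolutely continuous functions\<close>

definition nonoverlapping :: "real \<Rightarrow> real \<Rightarrow> (real \<times> real) set \<Rightarrow> bool" where
  "nonoverlapping a b D \<longleftrightarrow> finite D \<and> (\<forall>(u, v) \<in> D. a \<le> u \<and> u < v \<and> v \<le> b) \<and>
     disjoint_family_on (\<lambda>(u, v). {u<..<v}) D"

lemma absolutely_continuous_fun_iff:
  "absolutely_continuous_fun a b f \<longleftrightarrow> (\<forall>e>0. \<exists>d>0. \<forall>D. nonoverlapping a b D \<longrightarrow>
     (\<Sum>(u, v) \<in> D. v - u) < d \<longrightarrow> (\<Sum>(u, v) \<in> D. cmod (f v - f u)) < e)"
  unfolding absolutely_continuous_fun_def nonoverlapping_def by (simp only: imp_conjL)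

text \<open>
  The fundamental theorem of calculus for absolutely continuous functions, by a gauge argument.
  Outside the exceptional null set \<open>N\<close> the gauge comes from differentiability. The tags in \<open>N\<close> are
  confined to an open set of measure less than the \<open>\<delta>\<close> of absolute continuity, so their
  intervals contribute little to the total increment.
\<close>

lemma absolutely_continuous_fun_has_integral:
  fixes f f' :: "real \<Rightarrow> complex"
  assumes "a \<le> b" and ac: "absolutely_continuous_fun a b f" and N: "negligible N"
    and deriv: "\<And>x. x \<in> {a..b} - N \<Longrightarrow> (f has_vector_derivative f' x) (at x within {a..b})"
  shows "(f' has_integral (f b - f a)) {a..b}"
proof -
  define g where "g x = (if x \<in> N then 0 else f' x)" for x
  have "(g has_integral (f b - f a)) {a..b}"
    unfolding has_integral_real
  proof (intro allI impI)
    fix e :: real assume e: "e > 0"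
    define c where "c = e / (2 * (b - a + 1))"
    have c: "c > 0" "c * (b - a) < e / 2"
      using e \<open>a \<le> b\<close> by (auto simp: c_def field_simps)
    have "e / 2 > 0"
      using e by simp
    then obtain d where d: "d > 0" and small: "\<forall>D. nonoverlapping a b D \<longrightarrow>
        (\<Sum>(u, v) \<in> D. v - u) < d \<longrightarrow> (\<Sum>(u, v) \<in> D. cmod (f v - f u)) < e / 2"
      using ac unfolding absolutely_continuous_fun_iff by blast
    have N_leb: "N \<in> sets lebesgue" "N \<in> null_sets lebesgue"
      using N by (auto simp: negligible_iff_null_sets)
    obtain U where U: "open U" "N \<subseteq> U" "U - N \<in> lmeasurable" "emeasure lebesgue (U - N) < ennreal d"
      using sets_lebesgue_outer_open[OF N_leb(1) d] by blast
    have U_meas: "U \<in> lmeasurable" "measure lebesgue U < d"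
    proof -
      have eq: "emeasure lebesgue U = emeasure lebesgue (U - N)"
        using emeasure_Diff_null_set[OF N_leb(2), of U] U(1) by (simp add: borel_open)
      then show "U \<in> lmeasurable"
        using U by (intro fmeasurableI) (auto simp: fmeasurable_def borel_open intro: order.strict_trans)
      have "emeasure lebesgue U < ennreal d"
        using U(4) eq by simp
      then show "measure lebesgue U < d"
        using emeasure_eq_measure2[OF \<open>U \<in> lmeasurable\<close>] by (simp add: ennreal_less_iff)
    qed
    have "\<forall>x. \<exists>r>0. x \<in> {a..b} - N \<longrightarrow>
        (\<forall>y\<in>{a..b}. norm (y - x) < r \<longrightarrow> norm (f y - f x - (y - x) *\<^sub>R f' x) \<le> c * norm (y - x))"
      using deriv[unfolded has_vector_derivative_def has_derivative_within_alt] c(1) by metis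
    then obtain r where r: "\<And>x. 0 < r x"
      and straddle: "\<And>x y. x \<in> {a..b} - N \<Longrightarrow> y \<in> {a..b} \<Longrightarrow> norm (y - x) < r x \<Longrightarrow>
        norm (f y - f x - (y - x) *\<^sub>R f' x) \<le> c * norm (y - x)"
      by metis
    \<comment> \<open>intervals tagged in \<open>N\<close> stay inside \<open>U\<close>, the others are short enough for the derivative estimate\<close>
    define \<gamma> where "\<gamma> x = (if x \<in> N then U else ball x (r x))" for x
    have gauge: "gauge \<gamma>"
      using U r by (auto simp: gauge_def \<gamma>_def)
    have close: "norm ((\<Sum>(x, K) \<in> p. measure lborel K *\<^sub>R g x) - (f b - f a)) < e"
      if p: "p tagged_division_of {a..b}" and fine: "\<gamma> fine p" for p
    proof -
      have "finite p"
        using p by (rule tagged_division_of_finite)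
      have K: "\<exists>u v. K = {u..v} \<and> u \<le> x \<and> x \<le> v \<and> a \<le> u \<and> v \<le> b \<and> Inf K = u \<and> Sup K = v \<and> measure lborel K = v - u \<and> {u..v} \<subseteq> \<gamma> x"
        if xK: "(x, K) \<in> p" for x K
      proof -
        obtain u v where uv: "K = {u..v}"
          using tagged_division_ofD(4)[OF p xK] by auto
        have "x \<in> K" "K \<subseteq> {a..b}" "K \<subseteq> \<gamma> x"
          using tagged_division_ofD(2,3)[OF p xK] fine xK by auto
        then show ?thesis
          using uv by (intro exI[of _ u] exI[of _ v]) auto
      qed
      define p1 p2 where "p1 = {(x, K) \<in> p. x \<notin> N}" and "p2 = {(x, K) \<in> p. x \<in> N}"
      have p12: "p = p1 \<union> p2" "p1 \<inter> p2 = {}" "finite p1" "finite p2"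
        using \<open>finite p\<close> by (auto simp: p1_def p2_def intro: rev_finite_subset)
      let ?T = "\<lambda>(x, K). measure lborel K *\<^sub>R g x - (f (Sup K) - f (Inf K))"
      have "f b - f a = (\<Sum>(x, K) \<in> p. f (Sup K) - f (Inf K))"
        using additive_tagged_division_1[OF \<open>a \<le> b\<close> p, of f] by simp
      then have "(\<Sum>(x, K) \<in> p. measure lborel K *\<^sub>R g x) - (f b - f a) = (\<Sum>z \<in> p. ?T z)"
        by (simp add: sum_subtractf case_prod_unfold)
      also have "\<dots> = (\<Sum>z \<in> p1. ?T z) + (\<Sum>z \<in> p2. ?T z)"
        unfolding p12(1) by (rule sum.union_disjoint) (use p12 in auto)
      finally have split: "norm ((\<Sum>(x, K) \<in> p. measure lborel K *\<^sub>R g x) - (f b - f a))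
          \<le> norm (\<Sum>z \<in> p1. ?T z) + norm (\<Sum>z \<in> p2. ?T z)"
        by (simp add: norm_triangle_ineq)
      have "norm (\<Sum>z \<in> p1. ?T z) \<le> (\<Sum>(x, K) \<in> p1. c * measure lborel K)"
      proof (rule sum_norm_le)
        fix z assume "z \<in> p1"
        then obtain x K where z: "z = (x, K)" "(x, K) \<in> p" "x \<notin> N"
          by (auto simp: p1_def)
        obtain u v where uv: "K = {u..v}" "u \<le> x" "x \<le> v" "a \<le> u" "v \<le> b" "Inf K = u" "Sup K = v"
            "measure lborel K = v - u" "{u..v} \<subseteq> \<gamma> x"
          using K[OF z(2)] by blast
        have near: "norm (u - x) < r x" "norm (v - x) < r x"
        proof -
          have "u \<in> \<gamma> x" "v \<in> \<gamma> x"
            using uv by auto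
          then show "norm (u - x) < r x" "norm (v - x) < r x"
            using z(3) by (auto simp: \<gamma>_def dist_real_def)
        qed
        have "?T z = (f u - f x - (u - x) *\<^sub>R f' x) - (f v - f x - (v - x) *\<^sub>R f' x)"
          using uv z by (simp add: g_def algebra_simps)
        then have "norm (?T z) \<le> norm (f u - f x - (u - x) *\<^sub>R f' x) + norm (f v - f x - (v - x) *\<^sub>R f' x)"
          by (metis norm_triangle_ineq4)
        also have "\<dots> \<le> c * norm (u - x) + c * norm (v - x)"
          using uv z near by (intro add_mono straddle) auto
        also have "\<dots> = c * measure lborel K"
          using uv by (simp add: algebra_simps)
        finally show "norm (?T z) \<le> (case z of (x, K) \<Rightarrow> c * measure lborel K)"
          using z by simp
      qed
      also have "\<dots> \<le> (\<Sum>(x, K) \<in> p. c * measure lborel K)"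
        using p12 c(1) by (intro sum_mono2) auto
      also have "\<dots> = c * (b - a)"
        using additive_content_tagged_division[of p a b] p \<open>a \<le> b\<close>
        by (simp add: sum_distrib_left[symmetric] case_prod_unfold)
      finally have 1: "norm (\<Sum>z \<in> p1. ?T z) < e / 2"
        using c(2) by simp
      \<comment> \<open>degenerate intervals contribute nothing, and absolute continuity is about proper intervals only\<close>
      define D where "D = (\<lambda>(x, K). (Inf K, Sup K)) ` {(x, K) \<in> p2. measure lborel K \<noteq> 0}"
      let ?p2 = "{(x, K) \<in> p2. measure lborel K \<noteq> 0}"
      have pD: "(x, K) \<in> ?p2 \<Longrightarrow> \<exists>u v. K = {u..v} \<and> u < v \<and> a \<le> u \<and> v \<le> b \<and> Inf K = u \<and> Sup K = v \<and> measure lborel K = v - u \<and> {u..v} \<subseteq> U" for x K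
        using K[of x K] by (force simp: p2_def \<gamma>_def)
      have disj: "(x, K) \<in> ?p2 \<Longrightarrow> (y, L) \<in> ?p2 \<Longrightarrow> (x, K) \<noteq> (y, L) \<Longrightarrow> {Inf K<..<Sup K} \<inter> {Inf L<..<Sup L} = {}" for x y K L
      proof -
        assume *: "(x, K) \<in> ?p2" "(y, L) \<in> ?p2" "(x, K) \<noteq> (y, L)"
        have "interior K \<inter> interior L = {}"
          using tagged_division_ofD(5)[OF p, of x K y L] * by (auto simp: p2_def)
        moreover have "interior K = {Inf K<..<Sup K}" "interior L = {Inf L<..<Sup L}"
          using pD[OF *(1)] pD[OF *(2)] by (metis interior_atLeastAtMost_real)+
        ultimately show ?thesis
          by simp
      qed
      have inj: "inj_on (\<lambda>(x, K). (Inf K, Sup K)) ?p2"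
      proof (rule inj_onI, clarify)
        fix x K y L
        assume *: "(x, K) \<in> p2" "measure lborel K \<noteq> 0" "(y, L) \<in> p2" "measure lborel L \<noteq> 0" "Inf K = Inf L" "Sup K = Sup L"
        show "x = y \<and> K = L"
        proof (rule ccontr)
          assume "\<not> (x = y \<and> K = L)"
          then have "{Inf K<..<Sup K} \<inter> {Inf L<..<Sup L} = {}"
            using disj[of x K y L] * by auto
          moreover have "Inf K < Sup K"
            using pD[of x K] * by auto
          ultimately show False
            using * by simp
        qed
      qed
      have fin2: "finite ?p2"
        using p12(4) by (rule rev_finite_subset) auto
      have "norm (\<Sum>z \<in> p2. ?T z) \<le> (\<Sum>(x, K) \<in> p2. cmod (f (Sup K) - f (Inf K)))"
        by (rule sum_norm_le) (auto simp: p2_def g_def norm_minus_commute)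
      also have "\<dots> = (\<Sum>(x, K) \<in> ?p2. cmod (f (Sup K) - f (Inf K)))"
      proof (rule sum.mono_neutral_right)
        show "\<forall>z \<in> p2 - ?p2. (case z of (x, K) \<Rightarrow> cmod (f (Sup K) - f (Inf K))) = 0"
        proof
          fix z assume "z \<in> p2 - ?p2"
          then obtain x K where z: "z = (x, K)" "(x, K) \<in> p" "measure lborel K = 0"
            by (auto simp: p2_def)
          then have "Inf K = Sup K"
            using K[OF z(2)] by auto
          then show "(case z of (x, K) \<Rightarrow> cmod (f (Sup K) - f (Inf K))) = 0"
            using z by simp
        qed
      qed (use p12 in auto)
      also have "\<dots> = (\<Sum>(u, v) \<in> D. cmod (f v - f u))"
        unfolding D_def by (subst sum.reindex[OF inj]) (auto simp: case_prod_unfold intro!: sum.cong)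
      also have "\<dots> < e / 2"
      proof (rule small[rule_format])
        have D: "finite D" "\<forall>(u, v) \<in> D. a \<le> u \<and> u < v \<and> v \<le> b"
          unfolding D_def using fin2 pD by (simp, fastforce)
        have disjD: "disjoint_family_on (\<lambda>(u, v). {u<..<v}) D"
          unfolding D_def disjoint_family_on_def using disj by (fastforce simp: case_prod_unfold)
        show "nonoverlapping a b D"
          using D disjD by (simp add: nonoverlapping_def)
        have "(\<Sum>(u, v) \<in> D. v - u) = (\<Sum>z \<in> D. measure lebesgue (case z of (u, v) \<Rightarrow> {u<..<v}))"
          using D(2) by (intro sum.cong) (auto simp: less_imp_le)
        also have "\<dots> = measure lebesgue (\<Union>z \<in> D. case z of (u, v) \<Rightarrow> {u<..<v})"
          using disjD D(1)
          by (intro measure_negligible_finite_Union_image[symmetric])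
             (auto simp: pairwise_def disjoint_family_on_def case_prod_unfold)
        also have "\<dots> \<le> measure lebesgue U"
        proof (rule measure_mono_fmeasurable)
          show "(\<Union>z \<in> D. case z of (u, v) \<Rightarrow> {u<..<v}) \<subseteq> U"
            unfolding D_def using pD by (fastforce simp: subset_iff)
          show "(\<Union>z \<in> D. case z of (u, v) \<Rightarrow> {u<..<v}) \<in> sets lebesgue"
            using D(1) by (intro sets.finite_UN) (auto simp: case_prod_unfold)
        qed (rule U_meas)
        also have "\<dots> < d"
          by (rule U_meas)
        finally show "(\<Sum>(u, v) \<in> D. v - u) < d" .
      qed
      finally show ?thesis
        using 1 split by linarith
    qed
    show "\<exists>\<gamma>. gauge \<gamma> \<and> (\<forall>p. p tagged_division_of {a..b} \<and> \<gamma> fine p \<longrightarrow>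
        norm ((\<Sum>(x, K) \<in> p. measure lborel K *\<^sub>R g x) - (f b - f a)) < e)"
      using gauge close by (intro exI[of _ \<gamma>] conjI allI impI) simp_all
  qed
  then show ?thesis
    by (rule has_integral_spike[OF N, rotated]) (auto simp: g_def)
qed

text \<open>
  Lebesgue's differentiation theorem on the line. At a point where the difference quotients of
  the indefinite integral do not converge to \<open>f\<close> there are arbitrarily short intervals on which the Riemann term
  of \<open>f\<close> misses the integral by a fixed fraction of the length. By Vitali's theorem disjoint
  intervals of this kind cover almost all such points, and by Henstock's lemma their total
  length is arbitrarily small.
\<close>

lemma indefinite_integral_has_vector_derivative:
  fixes f :: "real \<Rightarrow> 'a :: euclidean_space"
  assumes f: "f integrable_on {a..b}"
  obtains N where "negligible N"
    "\<And>x. x \<in> {a..b} - N \<Longrightarrow> ((\<lambda>t. integral {a..t} f) has_vector_derivative f x) (at x within {a..b})"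
proof -
  define F where "F t = integral {a..t} f" for t
  define bad where "bad e x y \<longleftrightarrow> x \<in> {a..b} \<and> y \<in> {a..b} \<and> norm (F y - F x - (y - x) *\<^sub>R f x) > e * \<bar>y - x\<bar>" for e x y
  define B where "B e = {x. \<forall>d>0. \<exists>y. \<bar>y - x\<bar> < d \<and> bad e x y}" for e
  have negB: "negligible (B e)" if e: "e > 0" for e
    unfolding negligible_outer_le
  proof (intro allI impI)
    fix \<eta> :: real assume \<eta>: "\<eta> > 0"
    have f': "f integrable_on cbox a b"
      using f by simp
    obtain \<gamma> where \<gamma>: "gauge \<gamma>"
      and Henstock: "\<And>p. p tagged_partial_division_of {a..b} \<Longrightarrow> \<gamma> fine p \<Longrightarrow>
        (\<Sum>(x, K) \<in> p. norm (measure lborel K *\<^sub>R f x - integral K f)) < e * \<eta>"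
      using Henstock_lemma[OF f' mult_pos_pos[OF e \<eta>], unfolded box_real] by blast
    \<comment> \<open>a pair stands for the closed interval between \<open>x\<close> and \<open>y\<close>, written as a ball for the covering theorem\<close>
    define I where "I = {(x, y). x \<in> B e \<and> bad e x y \<and> cball ((x + y) / 2) (\<bar>y - x\<bar> / 2) \<subseteq> \<gamma> x}"
    define m :: "real \<times> real \<Rightarrow> real" where "m z = (fst z + snd z) / 2" for z
    define r :: "real \<times> real \<Rightarrow> real" where "r z = \<bar>snd z - fst z\<bar> / 2" for z
    define J where "J z = cball (m z) (r z)" for z
    have J_eq: "J (x, y) = {min x y..max x y}" for x y
      unfolding J_def m_def r_def cball_eq_atLeastAtMost by (auto simp: min_def max_def field_simps)
    have Iprop: "x \<in> {a..b}" "y \<in> {a..b}" "x \<noteq> y" "J (x, y) \<subseteq> \<gamma> x"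
        "norm (measure lborel (J (x, y)) *\<^sub>R f x - integral (J (x, y)) f) > e * measure lborel (J (x, y))"
      if "(x, y) \<in> I" for x y
    proof -
      have bad: "bad e x y" and sub: "J (x, y) \<subseteq> \<gamma> x"
        using that by (auto simp: I_def J_def m_def r_def)
      show xy: "x \<in> {a..b}" "y \<in> {a..b}" "x \<noteq> y"
        using bad by (auto simp: bad_def)
      show "J (x, y) \<subseteq> \<gamma> x"
        by (rule sub)
      have diff: "integral {u..v} f = F v - F u" if uv: "a \<le> u" "u \<le> v" "v \<le> b" for u v
      proof -
        have "f integrable_on {a..v}"
          using uv by (intro integrable_subinterval_real[OF f]) auto
        then show ?thesis
          using Henstock_Kurzweil_Integration.integral_combine[of a u v f] uv by (simp add: F_def algebra_simps)
      qed
      show "norm (measure lborel (J (x, y)) *\<^sub>R f x - integral (J (x, y)) f) > e * measure lborel (J (x, y))"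
      proof (cases "x \<le> y")
        case True
        then have "norm (measure lborel (J (x, y)) *\<^sub>R f x - integral (J (x, y)) f) = norm (F y - F x - (y - x) *\<^sub>R f x)"
          using xy by (simp add: J_eq diff norm_minus_commute)
        then show ?thesis
          using bad True by (simp add: bad_def J_eq)
      next
        case False
        then have "measure lborel (J (x, y)) *\<^sub>R f x - integral (J (x, y)) f = F y - F x - (y - x) *\<^sub>R f x"
          using xy by (simp add: J_eq diff algebra_simps)
        then show ?thesis
          using bad False by (simp add: bad_def J_eq)
      qed
    qed
    have "\<exists>C. countable C \<and> C \<subseteq> I \<and> pairwise (\<lambda>i j. disjnt (J i) (J j)) C \<and> negligible (B e - (\<Union>i\<in>C. J i))"
    proof -
      have 1: "0 < r z" if "z \<in> I" for z
        using Iprop(3)[of "fst z" "snd z"] that by (simp add: r_def)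
      have 2: "\<exists>i. i \<in> I \<and> x \<in> cball (m i) (r i) \<and> r i < d" if x: "x \<in> B e" and "0 < d" for x d
      proof -
        obtain s where s: "s > 0" "ball x s \<subseteq> \<gamma> x"
          using \<gamma> unfolding gauge_def by (meson open_contains_ball)
        obtain y where y: "\<bar>y - x\<bar> < min s d" "bad e x y"
        proof -
          have "0 < min s d"
            using s(1) \<open>0 < d\<close> by simp
          moreover have "\<forall>d>0. \<exists>y. \<bar>y - x\<bar> < d \<and> bad e x y"
            using x by (simp add: B_def)
          ultimately show thesis
            using that by blast
        qed
        have "J (x, y) \<subseteq> ball x s"
          unfolding J_eq using y(1) by (auto simp: dist_real_def min_def max_def split: if_splits)
        then have "(x, y) \<in> I"
          using s(2) x y(2) by (auto simp: I_def J_def m_def r_def)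
        moreover have "x \<in> cball (m (x, y)) (r (x, y))"
          using J_eq[of x y] by (simp add: J_def)
        ultimately show ?thesis
          using y(1) by (intro exI[of _ "(x, y)"]) (auto simp: r_def)
      qed
      show ?thesis
        unfolding J_def by (rule Vitali_covering_theorem_cballs[of I r "B e" m, OF 1 2]) blast+
    qed
    then obtain C where C: "countable C" "C \<subseteq> I" "pairwise (\<lambda>i j. disjnt (J i) (J j)) C"
        "negligible (B e - (\<Union>i\<in>C. J i))"
      by blast
    have J_meas: "J i \<in> lmeasurable" for i
      unfolding J_def by simp
    have fin: "measure lebesgue (\<Union>i\<in>C'. J i) \<le> \<eta>" if C': "C' \<subseteq> C" "finite C'" for C'
    proof -
      let ?t = "\<lambda>z. (fst z, J z)"
      have inj: "inj_on ?t C'"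
      proof (rule inj_onI)
        fix z w assume zw: "z \<in> C'" "w \<in> C'" "?t z = ?t w"
        have "fst z \<in> J z"
          using J_eq[of "fst z" "snd z"] by simp
        then have "\<not> disjnt (J z) (J w)"
          using zw by (auto simp: disjnt_def)
        then show "z = w"
          using C(3) C'(1) zw unfolding pairwise_def by blast
      qed
      have tpd: "?t ` C' tagged_partial_division_of {a..b}"
        unfolding tagged_partial_division_of_def
      proof (intro conjI allI impI)
        show "finite (?t ` C')"
          using C' by simp
        fix x K assume "(x, K) \<in> ?t ` C'"
        then obtain y where xy: "(x, y) \<in> C'" "K = J (x, y)"
          by auto
        then have "(x, y) \<in> I"
          using C' C by blast
        then show "x \<in> K" "K \<subseteq> {a..b}" "\<exists>u v. K = cbox u v"
          using Iprop(1,2)[of x y] xy by (auto simp: J_eq)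
      next
        fix x1 K1 x2 K2
        assume *: "(x1, K1) \<in> ?t ` C' \<and> (x2, K2) \<in> ?t ` C' \<and> (x1, K1) \<noteq> (x2, K2)"
        then obtain z1 z2 where z: "z1 \<in> C'" "(x1, K1) = ?t z1" "z2 \<in> C'" "(x2, K2) = ?t z2"
          by blast
        define y1 y2 where "y1 = snd z1" and "y2 = snd z2"
        have xy: "(x1, y1) \<in> C'" "K1 = J (x1, y1)" "(x2, y2) \<in> C'" "K2 = J (x2, y2)"
          using z by (simp_all add: y1_def y2_def)
        have "(x1, y1) \<noteq> (x2, y2)"
          using * xy by auto
        then have "disjnt K1 K2"
          using C(3) C'(1) xy unfolding pairwise_def by blast
        then show "interior K1 \<inter> interior K2 = {}"
          using interior_subset[of K1] interior_subset[of K2] by (auto simp: disjnt_def)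
      qed
      have "\<gamma> fine (?t ` C')"
        unfolding fine_def using Iprop(4) C' C by fastforce
      from Henstock[OF tpd this]
      have *: "(\<Sum>z \<in> C'. norm (measure lborel (J z) *\<^sub>R f (fst z) - integral (J z) f)) < e * \<eta>"
        by (simp add: sum.reindex[OF inj])
      have "e * measure lebesgue (\<Union>i\<in>C'. J i) = e * (\<Sum>z \<in> C'. measure lebesgue (J z))"
        using C(3) C' J_meas
        by (subst measure_negligible_finite_Union_image) (auto simp: pairwise_def disjnt_def subset_iff)
      also have "\<dots> = (\<Sum>z \<in> C'. e * measure lborel (J z))"
        by (simp add: sum_distrib_left J_def)
      also have "\<dots> \<le> (\<Sum>z \<in> C'. norm (measure lborel (J z) *\<^sub>R f (fst z) - integral (J z) f))"
        using Iprop(5) C' C by (intro sum_mono less_imp_le) (metis prod.collapse subsetD)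
      finally have "e * measure lebesgue (\<Union>i\<in>C'. J i) < e * \<eta>"
        using * by simp
      then show ?thesis
        using e by simp
    qed
    show "\<exists>T. B e \<subseteq> T \<and> T \<in> lmeasurable \<and> measure lebesgue T \<le> \<eta>"
    proof (intro exI conjI)
      let ?V = "\<Union>i\<in>C. J i"
      have V: "?V \<in> lmeasurable" "measure lebesgue ?V \<le> \<eta>"
        using fmeasurable_UN_bound[OF C(1) J_meas fin] measure_UN_bound[OF C(1) J_meas fin] by auto
      show "B e \<subseteq> ?V \<union> (B e - ?V)"
        by blast
      show "?V \<union> (B e - ?V) \<in> lmeasurable"
        using V(1) negligible_imp_measurable[OF C(4)] by (rule fmeasurable.Un)
      have "measure lebesgue (?V \<union> (B e - ?V)) \<le> measure lebesgue ?V + measure lebesgue (B e - ?V)"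
        using V(1) negligible_imp_measurable[OF C(4)] by (intro measure_Un_le) auto
      then show "measure lebesgue (?V \<union> (B e - ?V)) \<le> \<eta>"
        using V(2) negligible_imp_measure0[OF C(4)] by simp
    qed
  qed
  define N where "N = (\<Union>n :: nat. B (inverse (real (Suc n))))"
  show thesis
  proof (rule that)
    show "negligible N"
      unfolding N_def by (intro negligible_countable_Union) (auto intro: negB)
    fix x assume x: "x \<in> {a..b} - N"
    show "((\<lambda>t. integral {a..t} f) has_vector_derivative f x) (at x within {a..b})"
      unfolding has_vector_derivative_def has_derivative_within_alt F_def[symmetric]
    proof (intro conjI allI impI)
      show "bounded_linear (\<lambda>h. h *\<^sub>R f x)"
        by (rule bounded_linear_scaleR_left)
      fix e :: real assume "e > 0"
      then obtain n where n: "inverse (real (Suc n)) < e"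
        using reals_Archimedean by blast
      have "x \<notin> B (inverse (real (Suc n)))"
        using x by (auto simp: N_def)
      then obtain d where d: "d > 0" "\<And>y. \<bar>y - x\<bar> < d \<Longrightarrow> \<not> bad (inverse (real (Suc n))) x y"
        by (auto simp: B_def)
      show "\<exists>d>0. \<forall>y\<in>{a..b}. norm (y - x) < d \<longrightarrow> norm (F y - F x - (y - x) *\<^sub>R f x) \<le> e * norm (y - x)"
      proof (intro exI conjI ballI impI)
        fix y assume y: "y \<in> {a..b}" "norm (y - x) < d"
        then have "norm (F y - F x - (y - x) *\<^sub>R f x) \<le> inverse (real (Suc n)) * \<bar>y - x\<bar>"
          using d(2)[of y] x by (auto simp: bad_def)
        also have "\<dots> \<le> e * \<bar>y - x\<bar>"
          using n by (intro mult_right_mono) auto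
        finally show "norm (F y - F x - (y - x) *\<^sub>R f x) \<le> e * norm (y - x)"
          by simp
      qed (rule d(1))
    qed
  qed
qed

abbreviation lborel_Icc :: "real \<Rightarrow> real \<Rightarrow> real measure" where
  "lborel_Icc a b \<equiv> restrict_space lborel {a..b}"

lemma AE_interval_negligible:
  assumes "AE x in lborel_Icc a b. P x"
  obtains N where "negligible N" "\<And>x. x \<in> {a..b} - N \<Longrightarrow> P x"
proof -
  have "AE x in lborel. x \<in> {a..b} \<longrightarrow> P x"
    using assms by (simp add: AE_restrict_space_iff)
  then obtain N where N: "N \<in> null_sets lborel" "{x. \<not> (x \<in> {a..b} \<longrightarrow> P x)} \<subseteq> N"
    by (auto simp: eventually_ae_filter)
  have "negligible N"
    using N(1) by (simp add: negligible_iff_null_sets null_sets_completionI)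
  then show thesis
    by (rule that) (use N(2) in auto)
qed

lemma negligible_AE_interval:
  assumes "negligible N" "\<And>x. x \<in> {a..b::real} - N \<Longrightarrow> P x"
  shows "AE x in lborel_Icc a b. P x"
proof -
  have "AE x in lebesgue. x \<notin> N"
    using assms(1) by (simp add: negligible_iff_null_sets AE_not_in)
  then have "AE x in lborel. x \<notin> N"
    by (simp add: AE_completion_iff)
  then have "AE x in lborel. x \<in> {a..b} \<longrightarrow> P x"
    by eventually_elim (use assms(2) in auto)
  then show ?thesis
    by (simp add: AE_restrict_space_iff)
qed

lemma integral_interval_eq:
  fixes h :: "real \<Rightarrow> complex"
  assumes "integrable (lborel_Icc a b) h"
  shows "h integrable_on {a..b}" "(\<integral>x. h x \<partial>lborel_Icc a b) = integral {a..b} h"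
proof -
  have *: "set_integrable lborel {a..b} h"
    using assms by (simp add: set_integrable_def integrable_restrict_space)
  show "h integrable_on {a..b}"
    by (rule set_borel_integral_eq_integral(1)[OF *])
  show "(\<integral>x. h x \<partial>lborel_Icc a b) = integral {a..b} h"
    using set_borel_integral_eq_integral(2)[OF *] by (simp add: integral_restrict_space set_lebesgue_integral_def)
qed

lemma absolutely_continuous_funI_Lipschitz:
  assumes L: "\<And>u v. a \<le> u \<Longrightarrow> u < v \<Longrightarrow> v \<le> b \<Longrightarrow> cmod (f v - f u) \<le> L * (v - u)"
  shows "absolutely_continuous_fun a b f"
  unfolding absolutely_continuous_fun_iff
proof (intro allI impI)
  fix e :: real assume e: "e > 0"
  define d where "d = e / (\<bar>L\<bar> + 1)"
  have d: "d > 0" "(\<bar>L\<bar> + 1) * d = e"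
    using e by (auto simp: d_def)
  show "\<exists>d>0. \<forall>D. nonoverlapping a b D \<longrightarrow> (\<Sum>(u, v) \<in> D. v - u) < d \<longrightarrow> (\<Sum>(u, v) \<in> D. cmod (f v - f u)) < e"
  proof (intro exI conjI allI impI)
    fix D assume D: "nonoverlapping a b D" "(\<Sum>(u, v) \<in> D. v - u) < d"
    have "(\<Sum>(u, v) \<in> D. cmod (f v - f u)) \<le> (\<Sum>(u, v) \<in> D. (\<bar>L\<bar> + 1) * (v - u))"
    proof (rule sum_mono)
      fix z assume "z \<in> D"
      then obtain u v where z: "z = (u, v)" "a \<le> u" "u < v" "v \<le> b"
        using D(1) by (cases z) (auto simp: nonoverlapping_def)
      have "L * (v - u) \<le> (\<bar>L\<bar> + 1) * (v - u)"
        using z by (intro mult_right_mono) auto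
      then show "(case z of (u, v) \<Rightarrow> cmod (f v - f u)) \<le> (case z of (u, v) \<Rightarrow> (\<bar>L\<bar> + 1) * (v - u))"
        using order_trans[OF L[of u v]] z by simp
    qed
    also have "\<dots> = (\<bar>L\<bar> + 1) * (\<Sum>(u, v) \<in> D. v - u)"
      by (simp add: sum_distrib_left case_prod_unfold)
    also have "\<dots> < (\<bar>L\<bar> + 1) * d"
      using D(2) by (intro mult_strict_left_mono) auto
    finally show "(\<Sum>(u, v) \<in> D. cmod (f v - f u)) < e"
      using d by simp
  qed (rule d)
qed

lemma absolutely_continuous_fun_continuous_on:
  assumes ac: "absolutely_continuous_fun a b f"
  shows "continuous_on {a..b} f"
  unfolding continuous_on_iff
proof (intro ballI allI impI)
  fix x e :: real assume x: "x \<in> {a..b}" and "e > 0"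
  then obtain d where d: "d > 0" and small: "\<forall>D. nonoverlapping a b D \<longrightarrow> (\<Sum>(u, v) \<in> D. v - u) < d \<longrightarrow> (\<Sum>(u, v) \<in> D. cmod (f v - f u)) < e"
    using ac unfolding absolutely_continuous_fun_iff by blast
  have *: "cmod (f v - f u) < e" if "a \<le> u" "u < v" "v \<le> b" "v - u < d" for u v
    using small[rule_format, of "{(u, v)}"] that by (auto simp: nonoverlapping_def disjoint_family_on_def)
  show "\<exists>d>0. \<forall>y\<in>{a..b}. dist y x < d \<longrightarrow> dist (f y) (f x) < e"
  proof (intro exI[of _ d] conjI ballI impI d)
    fix y assume y: "y \<in> {a..b}" "dist y x < d"
    consider "y < x" | "y = x" | "x < y" by linarith
    then show "dist (f y) (f x) < e"
      using *[of x y] *[of y x] x y \<open>e > 0\<close> by cases (auto simp: dist_norm norm_minus_commute)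
  qed
qed

lemma absolutely_continuous_fun_bounded:
  assumes "absolutely_continuous_fun a b f"
  obtains B where "0 \<le> B" "\<And>x. x \<in> {a..b} \<Longrightarrow> cmod (f x) \<le> B"
proof -
  have "bounded (f ` {a..b})"
    by (intro compact_imp_bounded compact_continuous_image absolutely_continuous_fun_continuous_on assms) simp
  then obtain B where "\<forall>x\<in>{a..b}. cmod (f x) \<le> B"
    by (auto simp: bounded_iff)
  then show thesis
    by (intro that[of "max 0 B"]) (auto simp: le_max_iff_disj)
qed

text \<open>
  Increments controlled by those of two absolutely continuous functions: the common reason why sums, products and
  complex conjugates of absolutely continuous functions are absolutely continuous.
\<close>

lemma absolutely_continuous_fun_dominated:
  assumes f: "absolutely_continuous_fun a b f" and g: "absolutely_continuous_fun a b g" and B: "0 \<le> B"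
    and le: "\<And>u v. a \<le> u \<Longrightarrow> u < v \<Longrightarrow> v \<le> b \<Longrightarrow> cmod (h v - h u) \<le> B * (cmod (f v - f u) + cmod (g v - g u))"
  shows "absolutely_continuous_fun a b h"
  unfolding absolutely_continuous_fun_iff
proof (intro allI impI)
  fix e :: real assume e: "e > 0"
  define c where "c = e / (2 * (B + 1))"
  have "c > 0"
    using e B by (simp add: c_def)
  moreover have "2 * (B + 1) * c = e"
    using B by (simp add: c_def)
  ultimately have c: "c > 0" "(B + 1) * (c + c) = e"
    by (simp_all add: algebra_simps)
  obtain d1 where d1: "d1 > 0" "\<forall>D. nonoverlapping a b D \<longrightarrow> (\<Sum>(u, v) \<in> D. v - u) < d1 \<longrightarrow> (\<Sum>(u, v) \<in> D. cmod (f v - f u)) < c"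
    using f c(1) unfolding absolutely_continuous_fun_iff by blast
  obtain d2 where d2: "d2 > 0" "\<forall>D. nonoverlapping a b D \<longrightarrow> (\<Sum>(u, v) \<in> D. v - u) < d2 \<longrightarrow> (\<Sum>(u, v) \<in> D. cmod (g v - g u)) < c"
    using g c(1) unfolding absolutely_continuous_fun_iff by blast
  show "\<exists>d>0. \<forall>D. nonoverlapping a b D \<longrightarrow> (\<Sum>(u, v) \<in> D. v - u) < d \<longrightarrow> (\<Sum>(u, v) \<in> D. cmod (h v - h u)) < e"
  proof (intro exI[of _ "min d1 d2"] conjI allI impI)
    fix D assume D: "nonoverlapping a b D"
      "(\<Sum>(u, v) \<in> D. v - u) < min d1 d2"
    have s: "(\<Sum>(u, v) \<in> D. cmod (f v - f u)) < c" "(\<Sum>(u, v) \<in> D. cmod (g v - g u)) < c"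
      using d1(2) d2(2) D by simp_all
    have "(\<Sum>(u, v) \<in> D. cmod (h v - h u)) \<le> (\<Sum>(u, v) \<in> D. (B + 1) * (cmod (f v - f u) + cmod (g v - g u)))"
    proof (rule sum_mono)
      fix z assume "z \<in> D"
      then obtain u v where z: "z = (u, v)" "a \<le> u" "u < v" "v \<le> b"
        using D(1) by (cases z) (auto simp: nonoverlapping_def)
      have "cmod (h v - h u) \<le> B * (cmod (f v - f u) + cmod (g v - g u))"
        by (rule le) (use z in auto)
      also have "\<dots> \<le> (B + 1) * (cmod (f v - f u) + cmod (g v - g u))"
        by (intro mult_right_mono) auto
      finally show "(case z of (u, v) \<Rightarrow> cmod (h v - h u)) \<le> (case z of (u, v) \<Rightarrow> (B + 1) * (cmod (f v - f u) + cmod (g v - g u)))"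
        using z by simp
    qed
    also have "\<dots> = (B + 1) * ((\<Sum>(u, v) \<in> D. cmod (f v - f u)) + (\<Sum>(u, v) \<in> D. cmod (g v - g u)))"
      by (simp add: sum_distrib_left sum.distrib case_prod_unfold distrib_left)
    also have "\<dots> < (B + 1) * (c + c)"
      using s B by (intro mult_strict_left_mono add_strict_mono) auto
    finally show "(\<Sum>(u, v) \<in> D. cmod (h v - h u)) < e"
      using c by simp
  qed (use d1 d2 in simp)
qed

lemma absolutely_continuous_fun_add:
  assumes "absolutely_continuous_fun a b f" "absolutely_continuous_fun a b g"
  shows "absolutely_continuous_fun a b (\<lambda>x. f x + g x)"
proof (rule absolutely_continuous_fun_dominated[OF assms, of 1])
  show "cmod (f v + g v - (f u + g u)) \<le> 1 * (cmod (f v - f u) + cmod (g v - g u))" for u v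
    using norm_triangle_ineq[of "f v - f u" "g v - g u"] by (simp add: algebra_simps)
qed simp

lemma absolutely_continuous_fun_mult:
  assumes f: "absolutely_continuous_fun a b f" and g: "absolutely_continuous_fun a b g"
  shows "absolutely_continuous_fun a b (\<lambda>x. f x * g x)"
proof -
  obtain B where B: "0 \<le> B" "\<And>x. x \<in> {a..b} \<Longrightarrow> cmod (f x) \<le> B"
    using absolutely_continuous_fun_bounded[OF f] by blast
  obtain C where C: "0 \<le> C" "\<And>x. x \<in> {a..b} \<Longrightarrow> cmod (g x) \<le> C"
    using absolutely_continuous_fun_bounded[OF g] by blast
  show ?thesis
  proof (rule absolutely_continuous_fun_dominated[OF f g, of "max B C"])
    fix u v assume uv: "a \<le> u" "u < v" "v \<le> b"
    have "f v * g v - f u * g u = (f v - f u) * g v + f u * (g v - g u)"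
      by (simp add: algebra_simps)
    also have "cmod \<dots> \<le> cmod (f v - f u) * cmod (g v) + cmod (f u) * cmod (g v - g u)"
      by (rule order_trans[OF norm_triangle_ineq]) (simp add: norm_mult)
    also have "\<dots> \<le> cmod (f v - f u) * max B C + max B C * cmod (g v - g u)"
      using uv B(2)[of u] C(2)[of v] by (intro add_mono mult_left_mono mult_right_mono) auto
    finally show "cmod (f v * g v - f u * g u) \<le> max B C * (cmod (f v - f u) + cmod (g v - g u))"
      by (simp add: algebra_simps)
  qed (use B in auto)
qed

lemma absolutely_continuous_fun_cnj:
  assumes f: "absolutely_continuous_fun a b f"
  shows "absolutely_continuous_fun a b (\<lambda>x. cnj (f x))"
proof (rule absolutely_continuous_fun_dominated[OF f f, of 1])
  show "cmod (cnj (f v) - cnj (f u)) \<le> 1 * (cmod (f v - f u) + cmod (f v - f u))" for u v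
    unfolding complex_cnj_diff[symmetric] complex_mod_cnj by simp
qed simp

lemma one_square_integrable: "(\<lambda>x. 1) \<in> square_integrable (lborel_Icc a b)"
  by (intro square_integrableI) (auto simp: integrable_restrict_space emeasure_lborel_Icc_eq)

lemma square_integrable_interval_integrable:
  assumes "h \<in> square_integrable (lborel_Icc a b)"
  shows "integrable (lborel_Icc a b) h"
  using integrable_cnj_mult[OF one_square_integrable assms] by simp

text \<open>
  Over intervals of total length \<open>s\<close> the integral of \<open>|h| \<le> \<eta> |h|\<^sup>2 / 2 + 1 / (2 \<eta>)\<close> is at most
  \<open>\<eta> \<parallel>h\<parallel>\<^sup>2 / 2 + s / (2 \<eta>)\<close>, which is small if first \<open>\<eta>\<close> and then \<open>s\<close> are chosen small.
\<close>

lemma absolutely_continuous_fun_indefinite_integral: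
  assumes h: "h \<in> square_integrable (lborel_Icc a b)"
  shows "absolutely_continuous_fun a b (\<lambda>t. integral {a..t} h)"
  unfolding absolutely_continuous_fun_iff
proof (intro allI impI)
  fix e :: real assume e: "e > 0"
  have h1: "set_integrable lborel {a..b} h"
    using square_integrable_interval_integrable[OF h] by (simp add: set_integrable_def integrable_restrict_space)
  have h2: "set_integrable lborel {a..b} (\<lambda>x. (cmod (h x))\<^sup>2)"
    using square_integrable_integrable[OF h] by (simp add: set_integrable_def integrable_restrict_space)
  note hI = set_borel_integral_eq_integral(1)[OF h1]
  define A where "A = (\<integral>x. indicator {a..b} x * (cmod (h x))\<^sup>2 \<partial>lborel)"
  have "A \<ge> 0"
    unfolding A_def by (rule Bochner_Integration.integral_nonneg) simp
  define \<eta> where "\<eta> = e / (A + 1)"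
  have \<eta>: "\<eta> > 0" "\<eta> * A \<le> e"
    using e \<open>A \<ge> 0\<close> by (auto simp: \<eta>_def field_simps)
  have increment: "cmod (integral {a..v} h - integral {a..u} h)
      \<le> \<eta> / 2 * (\<integral>x. indicator {u<..<v} x * (cmod (h x))\<^sup>2 \<partial>lborel) + (v - u) / (2 * \<eta>)"
    if uv: "a \<le> u" "u < v" "v \<le> b" for u v
  proof -
    have sub: "{u<..<v} \<subseteq> {a..b}"
      using uv by auto
    have s1: "set_integrable lborel {u<..<v} h" and s2: "set_integrable lborel {u<..<v} (\<lambda>x. (cmod (h x))\<^sup>2)"
      using set_integrable_subset[OF h1 _ sub] set_integrable_subset[OF h2 _ sub] by simp_all
    have "integral {a..v} h - integral {a..u} h = integral {u..v} h"
      using Henstock_Kurzweil_Integration.integral_combine[of a u v h] integrable_subinterval_real[OF hI, of a v] uv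
      by (simp add: algebra_simps)
    also have "\<dots> = integral {u<..<v} h"
      using integral_open_interval[of u v h] by simp
    also have "\<dots> = (\<integral>x. indicator {u<..<v} x *\<^sub>R h x \<partial>lborel)"
      using set_borel_integral_eq_integral(2)[OF s1] by (simp add: set_lebesgue_integral_def)
    also have "cmod \<dots> \<le> (\<integral>x. cmod (indicator {u<..<v} x *\<^sub>R h x) \<partial>lborel)"
      by (rule integral_norm_bound)
    also have "\<dots> \<le> (\<integral>x. \<eta> / 2 * (indicator {u<..<v} x * (cmod (h x))\<^sup>2) + indicator {u<..<v} x / (2 * \<eta>) \<partial>lborel)"
    proof (rule Bochner_Integration.integral_mono)
      show "integrable lborel (\<lambda>x. cmod (indicator {u<..<v} x *\<^sub>R h x))"
        using s1 unfolding set_integrable_def by (rule integrable_norm)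
      show "integrable lborel (\<lambda>x. \<eta> / 2 * (indicator {u<..<v} x * (cmod (h x))\<^sup>2) + indicator {u<..<v} x / (2 * \<eta>))"
        using s2 uv unfolding set_integrable_def
        by (intro Bochner_Integration.integrable_add integrable_mult_right integrable_divide integrable_real_indicator) auto
      have "c \<le> \<eta> / 2 * c\<^sup>2 + 1 / (2 * \<eta>)" for c
      proof -
        have "0 \<le> (\<eta> * c - 1)\<^sup>2 / (2 * \<eta>)"
          using \<eta> by simp
        also have "\<dots> = \<eta> / 2 * c\<^sup>2 + 1 / (2 * \<eta>) - c"
          using \<eta> by (simp add: power2_eq_square field_simps)
        finally show ?thesis by simp
      qed
      then show "cmod (indicator {u<..<v} x *\<^sub>R h x) \<le> \<eta> / 2 * (indicator {u<..<v} x * (cmod (h x))\<^sup>2) + indicator {u<..<v} x / (2 * \<eta>)" for x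
        by (auto simp: indicator_def)
    qed
    also have "\<dots> = \<eta> / 2 * (\<integral>x. indicator {u<..<v} x * (cmod (h x))\<^sup>2 \<partial>lborel) + (v - u) / (2 * \<eta>)"
      using s2 uv unfolding set_integrable_def
      by (subst Bochner_Integration.integral_add) (auto simp: measure_def)
    finally show ?thesis .
  qed
  show "\<exists>d>0. \<forall>D. nonoverlapping a b D \<longrightarrow> (\<Sum>(u, v) \<in> D. v - u) < d \<longrightarrow>
      (\<Sum>(u, v) \<in> D. cmod (integral {a..v} h - integral {a..u} h)) < e"
  proof (intro exI[of _ "e * \<eta>"] conjI allI impI)
    fix D assume nD: "nonoverlapping a b D" and D_len: "(\<Sum>(u, v) \<in> D. v - u) < e * \<eta>"
    note D = nD[unfolded nonoverlapping_def]
    let ?I = "\<lambda>(u, v) x. indicator {u<..<v} x * (cmod (h x))\<^sup>2 :: real"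
    have I_int: "integrable lborel (?I z)" if z: "z \<in> D" for z
    proof -
      obtain u v where uv: "z = (u, v)" "{u<..<v} \<subseteq> {a..b}"
        using D z by (cases z) fastforce
      show ?thesis
        using set_integrable_subset[OF h2 _ uv(2)] by (simp add: uv(1) set_integrable_def)
    qed
    have "(\<Sum>(u, v) \<in> D. cmod (integral {a..v} h - integral {a..u} h))
        \<le> (\<Sum>(u, v) \<in> D. \<eta> / 2 * (\<integral>x. ?I (u, v) x \<partial>lborel) + (v - u) / (2 * \<eta>))"
      using D increment by (intro sum_mono) fastforce
    also have "\<dots> = \<eta> / 2 * (\<Sum>z \<in> D. \<integral>x. ?I z x \<partial>lborel) + (\<Sum>(u, v) \<in> D. v - u) / (2 * \<eta>)"
      by (simp add: case_prod_unfold sum.distrib sum_distrib_left sum_divide_distrib)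
    also have "(\<Sum>z \<in> D. \<integral>x. ?I z x \<partial>lborel) = (\<integral>x. (\<Sum>z \<in> D. ?I z x) \<partial>lborel)"
      by (rule Bochner_Integration.integral_sum[symmetric]) (rule I_int)
    also have "\<dots> \<le> A"
      unfolding A_def
    proof (rule Bochner_Integration.integral_mono)
      show "integrable lborel (\<lambda>x. \<Sum>z \<in> D. ?I z x)"
        by (intro Bochner_Integration.integrable_sum I_int)
      show "integrable lborel (\<lambda>x. indicator {a..b} x * (cmod (h x))\<^sup>2)"
        using h2 by (simp add: set_integrable_def)
      fix x :: real
      have "(\<Sum>z \<in> D. ?I z x) = (\<Sum>z \<in> D. indicator (case z of (u, v) \<Rightarrow> {u<..<v}) x) * (cmod (h x))\<^sup>2"
        by (simp add: sum_distrib_right case_prod_unfold)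
      also have "(\<Sum>z \<in> D. indicator (case z of (u, v) \<Rightarrow> {u<..<v}) x) = (indicator (\<Union>z \<in> D. case z of (u, v) \<Rightarrow> {u<..<v}) x :: real)"
        by (rule indicator_UN_disjoint[symmetric]) (use D in auto)
      also have "\<dots> \<le> indicator {a..b} x"
        using D by (intro indicator_leI) fastforce
      finally show "(\<Sum>z \<in> D. ?I z x) \<le> indicator {a..b} x * (cmod (h x))\<^sup>2"
        by (simp add: mult_right_mono)
    qed
    finally have "(\<Sum>(u, v) \<in> D. cmod (integral {a..v} h - integral {a..u} h))
        \<le> \<eta> / 2 * A + (\<Sum>(u, v) \<in> D. v - u) / (2 * \<eta>)"
      using \<eta>(1) by simp
    also have "\<dots> < e / 2 + e / 2"
      using \<eta> D_len by (intro add_le_less_mono) (auto simp: field_simps)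
    finally show "(\<Sum>(u, v) \<in> D. cmod (integral {a..v} h - integral {a..u} h)) < e"
      by simp
  qed (use e \<eta> in simp)
qed

lemma indefinite_integral_has_vector_derivative_AE:
  assumes "h \<in> square_integrable (lborel_Icc a b)"
  shows "AE x in lborel_Icc a b. ((\<lambda>t. integral {a..t} h) has_vector_derivative h x) (at x within {a..b})"
proof -
  have "h integrable_on {a..b}"
    by (intro integral_interval_eq square_integrable_interval_integrable assms)
  then obtain N where "negligible N"
    "\<And>x. x \<in> {a..b} - N \<Longrightarrow> ((\<lambda>t. integral {a..t} h) has_vector_derivative h x) (at x within {a..b})"
    using indefinite_integral_has_vector_derivative by blast
  then show ?thesis
    by (rule negligible_AE_interval)
qed

lemma continuous_on_interval_measurable:
  fixes f :: "real \<Rightarrow> complex"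
  shows "continuous_on {a..b} f \<Longrightarrow> f \<in> borel_measurable (lborel_Icc a b)"
  by (subst measurable_cong_sets[OF sets_restrict_space_cong[OF sets_lborel] refl])
     (rule borel_measurable_continuous_on_restrict)

lemma absolutely_continuous_fun_mult_square_integrable:
  assumes f: "absolutely_continuous_fun a b f" and h: "h \<in> square_integrable (lborel_Icc a b)"
  shows "(\<lambda>x. f x * h x) \<in> square_integrable (lborel_Icc a b)"
proof -
  obtain B where B: "\<And>x. x \<in> {a..b} \<Longrightarrow> cmod (f x) \<le> B"
    using absolutely_continuous_fun_bounded[OF f] by blast
  have [measurable]: "f \<in> borel_measurable (lborel_Icc a b)"
    by (rule continuous_on_interval_measurable[OF absolutely_continuous_fun_continuous_on[OF f]])
  show ?thesis
  proof (rule square_integrable_bound[OF h])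
    show "AE x in lborel_Icc a b. cmod (f x * h x) \<le> B * cmod (h x)"
      by (rule AE_I2) (simp add: norm_mult mult_right_mono[OF B])
    show "(\<lambda>x. f x * h x) \<in> borel_measurable (lborel_Icc a b)"
      using h by measurable
  qed
qed

lemma absolutely_continuous_fun_square_integrable:
  assumes f: "absolutely_continuous_fun a b f"
  shows "f \<in> square_integrable (lborel_Icc a b)"
  using absolutely_continuous_fun_mult_square_integrable[OF f one_square_integrable] by simp

theorem absolutely_continuous_fun_integral_by_parts:
  assumes "a \<le> b"
    and f: "absolutely_continuous_fun a b f" "f' \<in> square_integrable (lborel_Icc a b)"
      "AE x in lborel_Icc a b. (f has_vector_derivative f' x) (at x within {a..b})"
    and g: "absolutely_continuous_fun a b g" "g' \<in> square_integrable (lborel_Icc a b)"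
      "AE x in lborel_Icc a b. (g has_vector_derivative g' x) (at x within {a..b})"
  shows "(\<integral>x. f x * g' x \<partial>lborel_Icc a b) + (\<integral>x. f' x * g x \<partial>lborel_Icc a b)
    = f b * g b - f a * g a"
proof -
  let ?M = "lborel_Icc a b"
  have 1: "integrable ?M (\<lambda>x. f x * g' x)"
    by (intro square_integrable_interval_integrable absolutely_continuous_fun_mult_square_integrable f g)
  have "integrable ?M (\<lambda>x. g x * f' x)"
    by (intro square_integrable_interval_integrable absolutely_continuous_fun_mult_square_integrable f g)
  then have 2: "integrable ?M (\<lambda>x. f' x * g x)"
    by (simp add: mult.commute)
  have 3: "integrable ?M (\<lambda>x. f x * g' x + f' x * g x)"
    using 1 2 by simp
  have "AE x in ?M. ((\<lambda>x. f x * g x) has_vector_derivative f x * g' x + f' x * g x) (at x within {a..b})"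
    using f(3) g(3) by eventually_elim (rule has_vector_derivative_mult)
  then obtain N where N: "negligible N" "\<And>x. x \<in> {a..b} - N \<Longrightarrow>
      ((\<lambda>x. f x * g x) has_vector_derivative f x * g' x + f' x * g x) (at x within {a..b})"
    using AE_interval_negligible by blast
  have "((\<lambda>x. f x * g' x + f' x * g x) has_integral f b * g b - f a * g a) {a..b}"
    by (rule absolutely_continuous_fun_has_integral[OF \<open>a \<le> b\<close> absolutely_continuous_fun_mult[OF f(1) g(1)] N])
  then have "integral {a..b} (\<lambda>x. f x * g' x + f' x * g x) = f b * g b - f a * g a"
    by (rule integral_unique)
  then show ?thesis
    using integral_interval_eq(2)[OF 3] 1 2 by simp
qed

section \<open>Measures with an integrable density\<close>

text \<open>The supremum over the subsets of \<open>E\<close> is attained at \<open>E \<inter> {h > 0}\<close>.\<close>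

lemma positive_part_measure_density:
  fixes h :: "real \<Rightarrow> real"
  assumes h: "integrable lborel h" and m: "\<And>Y. Y \<in> sets borel \<Longrightarrow> m Y = (\<integral>x. indicator Y x * h x \<partial>lborel)"
  shows "positive_part_measure m = density lborel (\<lambda>x. ennreal (h x))"
proof -
  note [measurable] = borel_measurable_integrable[OF h]
  have "(SUP A \<in> {A \<in> sets borel. A \<subseteq> E}. ennreal (m A)) = (\<integral>\<^sup>+x. ennreal (h x) * indicator E x \<partial>lborel)"
    if E: "E \<in> sets borel" for E
  proof (rule antisym)
    show "(SUP A \<in> {A \<in> sets borel. A \<subseteq> E}. ennreal (m A)) \<le> (\<integral>\<^sup>+x. ennreal (h x) * indicator E x \<partial>lborel)"
    proof (rule SUP_least)
      fix A assume "A \<in> {A \<in> sets borel. A \<subseteq> E}"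
      then have A [measurable]: "A \<in> sets borel" and "A \<subseteq> E" by auto
      have i: "integrable lborel (\<lambda>x. indicator A x * h x)"
        using integrable_mult_indicator[of A lborel h] h A by simp
      have "ennreal (m A) \<le> ennreal (\<integral>x. max 0 (indicator A x * h x) \<partial>lborel)"
        unfolding m[OF A] using i by (intro ennreal_leI Bochner_Integration.integral_mono Bochner_Integration.integrable_max) auto
      also have "\<dots> = (\<integral>\<^sup>+x. ennreal (max 0 (indicator A x * h x)) \<partial>lborel)"
        using i by (intro nn_integral_eq_integral[symmetric] Bochner_Integration.integrable_max) auto
      also have "\<dots> \<le> (\<integral>\<^sup>+x. ennreal (h x) * indicator E x \<partial>lborel)"
        using \<open>A \<subseteq> E\<close> by (intro nn_integral_mono) (auto simp: indicator_def subset_iff)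
      finally show "ennreal (m A) \<le> (\<integral>\<^sup>+x. ennreal (h x) * indicator E x \<partial>lborel)" .
    qed
    let ?A = "E \<inter> {x. 0 < h x}"
    have A: "?A \<in> sets borel"
      using E by measurable
    have i: "integrable lborel (\<lambda>x. indicator ?A x * h x)"
      using integrable_mult_indicator[of ?A lborel h] h A by simp
    have "(\<integral>\<^sup>+x. ennreal (h x) * indicator E x \<partial>lborel) = (\<integral>\<^sup>+x. ennreal (indicator ?A x * h x) \<partial>lborel)"
      by (intro nn_integral_cong) (auto simp: indicator_def ennreal_neg)
    also have "\<dots> = ennreal (m ?A)"
      unfolding m[OF A] by (rule nn_integral_eq_integral[OF i]) (auto simp: indicator_def)
    also have "\<dots> \<le> (SUP A \<in> {A \<in> sets borel. A \<subseteq> E}. ennreal (m A))"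
      by (rule SUP_upper) (use A in auto)
    finally show "(\<integral>\<^sup>+x. ennreal (h x) * indicator E x \<partial>lborel) \<le> (SUP A \<in> {A \<in> sets borel. A \<subseteq> E}. ennreal (m A))" .
  qed
  then show ?thesis
    unfolding positive_part_measure_def density_def space_lborel sets_lborel space_borel
    by (intro measure_of_eq) (auto simp: sets.sigma_sets_eq[of borel, simplified])
qed

lemma complex_measure_integral_density:
  fixes h :: "real \<Rightarrow> complex"
  assumes h: "integrable lborel h" and \<mu>: "\<And>Y. Y \<in> sets borel \<Longrightarrow> \<mu> Y = (\<integral>x. indicator Y x * h x \<partial>lborel)"
    and [measurable]: "g \<in> borel_measurable borel" and gh: "integrable lborel (\<lambda>x. g x * h x)"
  shows "complex_measure_integral \<mu> g = (\<integral>x. g x * h x \<partial>lborel)"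
proof -
  note [measurable] = borel_measurable_integrable[OF h]
  let ?p = "\<lambda>r :: real \<Rightarrow> real. \<integral>x. complex_of_real (max 0 (r x)) * g x \<partial>lborel"
  have part: "(\<integral>x. g x \<partial>positive_part_measure m) = ?p r"
    and part_int: "integrable lborel (\<lambda>x. complex_of_real (max 0 (r x)) * g x)"
    if r: "integrable lborel r" and m: "\<And>Y. Y \<in> sets borel \<Longrightarrow> m Y = (\<integral>x. indicator Y x * r x \<partial>lborel)"
      and le: "\<And>x. \<bar>r x\<bar> \<le> cmod (h x)" for r :: "real \<Rightarrow> real" and m
  proof -
    note [measurable] = borel_measurable_integrable[OF r]
    have "positive_part_measure m = density lborel (\<lambda>x. ennreal (max 0 (r x)))"
      by (simp only: ennreal_max_0 positive_part_measure_density[OF r m])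
    then show "(\<integral>x. g x \<partial>positive_part_measure m) = ?p r"
      by (simp only:, subst integral_density) (auto simp: scaleR_conv_of_real)
    show "integrable lborel (\<lambda>x. complex_of_real (max 0 (r x)) * g x)"
    proof (rule Bochner_Integration.integrable_bound[OF gh])
      have "max 0 (r x) \<le> cmod (h x)" for x
        using le[of x] by (auto simp: abs_le_iff)
      then show "AE x in lborel. norm (complex_of_real (max 0 (r x)) * g x) \<le> norm (g x * h x)"
        by (intro AE_I2) (simp add: norm_mult mult.commute[of "cmod (g _)"] mult_right_mono)
    qed measurable
  qed
  have iY: "integrable lborel (\<lambda>x. indicator Y x * h x)" if "Y \<in> sets borel" for Y
  proof -
    have "(\<lambda>x. indicator Y x * h x) = (\<lambda>x. indicator Y x *\<^sub>R h x)"
      by (auto simp: indicator_def)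
    then show ?thesis
      using integrable_mult_indicator[of Y lborel h] h that by simp
  qed
  have Re\<mu>: "Re (\<mu> Y) = (\<integral>x. indicator Y x * Re (h x) \<partial>lborel)" if "Y \<in> sets borel" for Y
  proof -
    have "Re (indicator Y x * h x) = indicator Y x * Re (h x)" for x
      by (simp add: indicator_def)
    then show ?thesis
      using integral_Re[OF iY[OF that]] \<mu>[OF that] by simp
  qed
  have Im\<mu>: "Im (\<mu> Y) = (\<integral>x. indicator Y x * Im (h x) \<partial>lborel)" if "Y \<in> sets borel" for Y
  proof -
    have "Im (indicator Y x * h x) = indicator Y x * Im (h x)" for x
      by (simp add: indicator_def)
    then show ?thesis
      using integral_Im[OF iY[OF that]] \<mu>[OF that] by simp
  qed
  let ?r = "\<lambda>x. Re (h x)" and ?i = "\<lambda>x. Im (h x)"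
  have R: "integrable lborel ?r" "integrable lborel (\<lambda>x. - ?r x)" "integrable lborel ?i" "integrable lborel (\<lambda>x. - ?i x)"
    using h by simp_all
  have le: "\<bar>?r x\<bar> \<le> cmod (h x)" "\<bar>- ?r x\<bar> \<le> cmod (h x)" "\<bar>?i x\<bar> \<le> cmod (h x)" "\<bar>- ?i x\<bar> \<le> cmod (h x)" for x
    using abs_Re_le_cmod[of "h x"] abs_Im_le_cmod[of "h x"] by simp_all
  have p1: "(\<integral>x. g x \<partial>positive_part_measure (\<lambda>Y. Re (\<mu> Y))) = ?p ?r"
    "integrable lborel (\<lambda>x. complex_of_real (max 0 (?r x)) * g x)"
    by (rule part[OF R(1) _ le(1)] part_int[OF R(1) _ le(1), of "\<lambda>Y. Re (\<mu> Y)"]; simp add: Re\<mu>)+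
  have p3: "(\<integral>x. g x \<partial>positive_part_measure (\<lambda>Y. Im (\<mu> Y))) = ?p ?i"
    "integrable lborel (\<lambda>x. complex_of_real (max 0 (?i x)) * g x)"
    by (rule part[OF R(3) _ le(3)] part_int[OF R(3) _ le(3), of "\<lambda>Y. Im (\<mu> Y)"]; simp add: Im\<mu>)+
  have p2: "(\<integral>x. g x \<partial>positive_part_measure (\<lambda>Y. - Re (\<mu> Y))) = ?p (\<lambda>x. - ?r x)"
    "integrable lborel (\<lambda>x. complex_of_real (max 0 (- ?r x)) * g x)"
    by (rule part[OF R(2) _ le(2)] part_int[OF R(2) _ le(2), of "\<lambda>Y. - Re (\<mu> Y)"]; simp add: Re\<mu>)+
  have p4: "(\<integral>x. g x \<partial>positive_part_measure (\<lambda>Y. - Im (\<mu> Y))) = ?p (\<lambda>x. - ?i x)"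
    "integrable lborel (\<lambda>x. complex_of_real (max 0 (- ?i x)) * g x)"
    by (rule part[OF R(4) _ le(4)] part_int[OF R(4) _ le(4), of "\<lambda>Y. - Im (\<mu> Y)"]; simp add: Im\<mu>)+
  have "complex_measure_integral \<mu> g = ?p ?r - ?p (\<lambda>x. - ?r x) + \<i> * (?p ?i - ?p (\<lambda>x. - ?i x))"
    unfolding complex_measure_integral_def p1(1) p2(1) p3(1) p4(1) ..
  also have "\<dots> = (\<integral>x. complex_of_real (max 0 (?r x)) * g x - complex_of_real (max 0 (- ?r x)) * g x
      + \<i> * (complex_of_real (max 0 (?i x)) * g x - complex_of_real (max 0 (- ?i x)) * g x) \<partial>lborel)"
    using p1(2) p2(2) p3(2) p4(2) by simp
  also have "\<dots> = (\<integral>x. g x * h x \<partial>lborel)"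
  proof (rule Bochner_Integration.integral_cong[OF refl])
    fix x
    have pm: "complex_of_real (max 0 r) - complex_of_real (max 0 (- r)) = complex_of_real r" for r
      by (simp add: max_def flip: of_real_diff)
    have "complex_of_real (max 0 (?r x)) * g x - complex_of_real (max 0 (- ?r x)) * g x
      + \<i> * (complex_of_real (max 0 (?i x)) * g x - complex_of_real (max 0 (- ?i x)) * g x)
      = ((complex_of_real (max 0 (?r x)) - complex_of_real (max 0 (- ?r x)))
        + \<i> * (complex_of_real (max 0 (?i x)) - complex_of_real (max 0 (- ?i x)))) * g x"
      by (simp only: left_diff_distrib distrib_right mult.assoc)
    also have "\<dots> = (complex_of_real (?r x) + \<i> * complex_of_real (?i x)) * g x"
      by (simp only: pm)
    finally show "complex_of_real (max 0 (?r x)) * g x - complex_of_real (max 0 (- ?r x)) * g x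
      + \<i> * (complex_of_real (max 0 (?i x)) * g x - complex_of_real (max 0 (- ?i x)) * g x) = g x * h x"
      by (simp add: complex_eq[symmetric] mult.commute)
  qed
  finally show ?thesis .
qed

section \<open>Functions on the interval and their transforms\<close>

context
  fixes l :: real
begin

abbreviation \<I> where "\<I> \<equiv> interval_lborel l"
abbreviation \<H> where "\<H> \<equiv> L2 \<I>"
abbreviation class_I where "class_I \<equiv> L2_class \<I>"
abbreviation inner_I where "inner_I \<equiv> L2_inner \<I>"

definition zero_extend :: "(real \<Rightarrow> complex) \<Rightarrow> real \<Rightarrow> complex" where
  "zero_extend f x = indicator {0..l} x * f x"

lemma zero_extend_outside: "x \<notin> {0..l} \<Longrightarrow> zero_extend f x = 0"
  by (simp add: zero_extend_def)

lemma zero_extend_scaleR: "zero_extend f = (\<lambda>x. indicator {0..l} x *\<^sub>R f x)"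
  by (auto simp: zero_extend_def indicator_def)

lemma integral_interval_zero_extend: "(\<integral>x. f x \<partial>\<I>) = (\<integral>x. zero_extend f x \<partial>lborel)"
  by (simp add: integral_restrict_space zero_extend_scaleR)

lemma zero_extend_integrable_iff: "integrable lborel (zero_extend f) \<longleftrightarrow> integrable \<I> f"
  by (simp add: integrable_restrict_space zero_extend_scaleR)

lemma zero_extend_square_integrable_iff:
  "zero_extend f \<in> square_integrable lborel \<longleftrightarrow> f \<in> square_integrable \<I>"
proof -
  have "(cmod (zero_extend f x))\<^sup>2 = indicator {0..l} x *\<^sub>R (cmod (f x))\<^sup>2" for x
    by (simp add: zero_extend_def indicator_def)
  moreover have "f \<in> borel_measurable \<I> \<longleftrightarrow> zero_extend f \<in> borel_measurable lborel"
    by (subst borel_measurable_restrict_space_iff) (simp_all add: zero_extend_scaleR)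
  ultimately show ?thesis
    by (simp add: square_integrable_def integrable_restrict_space)
qed

lemma square_integrable_restrict:
  assumes "f \<in> square_integrable lborel"
  shows "f \<in> square_integrable \<I>"
  using truncation_square_integrable[OF assms, of 0 l] zero_extend_square_integrable_iff[of f]
  unfolding zero_extend_def[abs_def] by blast

lemma zero_extend_integrable:
  "f \<in> square_integrable \<I> \<Longrightarrow> integrable lborel (zero_extend f)"
  unfolding zero_extend_integrable_iff by (rule square_integrable_interval_integrable)

lemma zero_extend_cong_AE:
  assumes "AE x in \<I>. f x = g x"
  shows "AE x in lborel. zero_extend f x = zero_extend g x"
proof -
  have "AE x in lborel. x \<in> {0..l} \<longrightarrow> f x = g x"
    using assms by (simp add: AE_restrict_space_iff)
  then show ?thesis
    by eventually_elim (simp add: zero_extend_def indicator_def)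
qed

lemma fourier_integral_cong_AE:
  assumes [measurable]: "f \<in> borel_measurable lborel" "g \<in> borel_measurable lborel"
    and eq: "AE x in lborel. f x = g x"
  shows "fourier_integral f = fourier_integral g"
  unfolding fourier_integral_def[abs_def]
proof (intro ext arg_cong2[where f = "(*)"] refl integral_cong_AE)
  fix x show "AE t in lborel. fourier_kernel x t * f t
      = fourier_kernel x t * g t"
    using eq by eventually_elim simp
qed measurable

text \<open>
  Square integrable functions on a bounded interval are integrable, so their transform is given by the
  integral itself: a function, not only a class, and independent of the representative.
\<close>

definition \<F> :: "(real \<Rightarrow> complex) set \<Rightarrow> real \<Rightarrow> complex" where
  "\<F> \<Phi> = fourier_integral (zero_extend (L2_rep \<Phi>))"

lemma interval_fourier_class:
  assumes f: "f \<in> square_integrable \<I>"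
  shows "\<F> (class_I f) = fourier_integral (zero_extend f)"
  unfolding \<F>_def
proof (rule fourier_integral_cong_AE)
  show "zero_extend (L2_rep (class_I f)) \<in> borel_measurable lborel"
    "zero_extend f \<in> borel_measurable lborel"
    by (intro square_integrable_measurable zero_extend_square_integrable_iff[THEN iffD2] f L2_rep_class(1))+
qed (rule zero_extend_cong_AE[OF L2_rep_class(2)[OF f]])

lemma interval_fourier_square_integrable:
  assumes "\<Phi> \<in> \<H>"
  shows "\<F> \<Phi> \<in> square_integrable lborel"
  unfolding \<F>_def using L2_rep_in(1)[OF assms]
  by (intro fourier_integral_Bessel zero_extend_integrable) (simp_all add: zero_extend_square_integrable_iff)

lemma interval_fourier_parseval:
  assumes "\<Phi> \<in> \<H>" "\<Psi> \<in> \<H>"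
  shows "(\<integral>x. cnj (\<F> \<Phi> x) * \<F> \<Psi> x \<partial>lborel) = inner_I \<Phi> \<Psi>"
proof -
  have "(\<integral>x. cnj (\<F> \<Phi> x) * \<F> \<Psi> x \<partial>lborel)
      = (\<integral>x. cnj (zero_extend (L2_rep \<Phi>) x) * zero_extend (L2_rep \<Psi>) x \<partial>lborel)"
    unfolding \<F>_def using assms[THEN L2_rep_in(1)]
    by (intro fourier_parseval[where a = 0 and b = l] zero_extend_outside) (simp_all add: zero_extend_square_integrable_iff)
  also have "\<dots> = inner_I \<Phi> \<Psi>"
    unfolding L2_inner_def integral_interval_zero_extend
    by (intro Bochner_Integration.integral_cong) (auto simp: zero_extend_def indicator_def)
  finally show ?thesis .
qed

section \<open>The momentum POVM\<close>

lemma fourier_plancherel_class: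
  assumes "integrable lborel f" "f \<in> square_integrable lborel"
  shows "(L2_class lborel f, L2_class lborel (fourier_integral f)) \<in> fourier_plancherel"
proof -
  have 0: "L2_dist lborel \<Phi> \<Phi> = 0" if "\<Phi> \<in> L2 lborel" for \<Phi> :: "(real \<Rightarrow> complex) set"
    using L2_dist_eq_0_iff[OF that that] by simp
  show ?thesis
    unfolding fourier_plancherel_def
    using assms fourier_integral_Bessel[OF assms] by (auto simp: L2_class_in_L2 0 intro!: bexI[of _ f])
qed

lemma L2_inner_dist_right:
  assumes "\<Omega> \<in> L2 M" "\<Phi> \<in> L2 M" "\<Psi> \<in> L2 M"
  shows "cmod (L2_inner M \<Omega> \<Phi> - L2_inner M \<Omega> \<Psi>) \<le> L2_norm M (L2_rep \<Omega>) * L2_dist M \<Phi> \<Psi>"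
proof -
  note r = assms[THEN L2_rep_in(1)]
  have "L2_inner M \<Omega> \<Phi> - L2_inner M \<Omega> \<Psi> = (\<integral>x. cnj (L2_rep \<Omega> x) * (L2_rep \<Phi> x - L2_rep \<Psi> x) \<partial>M)"
    unfolding L2_inner_def by (simp add: right_diff_distrib integrable_cnj_mult r)
  also have "cmod \<dots> \<le> L2_norm M (L2_rep \<Omega>) * L2_dist M \<Phi> \<Psi>"
    unfolding L2_dist_eq by (intro L2_Cauchy_Schwarz square_integrable_diff r)
  finally show ?thesis .
qed

text \<open>
  The adjoint identity holds on the graph of the integral transform and extends to the closure
  of that graph, since both sides are continuous.
\<close>

lemma adjoint_fourier_plancherel_total:
  assumes "\<Omega> \<in> L2 lborel"
  obtains \<Delta> where "(\<Omega>, \<Delta>) \<in> adjoint_op lborel lborel fourier_plancherel"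
proof -
  obtain d where d: "d \<in> square_integrable lborel"
    and adj: "\<And>g. integrable lborel g \<Longrightarrow> g \<in> square_integrable lborel \<Longrightarrow>
      (\<integral>x. cnj (L2_rep \<Omega> x) * fourier_integral g x \<partial>lborel) = (\<integral>x. cnj (d x) * g x \<partial>lborel)"
    using fourier_integral_adjoint_exists[OF L2_rep_in(1)[OF assms]] by blast
  define \<Delta> where "\<Delta> = L2_class lborel d"
  have \<Delta>: "\<Delta> \<in> L2 lborel"
    unfolding \<Delta>_def by (rule L2_class_in_L2[OF d])
  have "L2_inner lborel \<Omega> \<Theta> = L2_inner lborel \<Delta> \<Phi>" if F: "(\<Phi>, \<Theta>) \<in> fourier_plancherel" for \<Phi> \<Theta>
  proof -
    have L: "\<Phi> \<in> L2 lborel" "\<Theta> \<in> L2 lborel"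
      using F by (auto simp: fourier_plancherel_def)
    define C where "C = L2_norm lborel (L2_rep \<Omega>) + L2_norm lborel (L2_rep \<Delta>) + 1"
    have "C > 0"
      unfolding C_def using L2_norm_nonneg[of lborel "L2_rep \<Omega>"] L2_norm_nonneg[of lborel "L2_rep \<Delta>"] by linarith
    have "cmod (L2_inner lborel \<Omega> \<Theta> - L2_inner lborel \<Delta> \<Phi>) \<le> 0 + e" if "e > 0" for e
    proof -
      have "e / C > 0" using \<open>C > 0\<close> \<open>e > 0\<close> by simp
      then obtain f where f: "f \<in> square_integrable lborel" "integrable lborel f"
        "L2_dist lborel (L2_class lborel f) \<Phi> < e / C" "L2_dist lborel (L2_class lborel (fourier_integral f)) \<Theta> < e / C"
        using F unfolding fourier_plancherel_def by blast
      note Ff = fourier_integral_Bessel(1)[OF f(2,1)]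
      have eq: "L2_inner lborel \<Omega> (L2_class lborel (fourier_integral f)) = L2_inner lborel \<Delta> (L2_class lborel f)"
        using adj[OF f(2,1)] L2_inner_class[OF L2_rep_in(1)[OF assms] Ff] L2_inner_class[OF d f(1)]
        by (simp add: L2_rep_in(2)[OF assms] \<Delta>_def)
      have "cmod (L2_inner lborel \<Omega> \<Theta> - L2_inner lborel \<Delta> \<Phi>)
          \<le> cmod (L2_inner lborel \<Omega> (L2_class lborel (fourier_integral f)) - L2_inner lborel \<Omega> \<Theta>)
            + cmod (L2_inner lborel \<Delta> (L2_class lborel f) - L2_inner lborel \<Delta> \<Phi>)"
        using norm_triangle_ineq4[of "L2_inner lborel \<Delta> (L2_class lborel f) - L2_inner lborel \<Delta> \<Phi>"
            "L2_inner lborel \<Omega> (L2_class lborel (fourier_integral f)) - L2_inner lborel \<Omega> \<Theta>"] eq by simp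
      also have "\<dots> \<le> L2_norm lborel (L2_rep \<Omega>) * (e / C) + L2_norm lborel (L2_rep \<Delta>) * (e / C)"
        using f(3,4) by (intro add_mono order_trans[OF L2_inner_dist_right] mult_left_mono assms \<Delta> L L2_class_in_L2 Ff f) auto
      also have "\<dots> \<le> C * (e / C)"
        unfolding distrib_right[symmetric] C_def[symmetric] using \<open>C > 0\<close> \<open>e > 0\<close>
        by (intro mult_right_mono) (auto simp: C_def)
      finally show ?thesis
        using \<open>C > 0\<close> by simp
    qed
    then have "cmod (L2_inner lborel \<Omega> \<Theta> - L2_inner lborel \<Delta> \<Phi>) \<le> 0"
      by (rule field_le_epsilon)
    then show ?thesis by simp
  qed
  then show thesis
    by (intro that[of \<Delta>]) (auto simp: adjoint_op_def assms \<Delta>)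
qed

text \<open>An operator with an everywhere defined adjoint is single valued.\<close>

lemma fourier_plancherel_unique:
  assumes F: "(\<Phi>, \<Theta>) \<in> fourier_plancherel" "(\<Phi>, \<Theta>') \<in> fourier_plancherel"
  shows "\<Theta> = \<Theta>'"
proof (rule L2_eqI_inner)
  show "\<Theta> \<in> L2 lborel" "\<Theta>' \<in> L2 lborel"
    using F by (auto simp: fourier_plancherel_def)
  fix \<Omega> :: "(real \<Rightarrow> complex) set" assume "\<Omega> \<in> L2 lborel"
  then obtain \<Delta> where "(\<Omega>, \<Delta>) \<in> adjoint_op lborel lborel fourier_plancherel"
    using adjoint_fourier_plancherel_total by blast
  then have "\<forall>(\<Phi>, \<Theta>) \<in> fourier_plancherel. L2_inner lborel \<Omega> \<Theta> = L2_inner lborel \<Delta> \<Phi>"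
    by (simp add: adjoint_op_def)
  from bspec[OF this F(1)] bspec[OF this F(2)] have "L2_inner lborel \<Omega> \<Theta> = L2_inner lborel \<Omega> \<Theta>'"
    by simp
  then show "L2_inner lborel \<Theta> \<Omega> = L2_inner lborel \<Theta>' \<Omega>"
    by (metis L2_inner_commute)
qed

lemma zero_extension_eq:
  "zero_extension l = {(class_I f, L2_class lborel (zero_extend f)) | f.
    f \<in> square_integrable \<I>}"
  by (simp add: zero_extension_def zero_extend_def[abs_def])

lemma adjoint_zero_extension_total:
  assumes "\<Delta> \<in> L2 lborel"
  obtains \<Theta> where "(\<Delta>, \<Theta>) \<in> adjoint_op \<I> lborel (zero_extension l)"
proof (rule that)
  note d = L2_rep_in[OF assms]
  note d' = square_integrable_restrict[OF d(1)]
  have "L2_inner lborel \<Delta> (L2_class lborel (zero_extend f))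
      = inner_I (class_I (L2_rep \<Delta>)) (class_I f)"
    if f: "f \<in> square_integrable \<I>" for f
  proof -
    have "L2_inner lborel \<Delta> (L2_class lborel (zero_extend f)) = (\<integral>x. cnj (L2_rep \<Delta> x) * zero_extend f x \<partial>lborel)"
      using L2_inner_class[OF d(1), of "zero_extend f"] f by (simp add: d(2) zero_extend_square_integrable_iff)
    also have "\<dots> = (\<integral>x. cnj (L2_rep \<Delta> x) * f x \<partial>\<I>)"
      unfolding integral_interval_zero_extend
      by (intro Bochner_Integration.integral_cong) (auto simp: zero_extend_def)
    finally show ?thesis
      by (simp add: L2_inner_class[OF d' f])
  qed
  then show "(\<Delta>, class_I (L2_rep \<Delta>)) \<in> adjoint_op \<I> lborel (zero_extension l)"
    by (auto simp: adjoint_op_def zero_extension_eq assms L2_class_in_L2[OF d'])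
qed



abbreviation \<D> where "\<D> \<equiv> moment_domain \<I> (momentum_povm l)"
abbreviation P\<^sub>0 where "P\<^sub>0 \<equiv> minimal_momentum l"

lemma zero_extension_rep:
  assumes "\<Psi> \<in> \<H>"
  shows "(\<Psi>, L2_class lborel (zero_extend (L2_rep \<Psi>))) \<in> zero_extension l"
  using L2_rep_in[OF assms] by (auto simp: zero_extension_eq intro!: exI[of _ "L2_rep \<Psi>"])

lemma fourier_plancherel_zero_extension:
  assumes "\<Psi> \<in> \<H>"
  shows "(L2_class lborel (zero_extend (L2_rep \<Psi>)), L2_class lborel (\<F> \<Psi>)) \<in> fourier_plancherel"
  unfolding \<F>_def using L2_rep_in(1)[OF assms]
  by (intro fourier_plancherel_class) (simp_all add: zero_extend_integrable zero_extend_square_integrable_iff)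

lemma adjoint_interval_fourier:
  assumes \<Delta>: "(C, \<Delta>) \<in> adjoint_op lborel lborel fourier_plancherel"
    and \<Theta>: "(\<Delta>, \<Theta>) \<in> adjoint_op \<I> lborel (zero_extension l)" and \<Psi>: "\<Psi> \<in> \<H>"
  shows "inner_I \<Theta> \<Psi> = L2_inner lborel C (L2_class lborel (\<F> \<Psi>))"
proof -
  have "inner_I \<Theta> \<Psi> = L2_inner lborel \<Delta> (L2_class lborel (zero_extend (L2_rep \<Psi>)))"
    using \<Theta> zero_extension_rep[OF \<Psi>] by (auto simp: adjoint_op_def)
  also have "\<dots> = L2_inner lborel C (L2_class lborel (\<F> \<Psi>))"
    using \<Delta> fourier_plancherel_zero_extension[OF \<Psi>] by (auto simp: adjoint_op_def)
  finally show ?thesis .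
qed

text \<open>
  Chasing an element through the factors \<open>U\<close>, \<open>\<F>\<close>, \<open>Q(Y)\<close>, \<open>\<F>\<^sup>*\<close>, \<open>U\<^sup>*\<close>: the first three act on explicit
  representatives, and the two adjoints are only used through their defining identities.
\<close>

lemma momentum_povm_inner:
  assumes P: "(\<Phi>, \<Theta>) \<in> momentum_povm l Y" and Y: "Y \<in> sets borel"
  shows "\<Theta> \<in> \<H>"
    and "\<Psi> \<in> \<H> \<Longrightarrow> inner_I \<Psi> \<Theta>
      = (\<integral>x. indicator Y x * (cnj (\<F> \<Psi> x) * \<F> \<Phi> x) \<partial>lborel)"
proof -
  obtain A B C \<Delta> where A: "(\<Phi>, A) \<in> zero_extension l" and B: "(A, B) \<in> fourier_plancherel"
    and C: "(B, C) \<in> position_pvm Y" and \<Delta>: "(C, \<Delta>) \<in> adjoint_op lborel lborel fourier_plancherel"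
    and \<Theta>: "(\<Delta>, \<Theta>) \<in> adjoint_op \<I> lborel (zero_extension l)"
    using P unfolding momentum_povm_def momentum_pvm_def by blast
  show "\<Theta> \<in> \<H>"
    using \<Theta> by (auto simp: adjoint_op_def)
  obtain f where f: "f \<in> square_integrable \<I>" "\<Phi> = class_I f"
    "A = L2_class lborel (zero_extend f)"
    using A by (auto simp: zero_extension_eq)
  have ze: "integrable lborel (zero_extend f)" "zero_extend f \<in> square_integrable lborel"
    using f(1) by (simp_all add: zero_extend_integrable zero_extend_square_integrable_iff)
  have Ff: "fourier_integral (zero_extend f) = \<F> \<Phi>"
    unfolding f(2) interval_fourier_class[OF f(1)] ..
  note F2 = fourier_integral_Bessel(1)[OF ze, unfolded Ff]
  have B_eq: "B = L2_class lborel (\<F> \<Phi>)"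
    using fourier_plancherel_unique[OF B] fourier_plancherel_class[OF ze] by (simp add: f(3) Ff)
  obtain g where g: "g \<in> square_integrable lborel" "B = L2_class lborel g"
    "C = L2_class lborel (\<lambda>x. indicator Y x * g x)"
    using C by (auto simp: position_pvm_def)
  have Yg: "(\<lambda>x. indicator Y x * g x) \<in> square_integrable lborel"
    using g(1) Y by (intro square_integrable_indicator) auto
  have "AE x in lborel. g x = \<F> \<Phi> x"
    using L2_class_eq_iff[OF g(1) F2] B_eq g(2) by simp
  then have Yg_eq: "AE x in lborel. indicator Y x * g x = indicator Y x * \<F> \<Phi> x"
    by eventually_elim simp
  assume \<Psi>: "\<Psi> \<in> \<H>"
  note Fh2 = interval_fourier_square_integrable[OF \<Psi>]
  have "inner_I \<Theta> \<Psi> = L2_inner lborel C (L2_class lborel (\<F> \<Psi>))"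
    by (rule adjoint_interval_fourier[OF \<Delta> \<Theta> \<Psi>])
  also have "\<dots> = (\<integral>x. cnj (indicator Y x * g x) * \<F> \<Psi> x \<partial>lborel)"
    unfolding g(3) by (rule L2_inner_class[OF Yg Fh2])
  also have "\<dots> = (\<integral>x. cnj (indicator Y x * \<F> \<Phi> x) * \<F> \<Psi> x \<partial>lborel)"
  proof (rule integral_cong_AE)
    show "(\<lambda>x. cnj (indicator Y x * g x) * \<F> \<Psi> x) \<in> borel_measurable lborel"
      by (intro borel_measurable_integrable integrable_cnj_mult Yg Fh2)
    have "(\<lambda>x. indicator Y x * \<F> \<Phi> x) \<in> square_integrable lborel"
      using F2 Y by (intro square_integrable_indicator) auto
    then show "(\<lambda>x. cnj (indicator Y x * \<F> \<Phi> x) * \<F> \<Psi> x) \<in> borel_measurable lborel"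
      by (intro borel_measurable_integrable integrable_cnj_mult Fh2)
    show "AE x in lborel. cnj (indicator Y x * g x) * \<F> \<Psi> x
        = cnj (indicator Y x * \<F> \<Phi> x) * \<F> \<Psi> x"
      using Yg_eq by eventually_elim (simp only:)
  qed
  finally have "inner_I \<Psi> \<Theta>
      = (\<integral>x. cnj (cnj (indicator Y x * \<F> \<Phi> x) * \<F> \<Psi> x) \<partial>lborel)"
    unfolding Bochner_Integration.integral_cnj by (subst L2_inner_commute) simp
  also have "\<dots> = (\<integral>x. indicator Y x * (cnj (\<F> \<Psi> x) * \<F> \<Phi> x) \<partial>lborel)"
    by (intro Bochner_Integration.integral_cong) (auto simp: mult_ac)
  finally show "inner_I \<Psi> \<Theta>
      = (\<integral>x. indicator Y x * (cnj (\<F> \<Psi> x) * \<F> \<Phi> x) \<partial>lborel)" .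
qed

lemma momentum_povm_total:
  assumes \<Phi>: "\<Phi> \<in> \<H>" and Y: "Y \<in> sets borel"
  obtains \<Theta> where "(\<Phi>, \<Theta>) \<in> momentum_povm l Y"
proof -
  note F2 = interval_fourier_square_integrable[OF \<Phi>]
  have YF: "(\<lambda>x. indicator Y x * \<F> \<Phi> x) \<in> square_integrable lborel"
    using F2 Y by (intro square_integrable_indicator) auto
  have Q: "(L2_class lborel (\<F> \<Phi>), L2_class lborel (\<lambda>x. indicator Y x * \<F> \<Phi> x)) \<in> position_pvm Y"
    using F2 by (auto simp: position_pvm_def)
  obtain \<Delta> where \<Delta>: "(L2_class lborel (\<lambda>x. indicator Y x * \<F> \<Phi> x), \<Delta>) \<in> adjoint_op lborel lborel fourier_plancherel"
    using adjoint_fourier_plancherel_total[OF L2_class_in_L2[OF YF]] by blast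
  then have "\<Delta> \<in> L2 lborel"
    by (auto simp: adjoint_op_def)
  then obtain \<Theta> where \<Theta>: "(\<Delta>, \<Theta>) \<in> adjoint_op \<I> lborel (zero_extension l)"
    using adjoint_zero_extension_total by blast
  have "(\<Phi>, \<Theta>) \<in> momentum_povm l Y"
    unfolding momentum_povm_def momentum_pvm_def
    using zero_extension_rep[OF \<Phi>] fourier_plancherel_zero_extension[OF \<Phi>] Q \<Delta> \<Theta> by blast
  then show thesis
    by (rule that)
qed

lemma povm_measure_momentum:
  assumes \<Psi>: "\<Psi> \<in> \<H>" and \<Phi>: "\<Phi> \<in> \<H>" and Y: "Y \<in> sets borel"
  shows "povm_measure \<I> (momentum_povm l) \<Psi> \<Phi> Y
    = (\<integral>x. indicator Y x * (cnj (\<F> \<Psi> x) * \<F> \<Phi> x) \<partial>lborel)"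
proof -
  obtain \<Theta> where \<Theta>: "(\<Phi>, \<Theta>) \<in> momentum_povm l Y"
    using momentum_povm_total[OF \<Phi> Y] by blast
  have "op_apply (momentum_povm l Y) \<Phi> = \<Theta>"
    unfolding op_apply_def
  proof (rule the_equality)
    fix \<Theta>' assume \<Theta>': "(\<Phi>, \<Theta>') \<in> momentum_povm l Y"
    show "\<Theta>' = \<Theta>"
    proof (rule L2_eqI_inner)
      fix \<Xi> assume \<Xi>: "\<Xi> \<in> \<H>"
      have "inner_I \<Xi> \<Theta>' = inner_I \<Xi> \<Theta>"
        unfolding momentum_povm_inner(2)[OF \<Theta> Y \<Xi>] momentum_povm_inner(2)[OF \<Theta>' Y \<Xi>] ..
      then show "inner_I \<Theta>' \<Xi> = inner_I \<Theta> \<Xi>"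
        by (metis L2_inner_commute)
    qed (use momentum_povm_inner(1)[OF \<Theta> Y] momentum_povm_inner(1)[OF \<Theta>' Y] in auto)
  qed (rule \<Theta>)
  then show ?thesis
    unfolding povm_measure_def by (simp add: momentum_povm_inner(2)[OF \<Theta> Y \<Psi>])
qed

section \<open>The weak moment operators in the Fourier picture\<close>

lemma moment_domain_iff:
  "\<Phi> \<in> \<D> k \<longleftrightarrow>
    \<Phi> \<in> \<H> \<and> integrable lborel (\<lambda>x. \<bar>x\<bar> ^ k * (cmod (\<F> \<Phi> x))\<^sup>2)"
proof (cases "\<Phi> \<in> \<H>")
  case True
  note F2 = interval_fourier_square_integrable[OF True]
  have [measurable]: "\<F> \<Phi> \<in> borel_measurable borel"
    using square_integrable_measurable[OF F2] by simp
  let ?F = "\<lambda>x. (cmod (\<F> \<Phi> x))\<^sup>2"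
  have "ennreal (Re (povm_measure \<I> (momentum_povm l) \<Phi> \<Phi> Y))
      = (\<integral>\<^sup>+x. ennreal (?F x) * indicator Y x \<partial>lborel)" if Y: "Y \<in> sets borel" for Y
  proof -
    have i: "integrable lborel (\<lambda>x. indicator Y x * ?F x)"
      using integrable_mult_indicator[of Y lborel ?F] square_integrable_integrable[OF F2] Y by simp
    have "povm_measure \<I> (momentum_povm l) \<Phi> \<Phi> Y
        = (\<integral>x. complex_of_real (indicator Y x * ?F x) \<partial>lborel)"
      unfolding povm_measure_momentum[OF True True Y]
      by (intro Bochner_Integration.integral_cong)
         (auto simp: indicator_def complex_norm_square mult.commute[of "cnj _"] simp del: of_real_power)
    then have "ennreal (Re (povm_measure \<I> (momentum_povm l) \<Phi> \<Phi> Y))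
        = ennreal (\<integral>x. indicator Y x * ?F x \<partial>lborel)"
      unfolding integral_complex_of_real by simp
    also have "\<dots> = (\<integral>\<^sup>+x. ennreal (indicator Y x * ?F x) \<partial>lborel)"
      by (rule nn_integral_eq_integral[OF i, symmetric]) simp
    also have "\<dots> = (\<integral>\<^sup>+x. ennreal (?F x) * indicator Y x \<partial>lborel)"
      by (intro nn_integral_cong) (simp add: indicator_def)
    finally show ?thesis .
  qed
  then have "measure_of UNIV (sets borel) (\<lambda>Y. ennreal (Re (povm_measure \<I> (momentum_povm l) \<Phi> \<Phi> Y)))
      = density lborel (\<lambda>x. ennreal (?F x))"
    unfolding density_def space_lborel sets_lborel space_borel
    by (intro measure_of_eq) (auto simp: sets.sigma_sets_eq[of borel, simplified])
  then have "\<Phi> \<in> \<D> k \<longleftrightarrow>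
      (\<integral>\<^sup>+x. ennreal (?F x) * ennreal (\<bar>x\<bar> ^ k) \<partial>lborel) < \<infinity>"
    using True by (simp add: moment_domain_def nn_integral_density)
  also have "(\<integral>\<^sup>+x. ennreal (?F x) * ennreal (\<bar>x\<bar> ^ k) \<partial>lborel) = (\<integral>\<^sup>+x. ennreal (norm (\<bar>x\<bar> ^ k * ?F x)) \<partial>lborel)"
    by (intro nn_integral_cong) (simp add: ennreal_mult[symmetric] mult.commute)
  also have "\<dots> < \<infinity> \<longleftrightarrow> integrable lborel (\<lambda>x. \<bar>x\<bar> ^ k * ?F x)"
    unfolding integrable_iff_bounded by simp
  finally show ?thesis
    using True by simp
qed (simp add: moment_domain_def)

lemma moment_domain_integrable:
  assumes \<Psi>: "\<Psi> \<in> \<D> k"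
    and \<Phi>: "\<Phi> \<in> \<D> k"
  shows "integrable lborel (\<lambda>x. complex_of_real x ^ k * (cnj (\<F> \<Psi> x) * \<F> \<Phi> x))"
proof (rule Bochner_Integration.integrable_bound)
  let ?F = "\<lambda>\<Phi> x. \<bar>x\<bar> ^ k * (cmod (\<F> \<Phi> x))\<^sup>2"
  have L: "\<Psi> \<in> \<H>" "\<Phi> \<in> \<H>"
    using \<Psi> \<Phi> by (auto simp: moment_domain_iff)
  have [measurable]: "\<F> \<Psi> \<in> borel_measurable borel" "\<F> \<Phi> \<in> borel_measurable borel"
    using L[THEN interval_fourier_square_integrable, THEN square_integrable_measurable] by simp_all
  show "integrable lborel (\<lambda>x. ?F \<Psi> x + ?F \<Phi> x)"
    using \<Psi> \<Phi> by (auto simp: moment_domain_iff)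
  have "cmod (complex_of_real x ^ k * (cnj (\<F> \<Psi> x) * \<F> \<Phi> x)) \<le> ?F \<Psi> x + ?F \<Phi> x" for x
  proof -
    let ?p = "cmod (\<F> \<Psi> x)" and ?q = "cmod (\<F> \<Phi> x)"
    have "?p * ?q \<le> ?p\<^sup>2 + ?q\<^sup>2"
      using sum_squares_bound[of ?p ?q] mult_nonneg_nonneg[OF norm_ge_zero norm_ge_zero, of "\<F> \<Psi> x" "\<F> \<Phi> x"]
      by linarith
    then have "\<bar>x\<bar> ^ k * (?p * ?q) \<le> \<bar>x\<bar> ^ k * (?p\<^sup>2 + ?q\<^sup>2)"
      by (intro mult_left_mono) auto
    then show ?thesis
      by (simp add: norm_mult norm_power distrib_left)
  qed
  then show "AE x in lborel. norm (complex_of_real x ^ k * (cnj (\<F> \<Psi> x) * \<F> \<Phi> x))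
      \<le> norm (?F \<Psi> x + ?F \<Phi> x)"
    by (intro AE_I2) simp
  show "(\<lambda>x. complex_of_real x ^ k * (cnj (\<F> \<Psi> x) * \<F> \<Phi> x)) \<in> borel_measurable lborel"
    by measurable
qed

lemma moment_integral_momentum:
  assumes \<Psi>: "\<Psi> \<in> \<D> k"
    and \<Phi>: "\<Phi> \<in> \<D> k"
  shows "complex_measure_integral (povm_measure \<I> (momentum_povm l) \<Psi> \<Phi>) (\<lambda>x. complex_of_real x ^ k)
    = (\<integral>x. complex_of_real x ^ k * (cnj (\<F> \<Psi> x) * \<F> \<Phi> x) \<partial>lborel)"
proof (rule complex_measure_integral_density)
  have L: "\<Psi> \<in> \<H>" "\<Phi> \<in> \<H>"
    using \<Psi> \<Phi> by (auto simp: moment_domain_iff)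
  show "integrable lborel (\<lambda>x. cnj (\<F> \<Psi> x) * \<F> \<Phi> x)"
    by (intro integrable_cnj_mult interval_fourier_square_integrable L)
  show "povm_measure \<I> (momentum_povm l) \<Psi> \<Phi> Y
      = (\<integral>x. indicator Y x * (cnj (\<F> \<Psi> x) * \<F> \<Phi> x) \<partial>lborel)"
    if "Y \<in> sets borel" for Y
    by (rule povm_measure_momentum[OF L that])
  show "integrable lborel (\<lambda>x. complex_of_real x ^ k * (cnj (\<F> \<Psi> x) * \<F> \<Phi> x))"
    by (rule moment_domain_integrable[OF \<Psi> \<Phi>])
qed measurable

text \<open>
  If the moment functional is represented by a vector, it is an inner product with that vector,
  and hence continuous.
\<close>

lemma weak_moment_iff:
  "(\<Phi>, \<Omega>) \<in> weak_moment \<I> (momentum_povm l) k \<longleftrightarrow>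
    \<Phi> \<in> \<D> k \<and> \<Omega> \<in> \<H> \<and>
    (\<forall>\<Psi> \<in> \<D> k. inner_I \<Psi> \<Omega>
      = (\<integral>x. complex_of_real x ^ k * (cnj (\<F> \<Psi> x) * \<F> \<Phi> x) \<partial>lborel))"
  (is "?W \<longleftrightarrow> ?R")
proof
  assume ?W
  then show ?R
    by (auto simp: weak_moment_def moment_integral_momentum)
next
  assume R: ?R
  let ?D = "\<D> k"
  have eq: "inner_I \<Psi> \<Omega>
      = complex_measure_integral (povm_measure \<I> (momentum_povm l) \<Psi> \<Phi>) (\<lambda>x. complex_of_real x ^ k)"
    if "\<Psi> \<in> ?D" for \<Psi>
    using R that by (simp add: moment_integral_momentum)
  interpret Metric_space "\<H>" "L2_dist \<I>"
    by (rule Metric_space_L2)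
  have "continuous_map (subtopology (L2_topology \<I>) ?D) euclidean (\<lambda>\<Psi>. inner_I \<Psi> \<Omega>)"
    using R by (intro continuous_map_from_subtopology continuous_map_L2_inner_left) auto
  then have "continuous_map (subtopology (L2_topology \<I>) ?D) euclidean
      (\<lambda>\<Psi>. complex_measure_integral (povm_measure \<I> (momentum_povm l) \<Psi> \<Phi>) (\<lambda>x. complex_of_real x ^ k))"
    by (rule continuous_map_eq) (auto simp: eq)
  then show ?W
    using R eq by (auto simp: weak_moment_def)
qed

section \<open>The minimal momentum operator in the Fourier picture\<close>

text \<open>
  Integration by parts against the kernel. The boundary term is what distinguishes the minimal
  momentum operator from its adjoint.
\<close>

lemma fourier_integral_derivative:
  assumes "0 \<le> l" and f: "absolutely_continuous_fun 0 l f" "f' \<in> square_integrable \<I>"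
    "AE x in \<I>. (f has_vector_derivative f' x) (at x within {0..l})"
  shows "fourier_integral (zero_extend f') x = \<i> * complex_of_real x * fourier_integral (zero_extend f) x
    + complex_of_real (1 / sqrt (2 * pi)) * (fourier_kernel x l * f l - f 0)"
proof -
  let ?e = "\<lambda>t :: real. fourier_kernel x t"
  let ?e' = "\<lambda>t :: real. - (\<i> * complex_of_real x) * ?e t"
  define c where "c = complex_of_real (1 / sqrt (2 * pi))"
  have deriv: "(?e has_vector_derivative ?e' t) (at t within S)" for t S
    by (rule has_vector_derivative_real_field) (auto intro!: derivative_eq_intros)
  have ac: "absolutely_continuous_fun 0 l ?e"
  proof (rule absolutely_continuous_funI_Lipschitz)
    fix u v :: real assume "u < v"
    have "cmod (?e v - ?e u) \<le> \<bar>x\<bar> * norm (v - u)"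
    proof (rule differentiable_bound[of "{u..v}"])
      show "(?e has_derivative (\<lambda>y. y *\<^sub>R ?e' t)) (at t within {u..v})" for t
        using deriv unfolding has_vector_derivative_def .
      show "onorm (\<lambda>y. y *\<^sub>R ?e' t) \<le> \<bar>x\<bar>" for t
        by (rule onorm_le) (simp only: norm_scaleR norm_mult norm_minus_cancel norm_fourier_kernel, simp add: mult.commute)
    qed (use \<open>u < v\<close> in auto)
    then show "cmod (?e v - ?e u) \<le> \<bar>x\<bar> * (v - u)"
      using \<open>u < v\<close> by simp
  qed
  have "(\<integral>t. ?e t * f' t \<partial>\<I>) + (\<integral>t. ?e' t * f t \<partial>\<I>) = ?e l * f l - ?e 0 * f 0"
    by (rule absolutely_continuous_fun_integral_by_parts[OF \<open>0 \<le> l\<close> ac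
          square_integrable_cmult[OF absolutely_continuous_fun_square_integrable[OF ac]] AE_I2[OF deriv] f])
  also have "(\<integral>t. ?e' t * f t \<partial>\<I>) = - (\<i> * complex_of_real x) * (\<integral>t. ?e t * f t \<partial>\<I>)"
    unfolding mult.assoc[of "- (\<i> * complex_of_real x)"] by (rule integral_mult_right_zero)
  finally have *: "(\<integral>t. ?e t * f' t \<partial>\<I>) = \<i> * complex_of_real x * (\<integral>t. ?e t * f t \<partial>\<I>) + (?e l * f l - f 0)"
    by (simp add: algebra_simps)
  have F: "fourier_integral (zero_extend g) x = c * (\<integral>t. ?e t * g t \<partial>\<I>)" for g
    unfolding fourier_integral_def c_def[symmetric] integral_interval_zero_extend
    by (intro arg_cong[where f = "(*) c"] Bochner_Integration.integral_cong) (simp_all add: zero_extend_def mult.left_commute)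
  show ?thesis
    unfolding F * c_def[symmetric] by (simp add: algebra_simps)
qed

lemma minimal_momentum_L2:
  assumes "(\<Phi>, \<Psi>) \<in> P\<^sub>0"
  shows "\<Phi> \<in> \<H>" "\<Psi> \<in> \<H>"
  using assms L2_class_in_L2[OF square_integrable_cmult[of _ "\<I>" "- \<i>"]]
  by (auto simp: minimal_momentum_def L2_class_in_L2)

lemma zero_extend_cmult: "zero_extend (\<lambda>x. c * f x) = (\<lambda>x. c * zero_extend f x)"
  by (auto simp: zero_extend_def)

lemma fourier_integral_cmult: "fourier_integral (\<lambda>x. c * f x) x = c * fourier_integral f x"
  unfolding fourier_integral_def by (simp only: mult.left_commute[of _ c] integral_mult_right_zero)

lemma minimal_momentum_fourier:
  assumes "0 \<le> l" and P: "(\<Phi>, \<Psi>) \<in> P\<^sub>0"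
  shows "\<F> \<Psi> x = complex_of_real x * \<F> \<Phi> x"
proof -
  obtain f f' where f: "f \<in> square_integrable \<I>" "f' \<in> square_integrable \<I>"
    "absolutely_continuous_fun 0 l f" "f 0 = 0" "f l = 0"
    "AE x in \<I>. (f has_vector_derivative f' x) (at x within {0..l})"
    "\<Phi> = class_I f" "\<Psi> = class_I (\<lambda>x. - \<i> * f' x)"
    using P by (auto simp: minimal_momentum_def)
  have "\<F> \<Psi> x = - \<i> * fourier_integral (zero_extend f') x"
    unfolding f(8) interval_fourier_class[OF square_integrable_cmult[OF f(2)]] zero_extend_cmult fourier_integral_cmult ..
  also have "\<dots> = complex_of_real x * fourier_integral (zero_extend f) x"
    using fourier_integral_derivative[OF \<open>0 \<le> l\<close> f(3,2,6)] f(4,5) by (simp add: mult.assoc[symmetric])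
  also have "fourier_integral (zero_extend f) = \<F> \<Phi>"
    unfolding f(7) interval_fourier_class[OF f(1)] ..
  finally show ?thesis .
qed

text \<open>
  A trigonometric term \<open>a - b exp (- i l x)\<close> that does not vanish is not square integrable at
  infinity against \<open>dx / x\<close>: its squared modulus and the one shifted by the half period \<open>\<pi> / l\<close> add up to the constant
  \<open>2 (|a|\<^sup>2 + |b|\<^sup>2)\<close>, and \<open>\<integral> dx / x\<close> diverges.
\<close>

lemma boundary_values_vanish:
  fixes a b :: complex and P Q :: "real \<Rightarrow> real"
  assumes "l > 0" and P: "integrable lborel P" "\<And>x. 0 \<le> P x" and Q: "integrable lborel (\<lambda>x. \<bar>x\<bar> * Q x)" "\<And>x. 0 \<le> Q x"
    and le: "\<And>x. (cmod (a - fourier_kernel x l * b))\<^sup>2 \<le> P x + x\<^sup>2 * Q x"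
  shows "a = 0 \<and> b = 0"
proof -
  define u where "u x = (cmod (a - fourier_kernel x l * b))\<^sup>2" for x :: real
  define R where "R x = P x + \<bar>x\<bar> * Q x" for x
  define s where "s = pi / l"
  define K where "K = 2 * ((cmod a)\<^sup>2 + (cmod b)\<^sup>2)"
  have "s > 0"
    using \<open>l > 0\<close> by (simp add: s_def)
  have R: "integrable lborel R" "R x \<ge> 0" for x
    using P Q by (auto simp: R_def[abs_def])
  have u_le: "u x / x \<le> R x" if "x \<ge> 1" for x
  proof -
    have "u x \<le> P x + x\<^sup>2 * Q x"
      unfolding u_def by (rule le)
    also have "\<dots> \<le> x * P x + x\<^sup>2 * Q x"
      using mult_right_mono[OF that P(2)[of x]] by simp
    also have "\<dots> = x * R x"
      using that by (simp add: R_def power2_eq_square algebra_simps)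
    finally show ?thesis
      using that by (simp add: divide_le_eq mult.commute)
  qed
  have u_sum: "u x + u (x + s) = K" for x
  proof -
    let ?z = "fourier_kernel x l"
    have "- (\<i> * complex_of_real (x + s) * complex_of_real l) = - (\<i> * complex_of_real x * complex_of_real l) - \<i> * complex_of_real pi"
      using \<open>l > 0\<close> by (simp add: s_def algebra_simps)
    then have shift: "exp (- (\<i> * complex_of_real (x + s) * complex_of_real l)) = - ?z"
      by (simp only: exp_diff exp_pi_i') simp
    have "(cmod (a - w))\<^sup>2 + (cmod (a + w))\<^sup>2 = 2 * ((cmod a)\<^sup>2 + (cmod w)\<^sup>2)" for w
      by (simp add: cmod_power2 power2_sum power2_diff)
    from this[of "?z * b"] show ?thesis
      unfolding u_def shift K_def by (simp add: norm_mult)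
  qed
  define S where "S x = R x + (1 + s) * R (x + s)" for x
  have S: "integrable lborel S" "S x \<ge> 0" for x
    using R lborel_integrable_real_affine[OF R(1), of 1 s] \<open>s > 0\<close> by (auto simp: S_def[abs_def] add.commute)
  have K_le: "K / x \<le> S x" if "x \<ge> 1" for x
  proof -
    have "u (x + s) / x = (x + s) / x * (u (x + s) / (x + s))"
      using that \<open>s > 0\<close> by simp
    also have "\<dots> \<le> (1 + s) * R (x + s)"
    proof (rule mult_mono)
      show "(x + s) / x \<le> 1 + s"
        using that \<open>s > 0\<close> by (simp add: field_simps)
      show "u (x + s) / (x + s) \<le> R (x + s)"
        using that \<open>s > 0\<close> by (intro u_le) simp
      show "0 \<le> u (x + s) / (x + s)"
        using that \<open>s > 0\<close> by (simp add: u_def)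
    qed (use \<open>s > 0\<close> in simp)
    finally have "u (x + s) / x \<le> (1 + s) * R (x + s)" .
    then have "u x / x + u (x + s) / x \<le> S x"
      using u_le[OF that] by (simp add: S_def)
    then show ?thesis
      by (simp add: u_sum[of x, symmetric] add_divide_distrib)
  qed
  have K_bound: "K * T \<le> integral\<^sup>L lborel S" if "T \<ge> 0" for T
  proof -
    have hb: "has_bochner_integral lborel (\<lambda>x. K / x * indicator {1..exp T} x) (K * ln (exp T) - K * ln 1)"
    proof (rule has_bochner_integral_FTC_Icc_real)
      show "1 \<le> exp T"
        using that by simp
      show "((\<lambda>x. K * ln x) has_real_derivative K / x) (at x)" if "1 \<le> x" "x \<le> exp T" for x
        using that by (auto intro!: derivative_eq_intros)
      show "isCont (\<lambda>x. K / x) x" if "1 \<le> x" "x \<le> exp T" for x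
        using that by (intro continuous_intros) auto
    qed
    have "K * T = (\<integral>x. K / x * indicator {1..exp T} x \<partial>lborel)"
      using has_bochner_integral_integral_eq[OF hb] by simp
    also have "\<dots> \<le> integral\<^sup>L lborel S"
    proof (rule Bochner_Integration.integral_mono)
      show "integrable lborel (\<lambda>x. K / x * indicator {1..exp T} x)"
        using hb by (rule integrable.intros)
      show "K / x * indicator {1..exp T} x \<le> S x" for x
        using K_le[of x] S(2)[of x] by (auto simp: indicator_def)
    qed (rule S)
    finally show ?thesis .
  qed
  have "K = 0"
  proof (rule ccontr)
    assume "K \<noteq> 0"
    moreover have "0 \<le> K"
      by (simp add: K_def)
    ultimately have "K > 0"
      by simp
    have "0 \<le> integral\<^sup>L lborel S"
      by (rule Bochner_Integration.integral_nonneg) (rule S(2))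
    then have "K * ((integral\<^sup>L lborel S + 1) / K) \<le> integral\<^sup>L lborel S"
      using \<open>K > 0\<close> by (intro K_bound) simp
    then show False
      using \<open>K > 0\<close> by simp
  qed
  then have "(cmod a)\<^sup>2 + (cmod b)\<^sup>2 = 0"
    unfolding K_def mult_eq_0_iff by (elim disjE) simp_all
  then show ?thesis
    unfolding sum_power2_eq_zero_iff by simp
qed

text \<open>
  The last assumption says that \<open>\<Omega>\<close> is the value of the adjoint of the minimal momentum operator at \<open>\<Phi>\<close>, so
  by du Bois-Reymond's lemma \<open>\<Phi>\<close> has an absolutely continuous representative \<open>G + m\<close> with derivative \<open>i \<Omega>\<close>:
  test with the primitive \<open>\<psi>\<close> of \<open>h = \<Phi> - G - m\<close>, where the constant \<open>m\<close> is chosen so that \<open>\<psi>\<close> vanishes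
  at both ends. Nonzero boundary values would make the transform decay like \<open>1 / x\<close> only, against the
  moment condition.
\<close>

lemma minimal_momentum_if_adjoint:
  assumes "l > 0" and \<Phi>: "\<Phi> \<in> \<H>" and \<Omega>: "\<Omega> \<in> \<H>"
    and moment: "integrable lborel (\<lambda>x. \<bar>x\<bar> * (cmod (\<F> \<Phi> x))\<^sup>2)"
    and adj: "\<And>\<Psi> \<Psi>'. (\<Psi>, \<Psi>') \<in> P\<^sub>0 \<Longrightarrow> inner_I \<Psi>' \<Phi> = inner_I \<Psi> \<Omega>"
  shows "(\<Phi>, \<Omega>) \<in> P\<^sub>0"
proof -
  let ?M = "\<I>"
  let ?\<phi> = "L2_rep \<Phi>" and ?\<omega> = "L2_rep \<Omega>"
  note \<phi> = L2_rep_in[OF \<Phi>] and \<omega> = L2_rep_in[OF \<Omega>]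
  have i\<omega>: "(\<lambda>x. \<i> * ?\<omega> x) \<in> square_integrable ?M"
    by (rule square_integrable_cmult[OF \<omega>(1)])
  have const_ac: "absolutely_continuous_fun 0 l (\<lambda>x. c)" for c
    by (rule absolutely_continuous_funI_Lipschitz[where L = 0]) simp
  define G where "G t = integral {0..t} (\<lambda>x. \<i> * ?\<omega> x)" for t
  have G: "absolutely_continuous_fun 0 l G"
    "AE x in ?M. (G has_vector_derivative \<i> * ?\<omega> x) (at x within {0..l})"
    unfolding G_def[abs_def]
    by (rule absolutely_continuous_fun_indefinite_integral[OF i\<omega>] indefinite_integral_has_vector_derivative_AE[OF i\<omega>])+
  define m where "m = (\<integral>x. ?\<phi> x - G x \<partial>?M) / complex_of_real l"
  define h where "h x = ?\<phi> x - (G x + m)" for x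
  define f where "f x = G x + m" for x
  have f_ac: "absolutely_continuous_fun 0 l f"
    unfolding f_def[abs_def] by (rule absolutely_continuous_fun_add[OF G(1) const_ac])
  note f_sq = absolutely_continuous_fun_square_integrable[OF f_ac]
  have f_deriv: "AE x in ?M. (f has_vector_derivative \<i> * ?\<omega> x) (at x within {0..l})"
    using G(2) unfolding f_def[abs_def] by eventually_elim (auto intro!: derivative_eq_intros)
  have h: "h \<in> square_integrable ?M"
    using square_integrable_diff[OF \<phi>(1) f_sq] by (simp add: h_def[abs_def] f_def)
  note h_int = square_integrable_interval_integrable[OF h]
  have h_mean: "(\<integral>x. h x \<partial>?M) = 0"
  proof -
    note Gsq = absolutely_continuous_fun_square_integrable[OF G(1)]
    have i1: "integrable ?M (\<lambda>x. ?\<phi> x - G x)"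
      by (intro square_integrable_interval_integrable square_integrable_diff \<phi> Gsq)
    have i2: "integrable ?M (\<lambda>x. m)"
      by (intro square_integrable_interval_integrable absolutely_continuous_fun_square_integrable const_ac)
    have "(\<integral>x. h x \<partial>?M) = (\<integral>x. (?\<phi> x - G x) - m \<partial>?M)"
      by (simp add: h_def diff_diff_eq)
    also have "\<dots> = (\<integral>x. ?\<phi> x - G x \<partial>?M) - (\<integral>x. m \<partial>?M)"
      by (rule Bochner_Integration.integral_diff[OF i1 i2])
    also have "(\<integral>x. m \<partial>?M) = complex_of_real l * m"
      using integral_interval_eq(2)[OF i2] \<open>l > 0\<close> by (simp add: scaleR_conv_of_real)
    finally show ?thesis
      using \<open>l > 0\<close> by (simp add: m_def)
  qed
  \<comment> \<open>the mean of \<open>h\<close> vanishes, so its primitive vanishes at both ends and is an admissible test function\<close>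
  define \<psi> where "\<psi> t = integral {0..t} h" for t
  have \<psi>: "absolutely_continuous_fun 0 l \<psi>"
    "AE x in ?M. (\<psi> has_vector_derivative h x) (at x within {0..l})"
    unfolding \<psi>_def[abs_def]
    by (rule absolutely_continuous_fun_indefinite_integral[OF h] indefinite_integral_has_vector_derivative_AE[OF h])+
  note \<psi>_sq = absolutely_continuous_fun_square_integrable[OF \<psi>(1)]
  have \<psi>_ends: "\<psi> 0 = 0" "\<psi> l = 0"
    using integral_interval_eq(2)[OF h_int] h_mean by (simp_all add: \<psi>_def)
  have "(L2_class ?M \<psi>, L2_class ?M (\<lambda>x. - \<i> * h x)) \<in> P\<^sub>0"
    unfolding minimal_momentum_def using \<psi> \<psi>_ends \<psi>_sq h by blast
  from adj[OF this] have "(\<integral>x. cnj (- \<i> * h x) * ?\<phi> x \<partial>?M) = (\<integral>x. cnj (\<psi> x) * ?\<omega> x \<partial>?M)"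
    using L2_inner_class[OF square_integrable_cmult[OF h, of "- \<i>"] \<phi>(1)] L2_inner_class[OF \<psi>_sq \<omega>(1)] \<phi>(2) \<omega>(2)
    by simp
  moreover have "(\<integral>x. cnj (- \<i> * h x) * ?\<phi> x \<partial>?M) = \<i> * (\<integral>x. cnj (h x) * ?\<phi> x \<partial>?M)"
    unfolding integral_mult_right_zero[symmetric] by (simp add: mult.assoc)
  ultimately have 1: "\<i> * (\<integral>x. cnj (h x) * ?\<phi> x \<partial>?M) = (\<integral>x. cnj (\<psi> x) * ?\<omega> x \<partial>?M)"
    by simp
  have cnj\<psi>_deriv: "AE x in ?M. ((\<lambda>x. cnj (\<psi> x)) has_vector_derivative cnj (h x)) (at x within {0..l})"
    using \<psi>(2) by eventually_elim (rule has_vector_derivative_cnj)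
  have "(\<integral>x. cnj (\<psi> x) * (\<i> * ?\<omega> x) \<partial>?M) + (\<integral>x. cnj (h x) * f x \<partial>?M) = cnj (\<psi> l) * f l - cnj (\<psi> 0) * f 0"
    by (rule absolutely_continuous_fun_integral_by_parts[OF _ absolutely_continuous_fun_cnj[OF \<psi>(1)]
          square_integrable_cnj[OF h] cnj\<psi>_deriv f_ac i\<omega> f_deriv]) (use \<open>l > 0\<close> in simp)
  then have "(\<integral>x. cnj (h x) * f x \<partial>?M) = - (\<integral>x. \<i> * (cnj (\<psi> x) * ?\<omega> x) \<partial>?M)"
    by (simp add: \<psi>_ends mult.left_commute[of _ \<i>] eq_neg_iff_add_eq_0 add.commute)
  also have "\<dots> = (\<integral>x. cnj (h x) * ?\<phi> x \<partial>?M)"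
    unfolding integral_mult_right_zero 1[symmetric] by simp
  finally have "(\<integral>x. cnj (h x) * h x \<partial>?M) = 0"
    using integrable_cnj_mult[OF h \<phi>(1)] integrable_cnj_mult[OF h f_sq]
    unfolding h_def[of "_"] f_def[symmetric]
    by (simp add: right_diff_distrib f_def[symmetric] h_def)
  then have "complex_of_real (\<integral>x. (cmod (h x))\<^sup>2 \<partial>?M) = 0"
    unfolding integral_complex_of_real[symmetric] complex_norm_square by (simp only: mult.commute)
  then have "L2_norm ?M h = 0"
    by (simp add: L2_norm_def)
  then have "AE x in ?M. ?\<phi> x = f x"
    using L2_norm_eq_0_iff[OF h] by (simp add: h_def f_def)
  then have \<Phi>_eq: "\<Phi> = L2_class ?M f"
    using L2_class_eq_iff[OF \<phi>(1) f_sq] \<phi>(2) by simp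
  have \<Omega>_eq: "\<Omega> = L2_class ?M (\<lambda>x. - \<i> * (\<i> * ?\<omega> x))"
    using \<omega>(2) by (simp add: mult.assoc[symmetric])
  let ?c = "1 / sqrt (2 * pi)"
  let ?Ff = "\<F> \<Phi>" and ?Fw = "fourier_integral (zero_extend (\<lambda>x. \<i> * ?\<omega> x))"
  have Ff: "fourier_integral (zero_extend f) = ?Ff"
    unfolding \<Phi>_eq interval_fourier_class[OF f_sq] ..
  have Fw: "?Fw \<in> square_integrable lborel"
    by (intro fourier_integral_Bessel zero_extend_integrable i\<omega>) (simp add: zero_extend_square_integrable_iff i\<omega>)
  have "f 0 = 0 \<and> f l = 0"
  proof (rule boundary_values_vanish[OF \<open>l > 0\<close>])
    let ?C = "2 * (2 * pi)"
    show "integrable lborel (\<lambda>x. ?C * (cmod (?Fw x))\<^sup>2)"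
      using square_integrable_integrable[OF Fw] by simp
    show "integrable lborel (\<lambda>x. \<bar>x\<bar> * (?C * (cmod (?Ff x))\<^sup>2))"
      using integrable_mult_right[OF moment, of ?C] by (simp add: mult.left_commute)
    fix x :: real
    let ?e = "fourier_kernel x l"
    have "complex_of_real ?c * (f 0 - ?e * f l) = \<i> * complex_of_real x * ?Ff x - ?Fw x"
      using fourier_integral_derivative[OF _ f_ac i\<omega> f_deriv, of x] \<open>l > 0\<close>
      unfolding Ff by (simp add: algebra_simps)
    then have "(cmod (complex_of_real ?c * (f 0 - ?e * f l)))\<^sup>2 \<le> (\<bar>x\<bar> * cmod (?Ff x) + cmod (?Fw x))\<^sup>2"
      using norm_triangle_ineq4[of "\<i> * complex_of_real x * ?Ff x" "?Fw x"]
      by (intro power_mono) (auto simp: norm_mult)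
    also have "\<dots> \<le> 2 * (x\<^sup>2 * (cmod (?Ff x))\<^sup>2) + 2 * (cmod (?Fw x))\<^sup>2"
      using sum_squares_bound[of "\<bar>x\<bar> * cmod (?Ff x)" "cmod (?Fw x)"]
      by (simp add: power2_sum power_mult_distrib)
    finally have "(cmod (f 0 - ?e * f l))\<^sup>2 / (2 * pi) \<le> 2 * (x\<^sup>2 * (cmod (?Ff x))\<^sup>2) + 2 * (cmod (?Fw x))\<^sup>2"
      by (simp add: norm_mult norm_divide power_divide power_mult_distrib)
    then show "(cmod (f 0 - ?e * f l))\<^sup>2 \<le> ?C * (cmod (?Fw x))\<^sup>2 + x\<^sup>2 * (?C * (cmod (?Ff x))\<^sup>2)"
      by (simp add: divide_le_eq algebra_simps)
  qed simp_all
  then show ?thesis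
    unfolding minimal_momentum_def using f_sq i\<omega> f_ac f_deriv
    by (intro CollectI exI[of _ f] exI[of _ "\<lambda>x. \<i> * ?\<omega> x"] conjI arg_cong2[where f = Pair, OF \<Phi>_eq \<Omega>_eq])
       (simp_all only:)
qed

lemma interval_fourier_adjoint_exists:
  assumes h: "h \<in> square_integrable lborel"
  obtains \<Omega> where "\<Omega> \<in> \<H>" "\<And>\<Psi>. \<Psi> \<in> \<H> \<Longrightarrow> (\<integral>x. cnj (\<F> \<Psi> x) * h x \<partial>lborel) = inner_I \<Psi> \<Omega>"
proof -
  obtain \<Delta> where \<Delta>: "(L2_class lborel h, \<Delta>) \<in> adjoint_op lborel lborel fourier_plancherel"
    using adjoint_fourier_plancherel_total[OF L2_class_in_L2[OF h]] by blast
  then have "\<Delta> \<in> L2 lborel"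
    by (auto simp: adjoint_op_def)
  then obtain \<Omega> where \<Omega>: "(\<Delta>, \<Omega>) \<in> adjoint_op \<I> lborel (zero_extension l)"
    using adjoint_zero_extension_total by blast
  show thesis
  proof (rule that[of \<Omega>])
    show "\<Omega> \<in> \<H>"
      using \<Omega> by (auto simp: adjoint_op_def)
    fix \<Psi> assume \<Psi>: "\<Psi> \<in> \<H>"
    show "(\<integral>x. cnj (\<F> \<Psi> x) * h x \<partial>lborel) = inner_I \<Psi> \<Omega>"
      using adjoint_interval_fourier[OF \<Delta> \<Omega> \<Psi>] L2_inner_class[OF interval_fourier_square_integrable[OF \<Psi>] h]
      by (metis L2_inner_commute)
  qed
qed

lemma integrable_fourier_moment:
  assumes "\<Phi> \<in> \<H>" and "integrable lborel (\<lambda>x. \<bar>x\<bar> ^ k * (cmod (\<F> \<Phi> x))\<^sup>2)" and "j \<le> k"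
  shows "integrable lborel (\<lambda>x. \<bar>x\<bar> ^ j * (cmod (\<F> \<Phi> x))\<^sup>2)"
proof (rule Bochner_Integration.integrable_bound)
  let ?F = "\<lambda>x. (cmod (\<F> \<Phi> x))\<^sup>2"
  note F2 = interval_fourier_square_integrable[OF assms(1)]
  show "integrable lborel (\<lambda>x. ?F x + \<bar>x\<bar> ^ k * ?F x)"
    using square_integrable_integrable[OF F2] assms(2) by simp
  have [measurable]: "\<F> \<Phi> \<in> borel_measurable borel"
    using square_integrable_measurable[OF F2] by simp
  show "(\<lambda>x. \<bar>x\<bar> ^ j * ?F x) \<in> borel_measurable lborel"
    by measurable
  have "\<bar>x\<bar> ^ j \<le> 1 + \<bar>x\<bar> ^ k" for x :: real
  proof (cases "\<bar>x\<bar> \<le> 1")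
    case True
    then show ?thesis
      using power_le_one[of "\<bar>x\<bar>" j] by (simp add: add_increasing2)
  next
    case False
    then have "\<bar>x\<bar> ^ j \<le> \<bar>x\<bar> ^ k"
      using \<open>j \<le> k\<close> by (intro power_increasing) auto
    then show ?thesis by linarith
  qed
  from mult_right_mono[OF this, of "?F _"]
  have "\<bar>x\<bar> ^ j * ?F x \<le> ?F x + \<bar>x\<bar> ^ k * ?F x" for x
    by (simp add: distrib_right)
  then show "AE x in lborel. norm (\<bar>x\<bar> ^ j * ?F x) \<le> norm (?F x + \<bar>x\<bar> ^ k * ?F x)"
    by (intro AE_I2) simp
qed

text \<open>
  If \<open>x \<phi>\<close> is square integrable in the Fourier picture, its image under the adjoint transform is
  the value of the adjoint momentum operator.
\<close>

lemma minimal_momentum_total: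
  assumes "l > 0" and \<Phi>: "\<Phi> \<in> \<H>"
    and i: "integrable lborel (\<lambda>x. \<bar>x\<bar> ^ 2 * (cmod (\<F> \<Phi> x))\<^sup>2)"
  obtains \<Psi> where "(\<Phi>, \<Psi>) \<in> P\<^sub>0"
proof -
  let ?h = "\<lambda>x. complex_of_real x * \<F> \<Phi> x"
  have [measurable]: "\<F> \<Phi> \<in> borel_measurable borel"
    using square_integrable_measurable[OF interval_fourier_square_integrable[OF \<Phi>]] by simp
  have h: "?h \<in> square_integrable lborel"
    using i by (intro square_integrableI) (simp_all add: norm_mult power_mult_distrib)
  obtain \<Omega> where \<Omega>: "\<Omega> \<in> \<H>"
    "\<And>\<Psi>. \<Psi> \<in> \<H> \<Longrightarrow> (\<integral>x. cnj (\<F> \<Psi> x) * ?h x \<partial>lborel) = inner_I \<Psi> \<Omega>"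
    using interval_fourier_adjoint_exists[OF h] by blast
  have "(\<Phi>, \<Omega>) \<in> P\<^sub>0"
  proof (rule minimal_momentum_if_adjoint[OF \<open>l > 0\<close> \<Phi> \<Omega>(1)])
    show "integrable lborel (\<lambda>x. \<bar>x\<bar> * (cmod (\<F> \<Phi> x))\<^sup>2)"
      using integrable_fourier_moment[OF \<Phi> i, of 1] by simp
    fix \<Psi> \<Psi>' assume P: "(\<Psi>, \<Psi>') \<in> P\<^sub>0"
    note L = minimal_momentum_L2[OF P]
    have "inner_I \<Psi>' \<Phi> = (\<integral>x. cnj (\<F> \<Psi>' x) * \<F> \<Phi> x \<partial>lborel)"
      by (rule interval_fourier_parseval[OF L(2) \<Phi>, symmetric])
    also have "\<dots> = (\<integral>x. cnj (\<F> \<Psi> x) * ?h x \<partial>lborel)"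
      using \<open>l > 0\<close> by (intro Bochner_Integration.integral_cong) (simp_all add: minimal_momentum_fourier[OF _ P])
    also have "\<dots> = inner_I \<Psi> \<Omega>"
      by (rule \<Omega>(2)[OF L(1)])
    finally show "inner_I \<Psi>' \<Phi> = inner_I \<Psi> \<Omega>" .
  qed
  then show thesis
    by (rule that)
qed

lemma minimal_momentum_relpow_fourier:
  assumes "0 \<le> l" and "\<Phi> \<in> \<H>" and "(\<Phi>, \<Psi>) \<in> P\<^sub>0 ^^ n"
  shows "\<Psi> \<in> \<H> \<and> \<F> \<Psi> = (\<lambda>x. complex_of_real x ^ n * \<F> \<Phi> x)"
  using assms(3)
proof (induction n arbitrary: \<Psi>)
  case 0
  then show ?case
    using assms(2) by simp
next
  case (Suc n)
  then obtain X where X: "(\<Phi>, X) \<in> P\<^sub>0 ^^ n" "(X, \<Psi>) \<in> P\<^sub>0"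
    by auto
  show ?case
    using Suc.IH[OF X(1)] minimal_momentum_L2[OF X(2)] minimal_momentum_fourier[OF \<open>0 \<le> l\<close> X(2)]
    by (auto simp: fun_eq_iff mult.assoc)
qed

text \<open>
  Finiteness of the moment of order \<open>2 n + 2\<close> includes that of order \<open>2\<close>, so \<open>P\<^sub>0\<close> can be applied
  once; the image has a finite moment of order \<open>2 n\<close>.
\<close>

lemma minimal_momentum_relpow_total:
  assumes "l > 0" and "\<Phi> \<in> \<H>"
    and "integrable lborel (\<lambda>x. \<bar>x\<bar> ^ (2 * n) * (cmod (\<F> \<Phi> x))\<^sup>2)"
  obtains \<Psi> where "(\<Phi>, \<Psi>) \<in> P\<^sub>0 ^^ n"
proof -
  have "\<exists>\<Psi>. (\<Phi>, \<Psi>) \<in> P\<^sub>0 ^^ n"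
    using assms(2,3)
  proof (induction n arbitrary: \<Phi>)
    case 0
    then show ?case by auto
  next
    case (Suc n)
    obtain X where X: "(\<Phi>, X) \<in> P\<^sub>0"
      using minimal_momentum_total[OF \<open>l > 0\<close> Suc.prems(1) integrable_fourier_moment[OF Suc.prems]] by auto
    have moment: "\<bar>x\<bar> ^ (2 * n) * (cmod (\<F> X x))\<^sup>2 = \<bar>x\<bar> ^ (2 * Suc n) * (cmod (\<F> \<Phi> x))\<^sup>2" for x
      using minimal_momentum_fourier[OF _ X, of x] \<open>l > 0\<close>
      by (simp add: norm_mult power_mult_distrib power2_eq_square mult_ac)
    have "\<exists>\<Psi>. (X, \<Psi>) \<in> P\<^sub>0 ^^ n"
      using Suc.prems(2) by (intro Suc.IH minimal_momentum_L2[OF X]) (simp only: moment)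
    then show ?case
      using X relpow_Suc_I2 by metis
  qed
  then show thesis
    using that by blast
qed

lemma moment_domain_even_iff:
  assumes "l > 0"
  shows "\<Phi> \<in> \<D> (2 * n) \<longleftrightarrow>
    \<Phi> \<in> \<H> \<and> (\<exists>\<Psi>. (\<Phi>, \<Psi>) \<in> P\<^sub>0 ^^ n)"
proof safe
  assume "\<Phi> \<in> \<D> (2 * n)"
  then have *: "\<Phi> \<in> \<H>" "integrable lborel (\<lambda>x. \<bar>x\<bar> ^ (2 * n) * (cmod (\<F> \<Phi> x))\<^sup>2)"
    by (auto simp: moment_domain_iff)
  then show "\<Phi> \<in> \<H>" "\<exists>\<Psi>. (\<Phi>, \<Psi>) \<in> P\<^sub>0 ^^ n"
    using minimal_momentum_relpow_total[OF \<open>l > 0\<close> *] by auto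
next
  fix \<Psi> assume \<Phi>: "\<Phi> \<in> \<H>" and P: "(\<Phi>, \<Psi>) \<in> P\<^sub>0 ^^ n"
  have \<Psi>: "\<Psi> \<in> \<H>" "\<F> \<Psi> = (\<lambda>x. complex_of_real x ^ n * \<F> \<Phi> x)"
    using minimal_momentum_relpow_fourier[OF _ \<Phi> P] \<open>l > 0\<close> by auto
  have "(cmod (\<F> \<Psi> x))\<^sup>2 = \<bar>x\<bar> ^ (2 * n) * (cmod (\<F> \<Phi> x))\<^sup>2" for x
    unfolding \<Psi>(2) by (simp add: norm_mult norm_power power_mult_distrib power_mult[symmetric] mult.commute)
  then show "\<Phi> \<in> \<D> (2 * n)"
    using square_integrable_integrable[OF interval_fourier_square_integrable[OF \<Psi>(1)]] \<Phi> by (simp add: moment_domain_iff)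
qed

section \<open>Identification of the weak moment operators\<close>

text \<open>
  The domain of the first moment form is larger than the domain of \<open>P\<^sub>0\<close>. The representation by a vector
  is used only against \<open>\<psi>\<close> in the smaller domain, where \<open>x\<close> can be moved to \<open>\<F> \<psi>\<close>.
\<close>

theorem weak_moment_1_eq:
  assumes "l > 0"
  shows "weak_moment \<I> (momentum_povm l) 1 = P\<^sub>0"
proof -
  let ?D = "\<D> 1"
  have dom: "\<Phi> \<in> ?D" if P: "(\<Phi>, \<Psi>) \<in> P\<^sub>0" for \<Phi> \<Psi>
  proof -
    have "\<Phi> \<in> \<D> (2 * 1)"
      using moment_domain_even_iff[OF \<open>l > 0\<close>, of \<Phi> 1] minimal_momentum_L2[OF P] P by auto
    then show ?thesis
      unfolding moment_domain_iff using integrable_fourier_moment[of \<Phi> 2 1] by simp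
  qed
  have "(\<Phi>, \<Omega>) \<in> weak_moment \<I> (momentum_povm l) 1 \<longleftrightarrow> (\<Phi>, \<Omega>) \<in> P\<^sub>0" for \<Phi> \<Omega>
  proof
    assume "(\<Phi>, \<Omega>) \<in> weak_moment \<I> (momentum_povm l) 1"
    then have W: "\<Phi> \<in> ?D" "\<Omega> \<in> \<H>"
      and eq: "\<And>\<Psi>. \<Psi> \<in> ?D \<Longrightarrow> inner_I \<Psi> \<Omega>
        = (\<integral>x. complex_of_real x ^ 1 * (cnj (\<F> \<Psi> x) * \<F> \<Phi> x) \<partial>lborel)"
      unfolding weak_moment_iff by blast+
    then have \<Phi>: "\<Phi> \<in> \<H>" "integrable lborel (\<lambda>x. \<bar>x\<bar> * (cmod (\<F> \<Phi> x))\<^sup>2)"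
      by (simp_all add: moment_domain_iff)
    show "(\<Phi>, \<Omega>) \<in> P\<^sub>0"
    proof (rule minimal_momentum_if_adjoint[OF \<open>l > 0\<close> \<Phi>(1) W(2) \<Phi>(2)])
      fix \<Psi> \<Psi>' assume P: "(\<Psi>, \<Psi>') \<in> P\<^sub>0"
      have "inner_I \<Psi>' \<Phi> = (\<integral>x. cnj (\<F> \<Psi>' x) * \<F> \<Phi> x \<partial>lborel)"
        by (rule interval_fourier_parseval[OF minimal_momentum_L2(2)[OF P] \<Phi>(1), symmetric])
      also have "\<dots> = inner_I \<Psi> \<Omega>"
        unfolding eq[OF dom[OF P]] using \<open>l > 0\<close>
        by (intro Bochner_Integration.integral_cong) (simp_all add: minimal_momentum_fourier[OF _ P] mult.assoc)
      finally show "inner_I \<Psi>' \<Phi> = inner_I \<Psi> \<Omega>" .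
    qed
  next
    assume P: "(\<Phi>, \<Omega>) \<in> P\<^sub>0"
    note L = minimal_momentum_L2[OF P]
    have "inner_I \<Psi> \<Omega>
        = (\<integral>x. complex_of_real x ^ 1 * (cnj (\<F> \<Psi> x) * \<F> \<Phi> x) \<partial>lborel)"
      if "\<Psi> \<in> ?D" for \<Psi>
    proof -
      have "\<Psi> \<in> \<H>"
        using that by (simp add: moment_domain_iff)
      from interval_fourier_parseval[OF this L(2)] show ?thesis
        using \<open>l > 0\<close> by (simp add: minimal_momentum_fourier[OF _ P] mult.left_commute)
    qed
    then show "(\<Phi>, \<Omega>) \<in> weak_moment \<I> (momentum_povm l) 1"
      unfolding weak_moment_iff using dom[OF P] L by blast
  qed
  then show ?thesis
    by auto
qed

text \<open>
  Both sides are the operator of the quadratic form \<open>\<parallel>P\<^sub>0\<^sup>n \<phi>\<parallel>\<^sup>2\<close>, whose form domain is the domain of \<open>P\<^sub>0\<^sup>n\<close>.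
\<close>

theorem weak_moment_even_eq:
  assumes "l > 0" "n \<ge> 1"
  shows "weak_moment \<I> (momentum_povm l) (2 * n) =
    (P\<^sub>0 ^^ n) O
      adjoint_op \<I> \<I> (P\<^sub>0 ^^ n)"
proof -
  let ?D = "\<D> (2 * n)"
  let ?T = "P\<^sub>0 ^^ n"
  have T_L2: "\<Phi> \<in> \<H>" if "(\<Phi>, \<Psi>) \<in> ?T" for \<Phi> \<Psi>
  proof -
    obtain k where k: "n = Suc k"
      using \<open>n \<ge> 1\<close> by (cases n) auto
    then obtain X where "(\<Phi>, X) \<in> P\<^sub>0"
      using relpow_Suc_D2[of \<Phi> \<Psi> k "P\<^sub>0"] \<open>(\<Phi>, \<Psi>) \<in> ?T\<close> by auto
    then show ?thesis
      by (rule minimal_momentum_L2)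
  qed
  have T_dom: "\<Phi> \<in> ?D \<longleftrightarrow> (\<exists>\<Psi>. (\<Phi>, \<Psi>) \<in> ?T)" for \<Phi>
    using moment_domain_even_iff[OF \<open>l > 0\<close>, of \<Phi> n] T_L2 by blast
  have T_fourier: "\<Psi> \<in> \<H>" "\<F> \<Psi> = (\<lambda>x. complex_of_real x ^ n * \<F> \<Phi> x)"
    if "(\<Phi>, \<Psi>) \<in> ?T" for \<Phi> \<Psi>
    using minimal_momentum_relpow_fourier[OF _ T_L2[OF that] that] \<open>l > 0\<close> by auto
  have double: "c ^ (n * 2) = c ^ n * c ^ n" for c :: complex
    by (simp add: mult_2_right power_add)
  have form: "(\<integral>x. complex_of_real x ^ (2 * n) * (cnj (\<F> \<Psi> x) * \<F> \<Phi> x) \<partial>lborel)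
      = inner_I \<Psi>' \<Phi>'"
    if "(\<Psi>, \<Psi>') \<in> ?T" "(\<Phi>, \<Phi>') \<in> ?T" for \<Phi> \<Phi>' \<Psi> \<Psi>'
    unfolding interval_fourier_parseval[OF T_fourier(1)[OF that(1)] T_fourier(1)[OF that(2)], symmetric]
      T_fourier(2)[OF that(1)] T_fourier(2)[OF that(2)]
    by (intro Bochner_Integration.integral_cong)      (simp_all add: double mult_ac)
  have "(\<Phi>, \<Omega>) \<in> weak_moment \<I> (momentum_povm l) (2 * n) \<longleftrightarrow>
      (\<Phi>, \<Omega>) \<in> ?T O adjoint_op \<I> \<I> ?T" for \<Phi> \<Omega>
  proof
    assume "(\<Phi>, \<Omega>) \<in> weak_moment \<I> (momentum_povm l) (2 * n)"
    then have W: "\<Phi> \<in> ?D" "\<Omega> \<in> \<H>"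
      and eq: "\<And>\<Psi>. \<Psi> \<in> ?D \<Longrightarrow> inner_I \<Psi> \<Omega>
        = (\<integral>x. complex_of_real x ^ (2 * n) * (cnj (\<F> \<Psi> x) * \<F> \<Phi> x) \<partial>lborel)"
      unfolding weak_moment_iff by blast+
    obtain \<Phi>' where \<Phi>': "(\<Phi>, \<Phi>') \<in> ?T"
      using W(1) T_dom by blast
    have "inner_I \<Phi>' \<Psi>' = inner_I \<Omega> \<Psi>" if "(\<Psi>, \<Psi>') \<in> ?T" for \<Psi> \<Psi>'
      using eq[of \<Psi>] T_dom that form[OF that \<Phi>'] by (metis L2_inner_commute)
    then have "(\<Phi>', \<Omega>) \<in> adjoint_op \<I> \<I> ?T"
      using W(2) T_fourier(1)[OF \<Phi>'] by (auto simp: adjoint_op_def)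
    then show "(\<Phi>, \<Omega>) \<in> ?T O adjoint_op \<I> \<I> ?T"
      using \<Phi>' by blast
  next
    assume "(\<Phi>, \<Omega>) \<in> ?T O adjoint_op \<I> \<I> ?T"
    then obtain \<Phi>' where \<Phi>': "(\<Phi>, \<Phi>') \<in> ?T" "(\<Phi>', \<Omega>) \<in> adjoint_op \<I> \<I> ?T"
      by blast
    have \<Omega>: "\<Omega> \<in> \<H>"
      and adj: "\<And>\<Psi> \<Psi>'. (\<Psi>, \<Psi>') \<in> ?T \<Longrightarrow> inner_I \<Phi>' \<Psi>' = inner_I \<Omega> \<Psi>"
      using \<Phi>'(2) by (auto simp: adjoint_op_def)
    have "inner_I \<Psi> \<Omega>
        = (\<integral>x. complex_of_real x ^ (2 * n) * (cnj (\<F> \<Psi> x) * \<F> \<Phi> x) \<partial>lborel)"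
      if "\<Psi> \<in> ?D" for \<Psi>
    proof -
      obtain \<Psi>' where \<Psi>': "(\<Psi>, \<Psi>') \<in> ?T"
        using T_dom \<open>\<Psi> \<in> ?D\<close> by blast
      then show ?thesis
        using adj[OF \<Psi>'] form[OF \<Psi>' \<Phi>'(1)] by (metis L2_inner_commute)
    qed
    moreover have "\<Phi> \<in> ?D"
      using T_dom \<Phi>'(1) by blast
    ultimately show "(\<Phi>, \<Omega>) \<in> weak_moment \<I> (momentum_povm l) (2 * n)"
      unfolding weak_moment_iff using \<Omega> by blast
  qed
  then show ?thesis
    by auto
qed

end

theorem proposition19:
  fixes l :: real
  assumes "l > 0"
  shows "weak_moment (interval_lborel l) (momentum_povm l) 1 = minimal_momentum l \<and>
         (\<forall>n\<ge>1. weak_moment (interval_lborel l) (momentum_povm l) (2 * n) =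
            (minimal_momentum l ^^ n) O
              adjoint_op (interval_lborel l) (interval_lborel l) (minimal_momentum l ^^ n))"
  using weak_moment_1_eq[OF assms] weak_moment_even_eq[OF assms] by blast

end
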